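(* Let $n\in\{2,3,4\}$, let $\Sigma$ be a closed Riemann surface of genus $\ge2$ and let $q_n$ be a holomorphic $n$-differential on $\Sigma$. Let $(\tilde E,\tilde\phi)$ be a cyclic Higgs bundle in the Hitchin component parameterized by $q_n$, and let $(E,\phi)$ be a cyclic $SL(n,\mathbb{R})$-Higgs bundle over $\Sigma$, distinct from $(\tilde E,\tilde\phi)$, such that $\det\phi=(-1)^{n-1}q_n$. Then the pullback metrics $g,\tilde g$ of the harmonic maps corresponding to $(E,\phi)$ and $(\tilde E,\tilde\phi)$ satisfy $g<\tilde g$ on $\Sigma$ (i.e. $\tilde g-g$ is positive definite at every point).
   Context: Let $K$ be the canonical bundle of $\Sigma$. Cyclic $SL(n,\mathbb{R})$-Higgs bundles for $n=2,3,4$ are the following pairs $(E,\phi)$, where $L,L_1,L_2$ are holomorphic line bundles, all arrows are the only nonzero components of $\phi\in H^0(\mathrm{End}(E)\otimes K)$, and all the listed sections except possibly $\nu$ are not identically zero; if $\nu=0$ the Higgs bundle is assumed stable. - $n=2$: $E=L\oplus L^{-1}$, $\mu:L\to L^{-1}K$, $\nu:L^{-1}\to LK$ (so $\mu\nu=q_2$). - $n=3$: $E=L\oplus\mathcal{O}\oplus L^{-1}$, $\mu:L\to \mathcal{O}\otimes K$, the same section $\mu:\mathcal{O}\to L^{-1}K$, $\nu:L^{-1}\to LK$ (so $\mu^2\nu=q_3$). - $n=4$: $E=L_1\oplus L_2\oplus L_2^{-1}\oplus L_1^{-1}$, $\gamma:L_1\to L_2K$, $\mu:L_2\to L_2^{-1}K$,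 the same section $\gamma:L_2^{-1}\to L_1^{-1}K$, $\nu:L_1^{-1}\to L_1K$ (so $\gamma^2\mu\nu=q_4$). The cyclic Higgs bundle in the Hitchin component parameterized by $q_n$ is $\tilde E=K^{\frac{n-1}{2}}\oplus K^{\frac{n-3}{2}}\oplus\cdots\oplus K^{\frac{1-n}{2}}$ (with a choice of $K^{1/2}$ if $n$ is even); writing $\tilde L_k=K^{\frac{n+1-2k}{2}}$, the Higgs field $\tilde\phi$ has all components $\tilde L_k\to\tilde L_{k+1}K$, $1\le k\le n-1$, equal to $1$, and last component $q_n:\tilde L_n\to\tilde L_1K$, all others zero. The harmonic metric $h$ of $(E,\phi)$ is the (diagonal) Hermitian metric with trivial determinant solving the Hitchin equation $F^{\nabla^h}+[\phi,\phi^{*_h}]=0$, with $\nabla^h$ the Chern connection and $\phi^{*_h}$ the $h$-adjoint. It defines an equivariant harmonic map from $\widetilde\Sigma$ to $SL(n,\mathbb{C})/SU(n)$ with the metric induced by $B(X,Y)=2n\,\mathrm{tr}(XY)$. The pullback metric is the symmetric tensor $g(X,Y)=B\big((\phi+\phi^{*_h})(X),(\phi+\phi^{*_h})(Y)\big)$ on $\Sigma$; for $n\ge3$ it is of type $(1,1)$ and equals, as a Hermitian form, $2n\,\mathrm{tr}(\phi\phi^{*_h})dz\otimes d\bar z$; for $n=2$ it has in addition the $(2,0)$-part $2n\,\mathrm{tr}(\phi^2)$ and its conjugate. The metric $\tilde g$ is defined in the same way from $(\tilde E,\tilde\phi)$.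
   Formalization: "Distinct" is read as: not isomorphic, as a Higgs bundle, to a cyclic Higgs bundle in the Hitchin component parameterized by q_n for any choice of K^{1/2}; for n even another choice of K^{1/2} gives a distinct bundle with the same pullback metric, so g<g̃ would fail. *)

theory Defs
  imports
    "HOL-Complex_Analysis.Complex_Analysis"
    "HOL-Homology.Homology"
    "Jordan_Normal_Form.Determinant"
    "Jordan_Normal_Form.Gauss_Jordan_Elimination"
    "Jordan_Normal_Form.Schur_Decomposition"
begin

section \<open>Closed Riemann surfaces\<close>

text \<open>
  A chart is a pair of a domain and a coordinate. The surface is the whole type, and
  everything on it is written in the charts of one fixed holomorphic atlas.
\<close>

type_synonym 'a chart = "'a set \<times> ('a \<Rightarrow> complex)"

abbreviation cdom :: "'a chart \<Rightarrow> 'a set" where "cdom c \<equiv> fst c"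
abbreviation coord :: "'a chart \<Rightarrow> 'a \<Rightarrow> complex" where "coord c \<equiv> snd c"

definition chart_inv :: "'a chart \<Rightarrow> complex \<Rightarrow> 'a" where
  "chart_inv c = inv_into (cdom c) (coord c)"

definition holomorphic_atlas :: "'a::topological_space chart set \<Rightarrow> bool" where
  "holomorphic_atlas A \<longleftrightarrow>
     (\<Union>c\<in>A. cdom c) = UNIV \<and>
     (\<forall>c\<in>A. open (cdom c) \<and> open (coord c ` cdom c) \<and>
        homeomorphism (cdom c) (coord c ` cdom c) (coord c) (chart_inv c)) \<and>
     (\<forall>c\<in>A. \<forall>d\<in>A.
        (\<lambda>w. coord d (chart_inv c w)) holomorphic_on (coord c ` (cdom c \<inter> cdom d)))"

definition closed_riemann_surface :: "'a::t2_space chart set \<Rightarrow> bool" where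
  "closed_riemann_surface A \<longleftrightarrow>
     holomorphic_atlas A \<and> compact (UNIV :: 'a set) \<and> connected (UNIV :: 'a set)"

text \<open>The genus of a closed orientable surface: \<open>H\<^sub>1(X; \<int>)\<close> is free abelian of rank \<open>2g\<close>.\<close>

definition has_genus :: "'a topology \<Rightarrow> nat \<Rightarrow> bool" where
  "has_genus X g \<longleftrightarrow> homology_group 1 X \<cong> free_Abelian_group {..<2 * g}"

definition holomorphic_in :: "'a chart \<Rightarrow> ('a \<Rightarrow> complex) \<Rightarrow> bool" where
  "holomorphic_in c f \<longleftrightarrow> (\<lambda>w. f (chart_inv c w)) holomorphic_on (coord c ` cdom c)"


section \<open>Holomorphic line bundles and their sections\<close>

text \<open>
  A line bundle is given by its transition functions over the charts of the atlas: \<open>L c d\<close>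
  takes components in the frame over \<open>d\<close> to components in the frame over \<open>c\<close>, that is
  \<open>s c p = L c d p * s d p\<close> for a section \<open>s\<close>. Chart domains are open subsets of the plane up
  to isomorphism, and holomorphic vector bundles over those are trivial, so every
  holomorphic line bundle, and every holomorphic vector bundle, arises in this way from
  any given atlas.
\<close>

type_synonym 'a lbundle = "'a chart \<Rightarrow> 'a chart \<Rightarrow> 'a \<Rightarrow> complex"
type_synonym 'a section_of = "'a chart \<Rightarrow> 'a \<Rightarrow> complex"

definition line_bundle :: "'a chart set \<Rightarrow> 'a lbundle \<Rightarrow> bool" where
  "line_bundle A L \<longleftrightarrow>
     (\<forall>c\<in>A. \<forall>d\<in>A.
        (\<lambda>w. L c d (chart_inv c w)) holomorphic_on (coord c ` (cdom c \<inter> cdom d))) \<and>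
     (\<forall>c\<in>A. \<forall>p\<in>cdom c. L c c p = 1) \<and>
     (\<forall>c\<in>A. \<forall>d\<in>A. \<forall>e\<in>A. \<forall>p\<in>cdom c \<inter> cdom d \<inter> cdom e. L c e p = L c d p * L d e p)"

definition trivial_lb :: "'a lbundle" where
  "trivial_lb c d p = 1"

definition tensor_lb :: "'a lbundle \<Rightarrow> 'a lbundle \<Rightarrow> 'a lbundle" where
  "tensor_lb L M c d p = L c d p * M c d p"

definition power_lb :: "'a lbundle \<Rightarrow> int \<Rightarrow> 'a lbundle" where
  "power_lb L m c d p = L c d p powi m"

abbreviation dual_lb :: "'a lbundle \<Rightarrow> 'a lbundle" where
  "dual_lb L \<equiv> power_lb L (-1)"

definition hom_lb :: "'a lbundle \<Rightarrow> 'a lbundle \<Rightarrow> 'a lbundle" where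
  "hom_lb L M = tensor_lb (dual_lb L) M"

text \<open>The canonical bundle in the frames \<open>dz\<^sub>c\<close>, with transition functions \<open>dz\<^sub>d / dz\<^sub>c\<close>.\<close>

definition canonical_lb :: "'a lbundle" where
  "canonical_lb c d p = deriv (\<lambda>w. coord d (chart_inv c w)) (coord c p)"

definition holomorphic_section :: "'a chart set \<Rightarrow> 'a lbundle \<Rightarrow> 'a section_of \<Rightarrow> bool" where
  "holomorphic_section A L s \<longleftrightarrow>
     (\<forall>c\<in>A. holomorphic_in c (s c)) \<and>
     (\<forall>c\<in>A. \<forall>d\<in>A. \<forall>p\<in>cdom c \<inter> cdom d. s c p = L c d p * s d p)"

definition zero_section :: "'a chart set \<Rightarrow> 'a section_of \<Rightarrow> bool" where
  "zero_section A s \<longleftrightarrow> (\<forall>c\<in>A. \<forall>p\<in>cdom c. s c p = 0)"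

definition holomorphic_differential ::
    "'a chart set \<Rightarrow> nat \<Rightarrow> 'a section_of \<Rightarrow> bool" where
  "holomorphic_differential A n q \<longleftrightarrow>
     holomorphic_section A (power_lb canonical_lb (int n)) q"

text \<open>
  A section of \<open>Hom(L, M \<otimes> K)\<close>, written \<open>L \<rightarrow> M K\<close> in the sequel.
\<close>

abbreviation twisted_hom ::
    "'a chart set \<Rightarrow> 'a lbundle \<Rightarrow> 'a lbundle \<Rightarrow> 'a section_of \<Rightarrow> bool" where
  "twisted_hom A L M s \<equiv> holomorphic_section A (hom_lb L (tensor_lb M canonical_lb)) s"


section \<open>Degree\<close>

text \<open>
  The second conjunct excludes sections that vanish identically near some point; since
  \<open>meromorphic_on\<close> does not constrain values on a discrete set, it is stated on punctured
  neighbourhoods.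
\<close>

definition nonzero_meromorphic_section ::
    "'a chart set \<Rightarrow> 'a lbundle \<Rightarrow> 'a section_of \<Rightarrow> bool" where
  "nonzero_meromorphic_section A L s \<longleftrightarrow>
     (\<forall>c\<in>A. (\<lambda>w. s c (chart_inv c w)) meromorphic_on (coord c ` cdom c)) \<and>
     (\<forall>c\<in>A. \<forall>p\<in>cdom c. \<exists>\<^sub>F w in at (coord c p). s c (chart_inv c w) \<noteq> 0) \<and>
     (\<forall>c\<in>A. \<forall>d\<in>A. \<forall>p\<in>cdom c \<inter> cdom d. s c p = L c d p * s d p)"

definition section_order :: "'a chart set \<Rightarrow> 'a section_of \<Rightarrow> 'a \<Rightarrow> int" where
  "section_order A s p =
     (let c = (SOME c. c \<in> A \<and> p \<in> cdom c)
      in zorder (\<lambda>w. s c (chart_inv c w)) (coord c p))"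

text \<open>Zeros minus poles of any nonzero meromorphic section.\<close>

definition degree_lb :: "'a chart set \<Rightarrow> 'a lbundle \<Rightarrow> int" where
  "degree_lb A L = (THE deg. \<exists>s. nonzero_meromorphic_section A L s \<and>
     deg = (\<Sum>p | section_order A s p \<noteq> 0. section_order A s p))"


section \<open>Holomorphic vector bundles and Higgs bundles\<close>

type_synonym 'a vbundle = "'a chart \<Rightarrow> 'a chart \<Rightarrow> 'a \<Rightarrow> complex mat"

text \<open>
  A matrix-valued local object: an endomorphism-valued 1-form \<open>\<phi> = \<phi> c dz\<^sub>c\<close>, a Hermitian
  metric, or a bundle map, in the frames over \<open>c\<close>.
\<close>

type_synonym 'a matrix_field = "'a chart \<Rightarrow> 'a \<Rightarrow> complex mat"

definition holomorphic_mat_in ::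
    "'a chart \<Rightarrow> nat \<Rightarrow> nat \<Rightarrow> ('a \<Rightarrow> complex mat) \<Rightarrow> bool" where
  "holomorphic_mat_in c n m f \<longleftrightarrow>
     (\<forall>p\<in>cdom c. f p \<in> carrier_mat n m) \<and>
     (\<forall>i<n. \<forall>j<m. holomorphic_in c (\<lambda>p. f p $$ (i, j)))"

definition vector_bundle :: "'a chart set \<Rightarrow> nat \<Rightarrow> 'a vbundle \<Rightarrow> bool" where
  "vector_bundle A n E \<longleftrightarrow>
     (\<forall>c\<in>A. \<forall>d\<in>A. (\<forall>p\<in>cdom c \<inter> cdom d. E c d p \<in> carrier_mat n n) \<and>
        (\<forall>i<n. \<forall>j<n. (\<lambda>w. E c d (chart_inv c w) $$ (i, j))
            holomorphic_on (coord c ` (cdom c \<inter> cdom d)))) \<and>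
     (\<forall>c\<in>A. \<forall>p\<in>cdom c. E c c p = 1\<^sub>m n) \<and>
     (\<forall>c\<in>A. \<forall>d\<in>A. \<forall>e\<in>A. \<forall>p\<in>cdom c \<inter> cdom d \<inter> cdom e. E c e p = E c d p * E d e p)"

definition det_lb :: "'a vbundle \<Rightarrow> 'a lbundle" where
  "det_lb E c d p = Determinant.det (E c d p)"

text \<open>
  A Higgs bundle of rank \<open>n\<close>: the condition on overlaps says that the \<open>\<phi> c dz\<^sub>c\<close> define a
  section of \<open>End(E) \<otimes> K\<close>.
\<close>

definition higgs_bundle :: "'a chart set \<Rightarrow> nat \<Rightarrow> 'a vbundle \<Rightarrow> 'a matrix_field \<Rightarrow> bool" where
  "higgs_bundle A n E \<phi> \<longleftrightarrow>
     vector_bundle A n E \<and>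
     (\<forall>c\<in>A. holomorphic_mat_in c n n (\<phi> c)) \<and>
     (\<forall>c\<in>A. \<forall>d\<in>A. \<forall>p\<in>cdom c \<inter> cdom d.
        \<phi> c p * E c d p = canonical_lb c d p \<cdot>\<^sub>m (E c d p * \<phi> d p))"

text \<open>
  A \<open>\<phi>\<close>-invariant holomorphic subbundle \<open>F\<close> of rank \<open>k\<close>, with its inclusion \<open>\<iota>\<close> into \<open>E\<close>.
\<close>

definition invariant_subbundle ::
    "'a chart set \<Rightarrow> nat \<Rightarrow> 'a vbundle \<Rightarrow> 'a matrix_field \<Rightarrow>
     nat \<Rightarrow> 'a vbundle \<Rightarrow> 'a matrix_field \<Rightarrow> bool" where
  "invariant_subbundle A n E \<phi> k F \<iota> \<longleftrightarrow>
     vector_bundle A k F \<and>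
     (\<forall>c\<in>A. holomorphic_mat_in c n k (\<iota> c)) \<and>
     (\<forall>c\<in>A. \<forall>p\<in>cdom c. \<forall>v\<in>carrier_vec k. \<iota> c p *\<^sub>v v = 0\<^sub>v n \<longrightarrow> v = 0\<^sub>v k) \<and>
     (\<forall>c\<in>A. \<forall>d\<in>A. \<forall>p\<in>cdom c \<inter> cdom d. \<iota> c p * F c d p = E c d p * \<iota> d p) \<and>
     (\<forall>c\<in>A. \<forall>p\<in>cdom c. \<exists>M\<in>carrier_mat k k. \<phi> c p * \<iota> c p = \<iota> c p * M)"

text \<open>Slope stability, \<open>deg F / k < deg E / n\<close>, with denominators cleared.\<close>

definition stable_higgs :: "'a chart set \<Rightarrow> nat \<Rightarrow> 'a vbundle \<Rightarrow> 'a matrix_field \<Rightarrow> bool" where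
  "stable_higgs A n E \<phi> \<longleftrightarrow>
     higgs_bundle A n E \<phi> \<and>
     (\<forall>k F \<iota>. 0 < k \<and> k < n \<and> invariant_subbundle A n E \<phi> k F \<iota> \<longrightarrow>
        degree_lb A (det_lb F) * int n < degree_lb A (det_lb E) * int k)"

definition isomorphic_higgs ::
    "'a chart set \<Rightarrow> nat \<Rightarrow> 'a vbundle \<Rightarrow> 'a matrix_field \<Rightarrow>
     'a vbundle \<Rightarrow> 'a matrix_field \<Rightarrow> bool" where
  "isomorphic_higgs A n E \<phi> E' \<phi>' \<longleftrightarrow>
     (\<exists>f. (\<forall>c\<in>A. holomorphic_mat_in c n n (f c)) \<and>
          (\<forall>c\<in>A. \<forall>p\<in>cdom c. Determinant.det (f c p) \<noteq> 0) \<and>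
          (\<forall>c\<in>A. \<forall>d\<in>A. \<forall>p\<in>cdom c \<inter> cdom d. f c p * E c d p = E' c d p * f d p) \<and>
          (\<forall>c\<in>A. \<forall>p\<in>cdom c. f c p * \<phi> c p = \<phi>' c p * f c p))"


section \<open>Cyclic Higgs bundles\<close>

definition direct_sum :: "'a lbundle list \<Rightarrow> 'a vbundle" where
  "direct_sum Ls c d p =
     Matrix.mat (length Ls) (length Ls) (\<lambda>(i, j). if i = j then (Ls ! i) c d p else 0)"

text \<open>
  With lines \<open>L\<^sub>0, \<dots>, L\<^sub>n\<^sub>-\<^sub>1\<close>, the \<open>j\<close>-th entry of the list is the component
  \<open>L\<^sub>j \<rightarrow> L\<^sub>j\<^sub>+\<^sub>1 K\<close>, the index \<open>j + 1\<close> being taken modulo \<open>n\<close>.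
\<close>

definition cyclic_field :: "'a section_of list \<Rightarrow> 'a matrix_field" where
  "cyclic_field ss c p =
     Matrix.mat (length ss) (length ss)
       (\<lambda>(i, j). if i = Suc j mod length ss then (ss ! j) c p else 0)"

definition cyclic_SL2R :: "'a chart set \<Rightarrow> 'a vbundle \<Rightarrow> 'a matrix_field \<Rightarrow> bool" where
  "cyclic_SL2R A E \<phi> \<longleftrightarrow>
     (\<exists>L \<mu> \<nu>. line_bundle A L \<and>
        twisted_hom A L (dual_lb L) \<mu> \<and> \<not> zero_section A \<mu> \<and>
        twisted_hom A (dual_lb L) L \<nu> \<and>
        E = direct_sum [L, dual_lb L] \<and>
        \<phi> = cyclic_field [\<mu>, \<nu>] \<and>
        (zero_section A \<nu> \<longrightarrow> stable_higgs A 2 E \<phi>))"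

definition cyclic_SL3R :: "'a chart set \<Rightarrow> 'a vbundle \<Rightarrow> 'a matrix_field \<Rightarrow> bool" where
  "cyclic_SL3R A E \<phi> \<longleftrightarrow>
     (\<exists>L \<mu> \<nu>. line_bundle A L \<and>
        twisted_hom A L trivial_lb \<mu> \<and> twisted_hom A trivial_lb (dual_lb L) \<mu> \<and>
        \<not> zero_section A \<mu> \<and>
        twisted_hom A (dual_lb L) L \<nu> \<and>
        E = direct_sum [L, trivial_lb, dual_lb L] \<and>
        \<phi> = cyclic_field [\<mu>, \<mu>, \<nu>] \<and>
        (zero_section A \<nu> \<longrightarrow> stable_higgs A 3 E \<phi>))"

definition cyclic_SL4R :: "'a chart set \<Rightarrow> 'a vbundle \<Rightarrow> 'a matrix_field \<Rightarrow> bool" where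
  "cyclic_SL4R A E \<phi> \<longleftrightarrow>
     (\<exists>L1 L2 \<gamma> \<mu> \<nu>. line_bundle A L1 \<and> line_bundle A L2 \<and>
        twisted_hom A L1 L2 \<gamma> \<and> twisted_hom A (dual_lb L2) (dual_lb L1) \<gamma> \<and>
        \<not> zero_section A \<gamma> \<and>
        twisted_hom A L2 (dual_lb L2) \<mu> \<and> \<not> zero_section A \<mu> \<and>
        twisted_hom A (dual_lb L1) L1 \<nu> \<and>
        E = direct_sum [L1, L2, dual_lb L2, dual_lb L1] \<and>
        \<phi> = cyclic_field [\<gamma>, \<mu>, \<gamma>, \<nu>] \<and>
        (zero_section A \<nu> \<longrightarrow> stable_higgs A 4 E \<phi>))"

definition cyclic_SLR :: "'a chart set \<Rightarrow> nat \<Rightarrow> 'a vbundle \<Rightarrow> 'a matrix_field \<Rightarrow> bool" where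
  "cyclic_SLR A n E \<phi> \<longleftrightarrow>
     n = 2 \<and> cyclic_SL2R A E \<phi> \<or> n = 3 \<and> cyclic_SL3R A E \<phi> \<or> n = 4 \<and> cyclic_SL4R A E \<phi>"

text \<open>
  A square root of \<open>K\<close> is a line bundle \<open>S\<close> with an isomorphism \<open>\<tau> : S\<^sup>2 \<rightarrow> K\<close>. (Equality of
  transition functions would be too strong, as chart domains need not be simply connected.)
\<close>

definition sqrt_canonical :: "'a chart set \<Rightarrow> 'a lbundle \<Rightarrow> 'a section_of \<Rightarrow> bool" where
  "sqrt_canonical A S \<tau> \<longleftrightarrow>
     line_bundle A S \<and>
     holomorphic_section A (hom_lb (tensor_lb S S) canonical_lb) \<tau> \<and>
     (\<forall>c\<in>A. \<forall>p\<in>cdom c. \<tau> c p \<noteq> 0)"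

text \<open>
  The Higgs bundle in the Hitchin component. For \<open>n\<close> odd the lines are integral powers of \<open>K\<close>.
  For \<open>n\<close> even they are powers of \<open>S\<close>; in frames of \<open>S\<close> the identity
  \<open>S\<^sup>m \<rightarrow> S\<^sup>m\<^sup>-\<^sup>2 K\<close> is \<open>\<tau>\<close>, and \<open>q : S\<^sup>1\<^sup>-\<^sup>n \<rightarrow> S\<^sup>n\<^sup>-\<^sup>1 K\<close> is \<open>q \<tau>\<^sup>1\<^sup>-\<^sup>n\<close>, because
  \<open>S\<^sup>2\<^sup>n\<^sup>-\<^sup>2 K\<close> is identified with \<open>K\<^sup>n\<close> by \<open>\<tau>\<^sup>n\<^sup>-\<^sup>1\<close>.
\<close>

definition hitchin_bundle ::
    "'a chart set \<Rightarrow> nat \<Rightarrow> 'a section_of \<Rightarrow> 'a vbundle \<Rightarrow> 'a matrix_field \<Rightarrow> bool" where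
  "hitchin_bundle A n q E \<phi> \<longleftrightarrow>
     (if odd n then
        E = direct_sum (map (\<lambda>i. power_lb canonical_lb ((int n - 1 - 2 * int i) div 2)) [0..<n]) \<and>
        \<phi> = cyclic_field (replicate (n - 1) (\<lambda>c p. 1) @ [q])
      else
        (\<exists>S \<tau>. sqrt_canonical A S \<tau> \<and>
          E = direct_sum (map (\<lambda>i. power_lb S (int n - 1 - 2 * int i)) [0..<n]) \<and>
          \<phi> = cyclic_field (replicate (n - 1) \<tau> @ [\<lambda>c p. q c p * \<tau> c p powi (1 - int n)])))"


section \<open>Harmonic metrics and pullback metrics\<close>

definition partial_x :: "(complex \<Rightarrow> complex) \<Rightarrow> complex \<Rightarrow> complex" where
  "partial_x f w = vector_derivative (\<lambda>t. f (w + of_real t)) (at 0)"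

definition partial_y :: "(complex \<Rightarrow> complex) \<Rightarrow> complex \<Rightarrow> complex" where
  "partial_y f w = vector_derivative (\<lambda>t. f (w + \<i> * of_real t)) (at 0)"

definition wirtinger :: "(complex \<Rightarrow> complex) \<Rightarrow> complex \<Rightarrow> complex" where
  "wirtinger f w = (partial_x f w - \<i> * partial_y f w) / 2"

definition wirtinger_bar :: "(complex \<Rightarrow> complex) \<Rightarrow> complex \<Rightarrow> complex" where
  "wirtinger_bar f w = (partial_x f w + \<i> * partial_y f w) / 2"

fun C_k_on :: "nat \<Rightarrow> (complex \<Rightarrow> complex) \<Rightarrow> complex set \<Rightarrow> bool" where
  "C_k_on 0 f S \<longleftrightarrow> continuous_on S f"
| "C_k_on (Suc k) f S \<longleftrightarrow>
     (\<forall>w\<in>S. f differentiable (at w)) \<and> C_k_on k (partial_x f) S \<and> C_k_on k (partial_y f) S"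

definition smooth_on :: "(complex \<Rightarrow> complex) \<Rightarrow> complex set \<Rightarrow> bool" where
  "smooth_on f S \<longleftrightarrow> (\<forall>k. C_k_on k f S)"

definition mat_deriv ::
    "((complex \<Rightarrow> complex) \<Rightarrow> complex \<Rightarrow> complex) \<Rightarrow> nat \<Rightarrow>
     (complex \<Rightarrow> complex mat) \<Rightarrow> complex \<Rightarrow> complex mat" where
  "mat_deriv D n M w = Matrix.mat n n (\<lambda>(i, j). D (\<lambda>u. M u $$ (i, j)) w)"

definition mat_trace :: "complex mat \<Rightarrow> complex" where
  "mat_trace M = (\<Sum>i<dim_row M. M $$ (i, i))"

definition mat_inv :: "complex mat \<Rightarrow> complex mat" where
  "mat_inv M = the (mat_inverse M)"

text \<open>
  A Hermitian metric is given by Gram matrices: \<open>h(s, t) = t\<^sup>* (H c) s\<close> in the frame over \<open>c\<close>.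
\<close>

definition hermitian_metric ::
    "'a chart set \<Rightarrow> nat \<Rightarrow> 'a vbundle \<Rightarrow> 'a matrix_field \<Rightarrow> bool" where
  "hermitian_metric A n E H \<longleftrightarrow>
     (\<forall>c\<in>A. \<forall>p\<in>cdom c. H c p \<in> carrier_mat n n \<and> mat_adjoint (H c p) = H c p \<and>
        (\<forall>v\<in>carrier_vec n. v \<noteq> 0\<^sub>v n \<longrightarrow> 0 < Re ((H c p *\<^sub>v v) \<bullet>c v))) \<and>
     (\<forall>c\<in>A. \<forall>i<n. \<forall>j<n. smooth_on (\<lambda>w. H c (chart_inv c w) $$ (i, j)) (coord c ` cdom c)) \<and>
     (\<forall>c\<in>A. \<forall>d\<in>A. \<forall>p\<in>cdom c \<inter> cdom d.
        H d p = mat_adjoint (E c d p) * H c p * E c d p)"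

text \<open>The matrix \<open>\<Phi>\<^sup>*\<close> with \<open>\<phi>\<^sup>* = \<Phi>\<^sup>* dz*\<close> when \<open>\<phi> = \<Phi> dz\<close>.\<close>

definition higgs_adjoint ::
    "'a matrix_field \<Rightarrow> 'a matrix_field \<Rightarrow> 'a matrix_field" where
  "higgs_adjoint H \<phi> c p = mat_inv (H c p) * mat_adjoint (\<phi> c p) * H c p"

text \<open>
  In a holomorphic frame the Chern connection is \<open>d + H\<^sup>-\<^sup>1 \<partial>H\<close>, with curvature
  form obtained by applying \<open>wirtinger_bar\<close> to \<open>H\<^sup>-\<^sup>1 (wirtinger H)\<close> and multiplying by
  \<open>dz* \<and> dz\<close>, where \<open>z*\<close> is the conjugate of \<open>z\<close>. Below is its coefficient with respect to
  \<open>dz \<and> dz*\<close>.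
\<close>

definition chern_curvature :: "nat \<Rightarrow> 'a matrix_field \<Rightarrow> 'a matrix_field" where
  "chern_curvature n H c p =
     - mat_deriv wirtinger_bar n
         (\<lambda>w. mat_inv (H c (chart_inv c w)) *
              mat_deriv wirtinger n (\<lambda>u. H c (chart_inv c u)) w)
         (coord c p)"

text \<open>
  Coefficient of \<open>[\<phi>, \<phi>\<^sup>*]\<close> with respect to \<open>dz \<and> dz*\<close>; it is a commutator of matrices
  since the bracket of 1-forms is graded.
\<close>

definition higgs_bracket :: "'a matrix_field \<Rightarrow> 'a matrix_field \<Rightarrow> 'a matrix_field" where
  "higgs_bracket H \<phi> c p =
     \<phi> c p * higgs_adjoint H \<phi> c p - higgs_adjoint H \<phi> c p * \<phi> c p"

text \<open>
  \<open>E\<close> is meant to be a direct sum of line bundles whose determinant has transition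
  functions 1, so that diagonality and \<open>det H = 1\<close> are independent of the chart.
\<close>

definition harmonic_metric ::
    "'a chart set \<Rightarrow> nat \<Rightarrow> 'a vbundle \<Rightarrow> 'a matrix_field \<Rightarrow> 'a matrix_field \<Rightarrow> bool" where
  "harmonic_metric A n E \<phi> H \<longleftrightarrow>
     hermitian_metric A n E H \<and>
     (\<forall>c\<in>A. \<forall>p\<in>cdom c. diagonal_mat (H c p) \<and> Determinant.det (H c p) = 1 \<and>
        chern_curvature n H c p + higgs_bracket H \<phi> c p = 0\<^sub>m n n)"

text \<open>
  \<open>(\<phi> + \<phi>\<^sup>*)(X)\<close> for the real tangent vector \<open>X\<close> at \<open>p\<close> with \<open>dz\<^sub>c(X) = v\<close>.
\<close>

definition higgs_eval ::
    "'a matrix_field \<Rightarrow> 'a matrix_field \<Rightarrow> 'a chart \<Rightarrow> 'a \<Rightarrow> complex \<Rightarrow> complex mat" where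
  "higgs_eval H \<phi> c p v = v \<cdot>\<^sub>m \<phi> c p + cnj v \<cdot>\<^sub>m higgs_adjoint H \<phi> c p"

text \<open>
  \<open>g(X, Y) = 2n tr((\<phi> + \<phi>\<^sup>*)(X) (\<phi> + \<phi>\<^sup>*)(Y))\<close> for real tangent vectors with
  \<open>dz\<^sub>c(X) = v\<close> and \<open>dz\<^sub>c(Y) = w\<close>. The trace is real, both factors being \<open>h\<close>-self-adjoint.
\<close>

definition pullback_metric ::
    "nat \<Rightarrow> 'a matrix_field \<Rightarrow> 'a matrix_field \<Rightarrow> 'a chart \<Rightarrow> 'a \<Rightarrow> complex \<Rightarrow> complex \<Rightarrow> real" where
  "pullback_metric n H \<phi> c p v w =
     2 * real n * Re (mat_trace (higgs_eval H \<phi> c p v * higgs_eval H \<phi> c p w))"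

end

theory Submission
  imports Defs
begin

text \<open>
  The trace of \<open>(\<phi> + \<phi>\<^sup>*)(v)\<^sup>2\<close> is \<open>2 \<bar>v\<bar>\<^sup>2 \<Sum>\<^sub>j a\<^sub>j + 2 Re (v\<^sup>2 tr \<phi>\<^sup>2)\<close>, where
  \<open>a\<^sub>j = \<bar>s\<^sub>j\<bar>\<^sup>2 h\<^sub>j\<^sub>+\<^sub>1 / h\<^sub>j\<close> is the squared norm of the \<open>j\<close>-th component \<open>s\<^sub>j\<close> of the Higgs field
  (\<open>energy_density\<close>). For a cyclic field, \<open>tr \<phi>\<^sup>2\<close> is twice the quadratic differential when
  \<open>n = 2\<close> and vanishes when \<open>n \<ge> 3\<close>, so it is the same for both bundles, and the theorem says
  \<open>\<Sum>\<^sub>j a\<^sub>j < \<Sum>\<^sub>j a'\<^sub>j\<close>, with a prime for the bundle in the Hitchin component.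

  Two facts relate the two families. The products \<open>\<Prod>\<^sub>j a\<^sub>j\<close> and \<open>\<Prod>\<^sub>j a'\<^sub>j\<close> both equal \<open>\<bar>q\<bar>\<^sup>2\<close>, by
  the determinant condition. And away from its zeros each family solves the cyclic Toda system
  \<open>\<partial>\<partial>\<^sup>* log a\<^sub>j = 2 a\<^sub>j - a\<^sub>j\<^sub>-\<^sub>1 - a\<^sub>j\<^sub>+\<^sub>1\<close>, where \<open>\<partial>\<partial>\<^sup>*\<close> is a quarter of the Laplacian; this is the Hitchin
  equation for a diagonal metric (\<open>toda_solution_harmonic\<close>).

  The idea is to show that, for each \<open>k\<close>, every product of \<open>k\<close> of the \<open>a\<^sub>j\<close> that matters is at most
  the product of the \<open>k\<close> largest \<open>a'\<^sub>j\<close>. Partial products of a decreasing sequence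
  dominated in this way force the sums to be ordered, strictly unless the sequences coincide
  (\<open>sum_less_of_partial_products\<close>). The product bounds come from the maximum principle. The
  quotient of two monomials of equal degree in the \<open>a\<^sub>j\<close> and the \<open>a'\<^sub>j\<close> is a function on the compact
  surface, provided that the denominator has no zeros; this is why the components \<open>1\<close> of the Hitchin
  field go into the denominators. Zeros of the numerator are harmless, since the quotient is not
  maximal there. At a maximum the \<open>\<partial>\<partial>\<^sup>* log\<close> of the numerator is at most that of the denominator
  (\<open>ratio_maximum_point\<close>), and the Toda equations turn this into the bounds
  (\<open>toda2_less\<close>, \<open>toda3_sum_less\<close>, and the locale \<open>toda4_comparison\<close>).

  Strictness rests on the strong maximum principle (\<open>strong_maximum_local\<close>): a quotient bounded by 1
  that takes the value 1 is identically 1. Then certain components of \<open>\<phi>\<close> have no zeros, hence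
  are isomorphisms between the line bundles, and they carry \<open>E\<close>, possibly after a
  rotation of its cyclic order, onto a bundle in the Hitchin component
  (\<open>isomorphic_hitchin2\<close>, \<open>isomorphic_hitchin3\<close>, \<open>isomorphic_hitchin4\<close>), which is excluded.

  In rank four the argument uses that the two components given by the same section \<open>\<gamma>\<close> have the same
  norm, which holds since their quotient \<open>h\<^sub>1 h\<^sub>2 / (h\<^sub>0 h\<^sub>3)\<close> is a function to which the
  strong maximum principle applies (\<open>balanced_le\<close>).
\<close>

section \<open>Second derivatives of real functions in the plane\<close>

text \<open>
  The number \<open>l\<close> is a quarter of the Laplacian of \<open>u\<close> at \<open>z\<close>, which is the value of
  \<open>\<partial>\<partial>\<^sup>* u\<close> in the coordinate. Second derivatives are taken along the two axes and at the point \<open>z\<close>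
  alone: this suffices for the second derivative test, and the real part of
  \<open>wirtinger_bar (wirtinger u)\<close> involves no mixed derivatives.
\<close>

definition has_ddbar :: "(complex \<Rightarrow> real) \<Rightarrow> complex \<Rightarrow> real \<Rightarrow> bool" where
  "has_ddbar u z l \<longleftrightarrow>
     (\<exists>Du a b. (\<forall>\<^sub>F w in nhds z. (u has_derivative Du w) (at w)) \<and>
        ((\<lambda>t. Du (z + of_real t) 1) has_real_derivative a) (at 0) \<and>
        ((\<lambda>t. Du (z + \<i> * of_real t) \<i>) has_real_derivative b) (at 0) \<and> 4 * l = a + b)"

lemma has_ddbarI:
  assumes "\<forall>\<^sub>F w in nhds z. (u has_derivative Du w) (at w)"
    and "((\<lambda>t. Du (z + of_real t) 1) has_real_derivative a) (at 0)"
    and "((\<lambda>t. Du (z + \<i> * of_real t) \<i>) has_real_derivative b) (at 0)"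
    and "4 * l = a + b"
  shows "has_ddbar u z l"
  using assms unfolding has_ddbar_def by blast

text \<open>
  The value depends on the germ of the function only, so a formula valid near the point suffices.
\<close>

lemma has_ddbar_cong:
  assumes "has_ddbar u z l" and "\<forall>\<^sub>F w in nhds z. u w = v w"
  shows "has_ddbar v z l"
proof -
  obtain Du a b where D: "\<forall>\<^sub>F w in nhds z. (u has_derivative Du w) (at w)"
    and "((\<lambda>t. Du (z + of_real t) 1) has_real_derivative a) (at 0)"
    and "((\<lambda>t. Du (z + \<i> * of_real t) \<i>) has_real_derivative b) (at 0)" "4 * l = a + b"
    using assms(1) unfolding has_ddbar_def by blast
  moreover have "\<forall>\<^sub>F w in nhds z. \<forall>\<^sub>F x in nhds w. u x = v x"
    using assms(2) by (simp add: eventually_eventually)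
  with D have "\<forall>\<^sub>F w in nhds z. (v has_derivative Du w) (at w)"
  proof eventually_elim
    case (elim w)
    have "u w = v w" using elim(2) eventually_nhds_x_imp_x by fast
    moreover have "\<forall>\<^sub>F x in at w. u x = v x" using elim(2) by (simp add: eventually_nhds_conv_at)
    ultimately show ?case
      using has_derivative_transform_eventually[OF elim(1)] by simp
  qed
  ultimately show ?thesis by (intro has_ddbarI)
qed

lemma has_ddbar_lincomb:
  assumes "has_ddbar u z l" and "has_ddbar v z m"
  shows "has_ddbar (\<lambda>w. r * u w + s * v w) z (r * l + s * m)"
proof -
  obtain Du a b where u: "\<forall>\<^sub>F w in nhds z. (u has_derivative Du w) (at w)"
    "((\<lambda>t. Du (z + of_real t) 1) has_real_derivative a) (at 0)"
    "((\<lambda>t. Du (z + \<i> * of_real t) \<i>) has_real_derivative b) (at 0)" "4 * l = a + b"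
    using assms(1) unfolding has_ddbar_def by blast
  obtain Dv a' b' where v: "\<forall>\<^sub>F w in nhds z. (v has_derivative Dv w) (at w)"
    "((\<lambda>t. Dv (z + of_real t) 1) has_real_derivative a') (at 0)"
    "((\<lambda>t. Dv (z + \<i> * of_real t) \<i>) has_real_derivative b') (at 0)" "4 * m = a' + b'"
    using assms(2) unfolding has_ddbar_def by blast
  show ?thesis
  proof (rule has_ddbarI[where Du = "\<lambda>w h. r * Du w h + s * Dv w h"])
    show "\<forall>\<^sub>F w in nhds z. ((\<lambda>w. r * u w + s * v w) has_derivative (\<lambda>h. r * Du w h + s * Dv w h)) (at w)"
      using u(1) v(1) by eventually_elim (auto intro!: derivative_eq_intros)
    show "((\<lambda>t. r * Du (z + of_real t) 1 + s * Dv (z + of_real t) 1)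
        has_real_derivative (r * a + s * a')) (at 0)"
      using u(2) v(2) by (auto intro!: derivative_eq_intros)
    show "((\<lambda>t. r * Du (z + \<i> * of_real t) \<i> + s * Dv (z + \<i> * of_real t) \<i>)
        has_real_derivative (r * b + s * b')) (at 0)"
      using u(3) v(3) by (auto intro!: derivative_eq_intros)
    show "4 * (r * l + s * m) = (r * a + s * a') + (r * b + s * b')"
    proof -
      have "4 * (r * l + s * m) = r * (4 * l) + s * (4 * m)" by (simp add: algebra_simps)
      then show ?thesis unfolding u(4) v(4) by (simp add: algebra_simps)
    qed
  qed
qed

lemma has_ddbar_const: "has_ddbar (\<lambda>w. c) z 0"
  by (rule has_ddbarI[where Du = "\<lambda>w h. 0" and a = 0 and b = 0]) auto

lemma second_derivative_local_max:
  fixes g g' :: "real \<Rightarrow> real"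
  assumes d: "\<forall>\<^sub>F t in nhds 0. (g has_real_derivative g' t) (at t)"
    and d2: "(g' has_real_derivative a) (at 0)"
    and max: "\<forall>\<^sub>F t in nhds 0. g t \<le> g 0"
  shows "a \<le> 0"
proof (rule ccontr)
  assume "\<not> a \<le> 0"
  obtain e where e: "e > 0" "\<And>t. \<bar>t\<bar> < e \<Longrightarrow> (g has_real_derivative g' t) (at t) \<and> g t \<le> g 0"
    using eventually_conj[OF d max] unfolding eventually_nhds_metric by (auto simp: dist_real_def)
  have "g' 0 = 0"
    using DERIV_local_max[of g "g' 0" 0 e] e by auto
  then obtain d where d: "d > 0" "\<And>h. 0 < h \<Longrightarrow> h < d \<Longrightarrow> 0 < g' h"
    using DERIV_pos_inc_right[OF d2] \<open>\<not> a \<le> 0\<close> by auto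
  define t where "t = min d e / 2"
  have t: "0 < t" "t < d" "t < e" using d(1) e(1) by (auto simp: t_def)
  have "g 0 < g t"
  proof (rule DERIV_pos_imp_increasing_open[OF t(1)])
    fix x assume "0 < x" "x < t"
    then show "\<exists>y. DERIV g x :> y \<and> 0 < y" using d(2)[of x] e(2)[of x] t by auto
  next
    have "isCont g x" if "x \<in> {0..t}" for x
      using e(2)[of x] that t by (intro DERIV_isCont[of g "g' x"]) auto
    then show "continuous_on {0..t} g" by (simp add: continuous_at_imp_continuous_on)
  qed
  then show False using e(2)[of t] t by auto
qed

lemma eventually_nhds_line:
  fixes z v :: complex
  assumes "\<forall>\<^sub>F w in nhds z. P w"
  shows "\<forall>\<^sub>F t in nhds (0::real). P (z + v * of_real t)"
proof -
  have "((\<lambda>t. z + v * of_real t) \<longlongrightarrow> z + v * of_real 0) (nhds (0::real))"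
    by (rule tendsto_intros isCont_tendsto_compose filterlim_ident)+
  then have "filterlim (\<lambda>t. z + v * of_real t) (nhds z) (nhds (0::real))"
    by simp
  then show ?thesis using assms by (simp add: filterlim_iff)
qed

lemma has_derivative_along_line:
  fixes z v :: complex and u :: "complex \<Rightarrow> 'b::real_normed_vector"
  assumes "(u has_derivative D) (at (z + v * of_real t))"
  shows "((\<lambda>t. u (z + v * of_real t)) has_vector_derivative D v) (at t)"
proof -
  have *: "((\<lambda>t. z + v * of_real t) has_derivative (\<lambda>s. v * of_real s)) (at t)"
    by (auto intro!: derivative_eq_intros)
  have "linear D" using assms by (rule has_derivative_linear)
  then have "(\<lambda>s. D (v * of_real s)) = (\<lambda>s. s *\<^sub>R D v)"
    using linear_scale[of D _ v] by (auto simp: scaleR_conv_of_real mult.commute)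
  then show ?thesis
    using has_derivative_compose[OF * assms] by (simp add: has_vector_derivative_def)
qed

text \<open>
  Restricted to each coordinate axis the function has a local maximum, so both second derivatives
  are nonpositive.
\<close>

lemma has_ddbar_local_max:
  assumes u: "has_ddbar u z l" and max: "\<forall>\<^sub>F w in nhds z. u w \<le> u z"
  shows "l \<le> 0"
proof -
  obtain Du a b where D: "\<forall>\<^sub>F w in nhds z. (u has_derivative Du w) (at w)"
    and a: "((\<lambda>t. Du (z + of_real t) 1) has_real_derivative a) (at 0)"
    and b: "((\<lambda>t. Du (z + \<i> * of_real t) \<i>) has_real_derivative b) (at 0)" and l: "4 * l = a + b"
    using u unfolding has_ddbar_def by blast
  have line: "d \<le> 0" if d: "((\<lambda>t. Du (z + v * of_real t) v) has_real_derivative d) (at 0)" for v d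
  proof (rule second_derivative_local_max[OF _ d])
    show "\<forall>\<^sub>F t in nhds 0. ((\<lambda>t. u (z + v * of_real t))
        has_real_derivative Du (z + v * of_real t) v) (at t)"
      using eventually_nhds_line[OF D, of v]
      by eventually_elim (simp add: has_derivative_along_line has_real_derivative_iff_has_vector_derivative)
    show "\<forall>\<^sub>F t in nhds 0. u (z + v * of_real t) \<le> u (z + v * of_real 0)"
      using eventually_nhds_line[OF max, of v] by simp
  qed
  show ?thesis using line[of 1 a] line[of \<i> b] a b l by simp
qed

lemma has_ddbar_unique:
  assumes "has_ddbar u z l" and "has_ddbar u z m"
  shows "l = m"
proof -
  have "has_ddbar (\<lambda>w. r * u w + - r * u w) z (r * l + - r * m)" for r
    by (rule has_ddbar_lincomb[OF assms])
  from has_ddbar_local_max[OF this[of 1]] has_ddbar_local_max[OF this[of "-1"]]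
  show ?thesis by auto
qed

lemma has_ddbar_imp_differentiable:
  "has_ddbar u z l \<Longrightarrow> u differentiable (at z)"
  unfolding has_ddbar_def differentiable_def by (blast dest: eventually_nhds_x_imp_x)

lemma has_ddbar_imp_isCont: "has_ddbar u z l \<Longrightarrow> isCont u z"
  using has_ddbar_imp_differentiable differentiable_imp_continuous_within by blast

text \<open>
  The logarithm of \<open>\<bar>f\<bar>\<^sup>2\<close> is locally the real part of a holomorphic function. Its differential is
  \<open>h \<mapsto> 2 Re (g h)\<close> with \<open>g = f' / f\<close>, and multiplication by \<open>\<i>\<close> twice makes the two second
  derivatives cancel.
\<close>

lemma has_ddbar_ln_norm_square:
  assumes f: "f holomorphic_on S" and S: "open S" "z \<in> S" and nz: "f z \<noteq> 0"
  shows "has_ddbar (\<lambda>w. ln ((cmod (f w))\<^sup>2)) z 0"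
proof -
  define g where "g = (\<lambda>w. deriv f w / f w)"
  define T where "T = {w\<in>S. f w \<noteq> 0}"
  have T: "open T" "z \<in> T"
    using continuous_open_preimage[OF holomorphic_on_imp_continuous_on[OF f] S(1), of "- {0}"] S(2) nz
    by (auto simp: T_def vimage_def Int_def open_delete)
  have g_hol: "g holomorphic_on T"
    unfolding g_def using f S(1)
    by (intro holomorphic_intros holomorphic_on_subset[OF holomorphic_deriv[OF f S(1)]]
          holomorphic_on_subset[OF f]) (auto simp: T_def)
  define g1 where "g1 = deriv g z"
  have g: "(g has_field_derivative g1) (at z)"
    using holomorphic_derivI[OF g_hol T] by (simp add: g1_def)
  show ?thesis
  proof (rule has_ddbarI[where Du = "\<lambda>w h. 2 * Re (g w * h)"])
    have "((\<lambda>w. ln ((cmod (f w))\<^sup>2)) has_derivative (\<lambda>h. 2 * Re (g w * h))) (at w)" if "w \<in> T" for w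
    proof -
      have w: "w \<in> S" "f w \<noteq> 0" using that by (auto simp: T_def)
      have df: "(f has_derivative (\<lambda>h. deriv f w * h)) (at w)"
        using holomorphic_derivI[OF f S(1) w(1)] by (simp add: has_field_derivative_def)
      have "((\<lambda>w. ln (inner (f w) (f w))) has_derivative
          (\<lambda>h. (inner (f w) (deriv f w * h) + inner (deriv f w * h) (f w)) / inner (f w) (f w))) (at w)"
        using w(2) by (auto intro!: derivative_eq_intros df simp: divide_inverse)
      moreover have "(\<lambda>h. (inner (f w) (deriv f w * h) + inner (deriv f w * h) (f w)) / inner (f w) (f w))
          = (\<lambda>h. 2 * Re (g w * h))"
      proof
        fix h
        have "Re (g w * h) = Re (deriv f w * h * cnj (f w)) / (cmod (f w))\<^sup>2"
          unfolding g_def by (simp add: complex_div_cnj[of "deriv f w"] algebra_simps Re_divide_of_real 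
              del: of_real_power)
        then show "(inner (f w) (deriv f w * h) + inner (deriv f w * h) (f w)) / inner (f w) (f w) = 2 * Re (g w * h)"
          by (simp add: inner_commute[of "f w"] dot_square_norm inner_complex_def[of "deriv f w * h"]
              power2_norm_eq_inner[symmetric])
      qed
      ultimately show ?thesis by (simp add: power2_norm_eq_inner)
    qed
    then show "\<forall>\<^sub>F w in nhds z. ((\<lambda>w. ln ((cmod (f w))\<^sup>2)) has_derivative (\<lambda>h. 2 * Re (g w * h))) (at w)"
      using T by (auto simp: eventually_nhds)
    have line: "((\<lambda>t. 2 * Re (g (z + v * of_real t) * v)) has_real_derivative 2 * Re (g1 * v * v)) (at 0)" for v
    proof -
      have "((\<lambda>t. g (z + v * of_real t)) has_vector_derivative g1 * v) (at 0)"
        using has_derivative_along_line[of g "(*) g1" z v 0] g by (simp add: has_field_derivative_def)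
      then have "((\<lambda>t. g (z + v * of_real t) * v) has_vector_derivative g1 * v * v) (at 0)"
        by (rule has_vector_derivative_mult_left)
      then have "((\<lambda>t. Re (g (z + v * of_real t) * v)) has_vector_derivative Re (g1 * v * v)) (at 0)"
        by (rule bounded_linear.has_vector_derivative[OF bounded_linear_Re])
      then show ?thesis
        by (intro DERIV_cmult) (simp add: has_real_derivative_iff_has_vector_derivative)
    qed
    show "((\<lambda>t. 2 * Re (g (z + of_real t) * 1)) has_real_derivative 2 * Re g1) (at 0)"
      using line[of 1] by simp
    show "((\<lambda>t. 2 * Re (g (z + \<i> * of_real t) * \<i>)) has_real_derivative - 2 * Re g1) (at 0)"
      using line[of \<i>] by (simp add: mult.assoc)
  qed simp
qed

text \<open>
  The Gaussian is the barrier in the proof of the strong maximum principle.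
\<close>

lemma has_ddbar_gaussian:
  fixes x z :: complex
  defines "r \<equiv> \<lambda>w. (cmod (w - x))\<^sup>2"
  shows "has_ddbar (\<lambda>w. exp (- \<alpha> * r w)) z (exp (- \<alpha> * r z) * (\<alpha>\<^sup>2 * r z - \<alpha>))"
proof (rule has_ddbarI[where Du = "\<lambda>w h. - 2 * \<alpha> * exp (- \<alpha> * r w) * inner (w - x) h"])
  have "((\<lambda>w. exp (- \<alpha> * inner (w - x) (w - x))) has_derivative
        (\<lambda>h. - 2 * \<alpha> * exp (- \<alpha> * inner (w - x) (w - x)) * inner (w - x) h)) (at w)" for w
    by (auto intro!: derivative_eq_intros simp: algebra_simps inner_commute)
  then show "\<forall>\<^sub>F w in nhds z. ((\<lambda>w. exp (- \<alpha> * r w)) has_derivative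
        (\<lambda>h. - 2 * \<alpha> * exp (- \<alpha> * r w) * inner (w - x) h)) (at w)"
    by (simp add: r_def power2_norm_eq_inner)
  define a b where "a = Re (z - x)" and "b = Im (z - x)"
  have r1: "r (z + of_real t) = (a + t)\<^sup>2 + b\<^sup>2" and r2: "r (z + \<i> * of_real t) = a\<^sup>2 + (b + t)\<^sup>2"
    and r0: "r z = a\<^sup>2 + b\<^sup>2" for t
    by (simp_all add: r_def a_def b_def cmod_power2 algebra_simps)
  have i1: "inner (z + of_real t - x) 1 = a + t" and i2: "inner (z + \<i> * of_real t - x) \<i> = b + t" for t
    by (simp_all add: inner_complex_def a_def b_def)
  show "((\<lambda>t. - 2 * \<alpha> * exp (- \<alpha> * r (z + of_real t)) * inner (z + of_real t - x) 1)
      has_real_derivative exp (- \<alpha> * r z) * (4 * \<alpha>\<^sup>2 * a\<^sup>2 - 2 * \<alpha>)) (at 0)"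
    unfolding r1 i1 r0
    by (auto intro!: derivative_eq_intros simp: power2_eq_square algebra_simps)
  show "((\<lambda>t. - 2 * \<alpha> * exp (- \<alpha> * r (z + \<i> * of_real t)) * inner (z + \<i> * of_real t - x) \<i>)
      has_real_derivative exp (- \<alpha> * r z) * (4 * \<alpha>\<^sup>2 * b\<^sup>2 - 2 * \<alpha>)) (at 0)"
    unfolding r2 i2 r0
    by (auto intro!: derivative_eq_intros simp: power2_eq_square algebra_simps)
  show "4 * (exp (- \<alpha> * r z) * (\<alpha>\<^sup>2 * r z - \<alpha>)) =
      exp (- \<alpha> * r z) * (4 * \<alpha>\<^sup>2 * a\<^sup>2 - 2 * \<alpha>) + exp (- \<alpha> * r z) * (4 * \<alpha>\<^sup>2 * b\<^sup>2 - 2 * \<alpha>)"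
    unfolding r0 by (simp add: algebra_simps)
qed

section \<open>The strong maximum principle in the plane\<close>

text \<open>
  Hopf's argument. If \<open>v\<close> were positive at \<open>x\<close>, take the largest open disc around \<open>x\<close> on which \<open>v\<close> is
  positive. It has a boundary point \<open>y\<close> with \<open>v y = 0\<close>, where the derivative of \<open>v\<close> vanishes because
  \<open>v\<close> is minimal there. On an annulus along the boundary of the disc, \<open>v\<close> dominates a small
  multiple of a Gaussian barrier that vanishes on the outer circle and has a nonzero slope there,
  and this is incompatible with a vanishing derivative.
\<close>

lemma strong_maximum_local:
  fixes v :: "complex \<Rightarrow> real"
  assumes C: "0 \<le> C"
    and nonneg: "\<And>w. w \<in> ball z r \<Longrightarrow> 0 \<le> v w" and zero: "v z = 0"
    and super: "\<And>w. w \<in> ball z r \<Longrightarrow> \<exists>l. has_ddbar v w l \<and> l \<le> C * v w"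
    and x: "x \<in> ball z (r / 2)"
  shows "v x = 0"
proof (rule ccontr)
  assume "v x \<noteq> 0"
  have "r > 0" using x by (metis ball_eq_empty empty_iff half_gt_zero_iff not_le)
  have in_ball: "w \<in> ball z r" if "w \<in> cball x (dist x z)" for w
  proof -
    have "dist z w \<le> dist z x + dist x w" by (rule dist_triangle)
    then show ?thesis using that x by (simp add: dist_commute)
  qed
  have x_in: "x \<in> ball z r" using x \<open>r > 0\<close> by simp
  have vx: "v x > 0" using nonneg[OF x_in] \<open>v x \<noteq> 0\<close> by simp
  have cont: "isCont v w" if "w \<in> ball z r" for w
    using super[OF that] has_ddbar_imp_isCont by blast
  define Z where "Z = {w \<in> cball x (dist x z). v w = 0}"
  have "continuous_on (cball x (dist x z)) v"
    using cont in_ball by (simp add: continuous_at_imp_continuous_on)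
  then have "closed Z" unfolding Z_def
    by (intro continuous_closed_preimage_constant) auto
  moreover have "Z \<noteq> {}" using zero by (auto simp: Z_def)
  ultimately obtain y where y: "y \<in> Z" "\<And>w. w \<in> Z \<Longrightarrow> dist x y \<le> dist x w"
    using distance_attains_inf[of Z x] by blast
  define R where "R = dist x y"
  have y_in: "y \<in> cball x (dist x z)" "v y = 0" using y(1) by (auto simp: Z_def)
  have R: "R > 0" using vx y_in by (auto simp: R_def)
  have R_le: "R \<le> dist x z" using y_in by (simp add: R_def)
  have pos: "v w > 0" if "dist x w < R" for w
  proof -
    have "w \<in> cball x (dist x z)" using that R_le by simp
    moreover have "w \<notin> Z" using y(2)[of w] that by (auto simp: R_def)
    ultimately show ?thesis using nonneg[OF in_ball] by (force simp: Z_def)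
  qed
  \<comment> \<open>Large enough for the barrier to satisfy \<open>\<partial>\<partial>\<^sup>* \<eta> > C \<eta>\<close> outside the disc of radius \<open>R / 2\<close>.\<close>
  define \<alpha> where "\<alpha> = (C + 5) / R\<^sup>2 + (C + 5)"
  have \<alpha>: "\<alpha> > 0" using C R by (simp add: \<alpha>_def add_pos_pos)
  have \<alpha>R: "C < \<alpha>\<^sup>2 * (R / 2)\<^sup>2 - \<alpha>"
  proof -
    have "\<alpha> * R\<^sup>2 = (C + 5) + (C + 5) * R\<^sup>2" using R by (simp add: \<alpha>_def field_simps)
    then have a1: "\<alpha> * R\<^sup>2 \<ge> C + 5" using C by simp
    have a2: "\<alpha> \<ge> C + 5" using C R by (simp add: \<alpha>_def)
    have "\<alpha>\<^sup>2 * (R / 2)\<^sup>2 - \<alpha> = \<alpha> * (\<alpha> * R\<^sup>2 / 4 - 1)" by (simp add: power2_eq_square field_simps)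
    moreover have "\<alpha> * ((C + 5) / 4 - 1) \<le> \<alpha> * (\<alpha> * R\<^sup>2 / 4 - 1)" using a1 \<alpha> by simp
    moreover have "(C + 5) * ((C + 5) / 4 - 1) \<le> \<alpha> * ((C + 5) / 4 - 1)"
      using a2 C by (intro mult_right_mono) auto
    moreover have "C < (C + 5) * ((C + 5) / 4 - 1)"
      using C by (simp add: field_simps add_nonneg_pos)
    ultimately show ?thesis by linarith
  qed
  define \<eta> where "\<eta> = (\<lambda>w. exp (- \<alpha> * (cmod (w - x))\<^sup>2) - exp (- \<alpha> * R\<^sup>2))"
  define l\<eta> where "l\<eta> = (\<lambda>w. exp (- \<alpha> * (cmod (w - x))\<^sup>2) * (\<alpha>\<^sup>2 * (cmod (w - x))\<^sup>2 - \<alpha>))"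
  have \<eta>: "has_ddbar \<eta> w (l\<eta> w)" for w
    using has_ddbar_lincomb[OF has_ddbar_gaussian[of \<alpha> x w] has_ddbar_const[of 1 w], of 1 "- exp (- \<alpha> * R\<^sup>2)"]
    by (simp add: \<eta>_def l\<eta>_def)
  have l\<eta>: "l\<eta> w > C * \<eta> w" if "R / 2 \<le> cmod (w - x)" for w
  proof -
    have "(R / 2)\<^sup>2 \<le> (cmod (w - x))\<^sup>2" using that R by (intro power_mono) auto
    then have "\<alpha>\<^sup>2 * (R / 2)\<^sup>2 \<le> \<alpha>\<^sup>2 * (cmod (w - x))\<^sup>2" by (intro mult_left_mono) auto
    then have "exp (- \<alpha> * (cmod (w - x))\<^sup>2) * C < l\<eta> w"
      unfolding l\<eta>_def using \<alpha>R by (intro mult_strict_left_mono) auto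
    moreover have "C * \<eta> w \<le> C * exp (- \<alpha> * (cmod (w - x))\<^sup>2)"
      using C by (intro mult_left_mono) (simp_all add: \<eta>_def)
    ultimately show ?thesis by (simp add: mult.commute)
  qed
  define S where "S = sphere x (R / 2)"
  have S: "w \<in> ball z r" "v w > 0" if "w \<in> S" for w
    using that pos[of w] in_ball[of w] R R_le by (auto simp: S_def)
  have "S \<noteq> {}" "compact S" using R by (auto simp: S_def)
  moreover have "continuous_on S v"
    using cont S by (simp add: continuous_at_imp_continuous_on)
  ultimately obtain s where s: "s \<in> S" "\<And>w. w \<in> S \<Longrightarrow> v s \<le> v w"
    using continuous_attains_inf[of S v] by blast
  \<comment> \<open>As \<open>\<eta> \<le> 1\<close>, this multiple of the barrier is below \<open>v\<close> on the inner circle.\<close>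
  define e where "e = v s"
  have e: "e > 0" using S s by (simp add: e_def)
  define \<psi> where "\<psi> = (\<lambda>w. v w - e * \<eta> w)"
  define K where "K = {w. R / 2 \<le> cmod (w - x) \<and> cmod (w - x) \<le> R}"
  have K_in: "w \<in> ball z r" if "w \<in> K" for w
    using that in_ball[of w] R_le by (simp add: K_def dist_norm norm_minus_commute)
  have \<psi>_dd: "\<exists>l. has_ddbar \<psi> w (l - e * l\<eta> w) \<and> l \<le> C * v w" if w: "w \<in> ball z r" for w
  proof -
    obtain l where l: "has_ddbar v w l" "l \<le> C * v w" using super[OF w] by blast
    then show ?thesis using has_ddbar_lincomb[OF l(1) \<eta>[of w], of 1 "- e"] by (auto simp: \<psi>_def)
  qed
  \<comment> \<open>A negative minimum of \<open>\<psi>\<close> would be interior, and there \<open>\<partial>\<partial>\<^sup>* \<psi> < C \<psi> \<le> 0\<close>.\<close>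
  have \<psi>_nonneg: "\<psi> w \<ge> 0" if w: "w \<in> K" for w
  proof (rule ccontr)
    assume neg: "\<not> \<psi> w \<ge> 0"
    have "K = cball x R - ball x (R / 2)" by (auto simp: K_def dist_norm norm_minus_commute)
    then have "compact K" by (simp add: compact_diff)
    moreover have "isCont \<psi> u" if "u \<in> K" for u
      using \<psi>_dd[OF K_in[OF that]] has_ddbar_imp_isCont by blast
    then have "continuous_on K \<psi>" by (simp add: continuous_at_imp_continuous_on)
    ultimately obtain m where m: "m \<in> K" "\<And>u. u \<in> K \<Longrightarrow> \<psi> m \<le> \<psi> u"
      using continuous_attains_inf[of K \<psi>] w by blast
    have m_neg: "\<psi> m < 0" using m(2)[OF w] neg by simp
    have "cmod (m - x) \<noteq> R"
    proof
      assume "cmod (m - x) = R"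
      then have "\<psi> m = v m" by (simp add: \<psi>_def \<eta>_def)
      then show False using nonneg[OF K_in[OF m(1)]] m_neg by simp
    qed
    moreover have "cmod (m - x) \<noteq> R / 2"
    proof
      assume "cmod (m - x) = R / 2"
      then have "m \<in> S" by (simp add: S_def dist_norm norm_minus_commute)
      moreover have "exp (- \<alpha> * (cmod (m - x))\<^sup>2) \<le> 1" using \<alpha> by simp
      then have "\<eta> m \<le> 1" unfolding \<eta>_def by (smt (verit) exp_gt_zero)
      then have "e * \<eta> m \<le> e" using e by (simp add: mult_left_le)
      ultimately show False using s(2)[of m] m_neg by (simp add: \<psi>_def e_def)
    qed
    ultimately have m_int: "m \<in> ball x R - cball x (R / 2)"
      using m(1) by (auto simp: K_def dist_norm norm_minus_commute)
    have "open (ball x R - cball x (R / 2))" by (simp add: open_Diff)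
    then have ev: "\<forall>\<^sub>F u in nhds m. u \<in> ball x R - cball x (R / 2)"
      using m_int by (rule eventually_nhds_in_open)
    then have "\<forall>\<^sub>F u in nhds m. 0 * \<psi> u + - 1 * \<psi> u \<le> 0 * \<psi> m + - 1 * \<psi> m"
    proof eventually_elim
      case (elim u)
      then show ?case using m(2)[of u] by (simp add: K_def dist_norm norm_minus_commute)
    qed
    moreover obtain l where l: "has_ddbar \<psi> m (l - e * l\<eta> m)" "l \<le> C * v m"
      using \<psi>_dd[OF K_in[OF m(1)]] by blast
    note has_ddbar_lincomb[OF l(1) l(1), of 0 "-1"]
    ultimately have "l \<ge> e * l\<eta> m" using has_ddbar_local_max by fastforce
    moreover have "e * l\<eta> m \<ge> e * (C * \<eta> m)"
      using l\<eta>[of m] m(1) e by (intro mult_left_mono) (auto simp: K_def)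
    moreover have "e * l\<eta> m > e * (C * \<eta> m)"
      using l\<eta>[of m] m(1) e by (intro mult_strict_left_mono) (auto simp: K_def)
    ultimately have "C * \<psi> m > 0" using l(2) by (simp add: \<psi>_def algebra_simps)
    then show False using C m_neg by (simp add: zero_less_mult_iff)
  qed
  \<comment> \<open>The derivative of \<open>\<psi>\<close> at \<open>y\<close> towards the centre \<open>x\<close> is negative, because that of \<open>v\<close> vanishes.\<close>
  obtain D where D: "(v has_derivative D) (at y)"
    using super[OF in_ball[OF y_in(1)]] has_ddbar_imp_differentiable differentiable_def by blast
  have "D = (\<lambda>h. 0)"
  proof (rule has_derivative_local_min[OF D])
    have "\<forall>\<^sub>F u in at y. u \<in> ball z r"
      by (rule eventually_at_in_open') (use in_ball[OF y_in(1)] in auto)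
    then show "\<forall>\<^sub>F u in at y. v y \<le> v u"
      by eventually_elim (use nonneg y_in(2) in auto)
  qed
  define g where "g = (\<lambda>t. v (y + (x - y) * of_real t) - e * (exp (- \<alpha> * R\<^sup>2 * (1 - t)\<^sup>2) - exp (- \<alpha> * R\<^sup>2)))"
  have "((\<lambda>t. v (y + (x - y) * of_real t)) has_vector_derivative 0) (at 0)"
    using has_derivative_along_line[of v D y "x - y" 0] D \<open>D = _\<close> by simp
  then have "(g has_real_derivative 0 - e * (2 * \<alpha> * R\<^sup>2 * exp (- \<alpha> * R\<^sup>2))) (at 0)"
    unfolding g_def has_real_derivative_iff_has_vector_derivative[symmetric]
    by (auto intro!: derivative_eq_intros simp: power2_eq_square)
  moreover have "0 - e * (2 * \<alpha> * R\<^sup>2 * exp (- \<alpha> * R\<^sup>2)) < 0"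
    using e \<alpha> R by simp
  ultimately obtain d where d: "d > 0" "\<And>h. 0 < h \<Longrightarrow> h < d \<Longrightarrow> g h < g 0"
    using DERIV_neg_dec_right[of g "0 - e * (2 * \<alpha> * R\<^sup>2 * exp (- \<alpha> * R\<^sup>2))" 0]
    by (metis add.left_neutral)
  define t where "t = min (1 / 2) (d / 2)"
  have t: "0 < t" "t \<le> 1 / 2" "t < d" using d(1) by (auto simp: t_def)
  define w where "w = y + (x - y) * of_real t"
  have "w - x = (y - x) * of_real (1 - t)" by (simp add: w_def algebra_simps)
  then have wx: "cmod (w - x) = R * (1 - t)"
    using t by (simp only: norm_mult norm_of_real) (simp add: R_def dist_norm norm_minus_commute)
  have "R / 2 \<le> R * (1 - t)" "R * (1 - t) \<le> R" using t R by (simp_all add: field_simps)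
  then have "w \<in> K" by (simp add: K_def wx)
  moreover have "\<psi> w = g t"
    unfolding \<psi>_def \<eta>_def wx g_def by (simp add: w_def power_mult_distrib)
  moreover have "g 0 = 0" by (simp add: g_def y_in(2))
  ultimately show False using \<psi>_nonneg[of w] d(2)[of t] t by simp
qed

section \<open>Maximum principles for ratios of densities on a surface\<close>

lemma atlas_cover:
  assumes "holomorphic_atlas A" obtains c where "c \<in> A" "p \<in> cdom c"
  using assms unfolding holomorphic_atlas_def by blast

lemma chart_open:
  assumes "holomorphic_atlas A" "c \<in> A"
  shows "open (cdom c)" "open (coord c ` cdom c)"
    and "homeomorphism (cdom c) (coord c ` cdom c) (coord c) (chart_inv c)"
  using assms unfolding holomorphic_atlas_def by blast+

lemma chart_inv_coord:
  assumes "holomorphic_atlas A" "c \<in> A" "p \<in> cdom c"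
  shows "chart_inv c (coord c p) = p"
  using chart_open(3)[OF assms(1,2)] assms(3) by (simp add: homeomorphism_def)

lemma coord_chart_inv:
  assumes "holomorphic_atlas A" "c \<in> A" "w \<in> coord c ` cdom c"
  shows "coord c (chart_inv c w) = w" "chart_inv c w \<in> cdom c"
  using chart_open(3)[OF assms(1,2)] assms(3) by (auto simp: homeomorphism_def)

lemma eventually_in_chart:
  assumes "holomorphic_atlas A" "c \<in> A" "p \<in> cdom c"
  shows "\<forall>\<^sub>F w in nhds (coord c p). w \<in> coord c ` cdom c"
  using chart_open(2)[OF assms(1,2)] assms(3) by (intro eventually_nhds_in_open) auto

lemma chart_overlap_image:
  assumes "holomorphic_atlas A" "c \<in> A"
  shows "coord c ` (cdom c \<inter> S) = (coord c ` cdom c) \<inter> chart_inv c -` S"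
  using chart_inv_coord[OF assms] by force

lemma open_chart_overlap:
  assumes "holomorphic_atlas A" "c \<in> A" "open S"
  shows "open (coord c ` (cdom c \<inter> S))"
proof -
  have "continuous_on (coord c ` cdom c) (chart_inv c)"
    using chart_open(3)[OF assms(1,2)] by (simp add: homeomorphism_def)
  then show ?thesis
    unfolding chart_overlap_image[OF assms(1,2)]
    by (rule continuous_open_preimage[OF _ chart_open(2)[OF assms(1,2)] assms(3)])
qed

lemma canonical_lb_refl:
  assumes "holomorphic_atlas A" "c \<in> A" "p \<in> cdom c"
  shows "canonical_lb c c p = 1"
proof -
  have "\<forall>\<^sub>F w in nhds (coord c p). coord c (chart_inv c w) = w"
    using eventually_in_chart[OF assms] by eventually_elim (rule coord_chart_inv[OF assms(1,2)])
  then have "deriv (\<lambda>w. coord c (chart_inv c w)) (coord c p) = deriv (\<lambda>w. w) (coord c p)"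
    by (intro deriv_cong_ev) auto
  then show ?thesis by (simp add: canonical_lb_def)
qed

text \<open>
  The chain rule for the change of coordinates.
\<close>

lemma canonical_lb_cocycle:
  assumes A: "holomorphic_atlas A" and "c \<in> A" "d \<in> A" "e \<in> A"
    and p: "p \<in> cdom c" "p \<in> cdom d" "p \<in> cdom e"
  shows "canonical_lb c e p = canonical_lb c d p * canonical_lb d e p"
proof -
  define f where "f = (\<lambda>w. coord d (chart_inv c w))"
  define g where "g = (\<lambda>w. coord e (chart_inv d w))"
  have fp: "f (coord c p) = coord d p" by (simp add: f_def chart_inv_coord[OF A \<open>c \<in> A\<close> p(1)])
  have "f holomorphic_on coord c ` (cdom c \<inter> cdom d)" "g holomorphic_on coord d ` (cdom d \<inter> cdom e)"
    using A assms(2-4) unfolding holomorphic_atlas_def f_def g_def by blast+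
  moreover have "open (coord c ` (cdom c \<inter> cdom d))" "open (coord d ` (cdom d \<inter> cdom e))"
    using open_chart_overlap[OF A] chart_open(1)[OF A] assms(2-4) by blast+
  ultimately have fd: "f field_differentiable at (coord c p)" "g field_differentiable at (f (coord c p))"
    using p unfolding fp by (auto intro: holomorphic_on_imp_differentiable_at)
  have "\<forall>\<^sub>F w in nhds (coord c p). w \<in> coord c ` (cdom c \<inter> cdom d)"
    using open_chart_overlap[OF A \<open>c \<in> A\<close> chart_open(1)[OF A \<open>d \<in> A\<close>]] p
    by (intro eventually_nhds_in_open) auto
  then have "\<forall>\<^sub>F w in nhds (coord c p). coord e (chart_inv c w) = (g \<circ> f) w"
  proof eventually_elim
    case (elim w)
    then have "chart_inv c w \<in> cdom d" by (auto simp: chart_overlap_image[OF A \<open>c \<in> A\<close>])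
    then show ?case by (simp add: f_def g_def chart_inv_coord[OF A \<open>d \<in> A\<close>])
  qed
  then have "canonical_lb c e p = deriv (g \<circ> f) (coord c p)"
    unfolding canonical_lb_def by (intro deriv_cong_ev) auto
  also have "\<dots> = deriv g (f (coord c p)) * deriv f (coord c p)"
    by (rule deriv_chain[OF fd])
  finally show ?thesis unfolding fp by (simp add: canonical_lb_def f_def g_def mult.commute)
qed

lemma canonical_lb_nonzero:
  assumes "holomorphic_atlas A" "c \<in> A" "d \<in> A" "p \<in> cdom c" "p \<in> cdom d"
  shows "canonical_lb c d p \<noteq> 0"
  using canonical_lb_cocycle[of A c d c p] canonical_lb_refl[of A c p] assms by auto

text \<open>
  The coefficient of \<open>\<bar>dz\<bar>\<^sup>2\<^sup>k\<close> in each chart. The quotient of two densities of equal weight is a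
  function on the surface.
\<close>

definition weight_density :: "'a::topological_space chart set \<Rightarrow> nat \<Rightarrow> ('a chart \<Rightarrow> 'a \<Rightarrow> real) \<Rightarrow> bool" where
  "weight_density A k F \<longleftrightarrow>
     (\<forall>c\<in>A. continuous_on (coord c ` cdom c) (\<lambda>w. F c (chart_inv c w)) \<and> (\<forall>p\<in>cdom c. 0 \<le> F c p)) \<and>
     (\<forall>c\<in>A. \<forall>d\<in>A. \<forall>p\<in>cdom c \<inter> cdom d. F c p = cmod (canonical_lb c d p) ^ (2 * k) * F d p)"

text \<open>
  The function \<open>log F\<close>, in the coordinate of the chart \<open>c\<close>, has \<open>\<partial>\<partial>\<^sup>*\<close> equal to \<open>l\<close> at \<open>p\<close>. Positivity near
  the point is part of the notion, since \<open>ln\<close> takes the conventional value \<open>0\<close> at \<open>0\<close>.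
\<close>

definition log_ddbar :: "'a chart \<Rightarrow> ('a chart \<Rightarrow> 'a \<Rightarrow> real) \<Rightarrow> 'a \<Rightarrow> real \<Rightarrow> bool" where
  "log_ddbar c F p l \<longleftrightarrow>
     (\<forall>\<^sub>F w in nhds (coord c p). 0 < F c (chart_inv c w)) \<and>
     has_ddbar (\<lambda>w. ln (F c (chart_inv c w))) (coord c p) l"

lemma log_ddbar_mult:
  assumes "log_ddbar c F p l" and "log_ddbar c G p m"
  shows "log_ddbar c (\<lambda>c p. F c p * G c p) p (l + m)"
proof -
  have ev: "\<forall>\<^sub>F w in nhds (coord c p). 0 < F c (chart_inv c w) \<and> 0 < G c (chart_inv c w)"
    using assms by (auto simp: log_ddbar_def eventually_conj_iff)
  then have "\<forall>\<^sub>F w in nhds (coord c p). 0 < F c (chart_inv c w) * G c (chart_inv c w)"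
    by eventually_elim simp
  moreover have "has_ddbar (\<lambda>w. 1 * ln (F c (chart_inv c w)) + 1 * ln (G c (chart_inv c w)))
      (coord c p) (1 * l + 1 * m)"
    using assms by (intro has_ddbar_lincomb) (auto simp: log_ddbar_def)
  then have "has_ddbar (\<lambda>w. ln (F c (chart_inv c w) * G c (chart_inv c w))) (coord c p) (1 * l + 1 * m)"
    by (rule has_ddbar_cong) (use ev in eventually_elim, simp add: ln_mult)
  ultimately show ?thesis by (simp add: log_ddbar_def)
qed

lemma log_ddbar_inverse:
  assumes "log_ddbar c F p l"
  shows "log_ddbar c (\<lambda>c p. inverse (F c p)) p (- l)"
proof -
  have ev: "\<forall>\<^sub>F w in nhds (coord c p). 0 < F c (chart_inv c w)"
    using assms by (auto simp: log_ddbar_def)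
  have dd: "has_ddbar (\<lambda>w. ln (F c (chart_inv c w))) (coord c p) l"
    using assms by (simp add: log_ddbar_def)
  have "has_ddbar (\<lambda>w. ln (inverse (F c (chart_inv c w)))) (coord c p) (- 1 * l + 0 * l)"
    using has_ddbar_lincomb[OF dd dd]
    by (rule has_ddbar_cong) (use ev in eventually_elim, simp add: ln_inverse)
  moreover have "\<forall>\<^sub>F w in nhds (coord c p). 0 < inverse (F c (chart_inv c w))"
    using ev by eventually_elim simp
  ultimately show ?thesis by (simp add: log_ddbar_def)
qed

lemma log_ddbar_scale:
  assumes "log_ddbar c F p l" and "r > 0"
  shows "log_ddbar c (\<lambda>c p. r * F c p) p l"
  using log_ddbar_mult[of c "\<lambda>c p. r" p 0 F l] assms has_ddbar_const by (simp add: log_ddbar_def)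

lemma log_ddbar_square:
  "log_ddbar c F p l \<Longrightarrow> log_ddbar c (\<lambda>c p. (F c p)\<^sup>2) p (2 * l)"
  using log_ddbar_mult[of c F p l F l] by (simp add: power2_eq_square)

lemma weight_densityI:
  assumes "\<And>c. c \<in> A \<Longrightarrow> continuous_on (coord c ` cdom c) (\<lambda>w. F c (chart_inv c w))"
    and "\<And>c p. c \<in> A \<Longrightarrow> p \<in> cdom c \<Longrightarrow> 0 \<le> F c p"
    and "\<And>c d p. c \<in> A \<Longrightarrow> d \<in> A \<Longrightarrow> p \<in> cdom c \<Longrightarrow> p \<in> cdom d \<Longrightarrow>
      F c p = cmod (canonical_lb c d p) ^ (2 * k) * F d p"
  shows "weight_density A k F"
  using assms unfolding weight_density_def by blast

lemma weight_density_nonneg: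
  "weight_density A k F \<Longrightarrow> c \<in> A \<Longrightarrow> p \<in> cdom c \<Longrightarrow> 0 \<le> F c p"
  unfolding weight_density_def by blast

lemma weight_density_continuous:
  "weight_density A k F \<Longrightarrow> c \<in> A \<Longrightarrow> continuous_on (coord c ` cdom c) (\<lambda>w. F c (chart_inv c w))"
  unfolding weight_density_def by blast

lemma weight_density_change:
  assumes "weight_density A k F" "c \<in> A" "d \<in> A" "p \<in> cdom c" "p \<in> cdom d"
  shows "F c p = cmod (canonical_lb c d p) ^ (2 * k) * F d p"
proof -
  have "\<forall>c\<in>A. \<forall>d\<in>A. \<forall>p\<in>cdom c \<inter> cdom d. F c p = cmod (canonical_lb c d p) ^ (2 * k) * F d p"
    using assms(1) unfolding weight_density_def by (rule conjunct2)
  from this[rule_format, OF assms(2,3) IntI[OF assms(4,5)]] show ?thesis .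
qed

lemma weight_density_mult:
  assumes F: "weight_density A k F" and G: "weight_density A l G"
  shows "weight_density A (k + l) (\<lambda>c p. F c p * G c p)"
proof (rule weight_densityI)
  fix c d p assume "c \<in> A" "d \<in> A" "p \<in> cdom c" "p \<in> cdom d"
  from weight_density_change[OF F this] weight_density_change[OF G this]
  show "F c p * G c p = cmod (canonical_lb c d p) ^ (2 * (k + l)) * (F d p * G d p)"
    by (simp add: distrib_left power_add)
next
  fix c assume c: "c \<in> A"
  show "continuous_on (coord c ` cdom c) (\<lambda>w. F c (chart_inv c w) * G c (chart_inv c w))"
    by (rule continuous_on_mult[OF weight_density_continuous[OF F c] weight_density_continuous[OF G c]])
  show "0 \<le> F c p * G c p" if "p \<in> cdom c" for p
    by (rule mult_nonneg_nonneg[OF weight_density_nonneg[OF F c that] weight_density_nonneg[OF G c that]])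
qed

lemma weight_density_square:
  "weight_density A k F \<Longrightarrow> weight_density A (2 * k) (\<lambda>c p. (F c p)\<^sup>2)"
  by (subst mult_2, subst power2_eq_square) (rule weight_density_mult)

lemma weight_density_scale:
  assumes F: "weight_density A k F" and r: "0 \<le> r"
  shows "weight_density A k (\<lambda>c p. r * F c p)"
proof (rule weight_densityI)
  fix c d p assume "c \<in> A" "d \<in> A" "p \<in> cdom c" "p \<in> cdom d"
  from weight_density_change[OF F this]
  show "r * F c p = cmod (canonical_lb c d p) ^ (2 * k) * (r * F d p)"
    by simp
next
  fix c assume c: "c \<in> A"
  show "continuous_on (coord c ` cdom c) (\<lambda>w. r * F c (chart_inv c w))"
    by (rule continuous_on_mult[OF continuous_on_const weight_density_continuous[OF F c]])
  show "0 \<le> r * F c p" if "p \<in> cdom c" for p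
    by (rule mult_nonneg_nonneg[OF r weight_density_nonneg[OF F c that]])
qed

lemma weight_density_add:
  assumes F: "weight_density A k F" and G: "weight_density A k G"
  shows "weight_density A k (\<lambda>c p. F c p + G c p)"
proof (rule weight_densityI)
  fix c d p assume "c \<in> A" "d \<in> A" "p \<in> cdom c" "p \<in> cdom d"
  from weight_density_change[OF F this] weight_density_change[OF G this]
  show "F c p + G c p = cmod (canonical_lb c d p) ^ (2 * k) * (F d p + G d p)"
    by (simp add: distrib_left)
next
  fix c assume c: "c \<in> A"
  show "continuous_on (coord c ` cdom c) (\<lambda>w. F c (chart_inv c w) + G c (chart_inv c w))"
    by (rule continuous_on_add[OF weight_density_continuous[OF F c] weight_density_continuous[OF G c]])
  show "0 \<le> F c p + G c p" if "p \<in> cdom c" for p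
    by (rule add_nonneg_nonneg[OF weight_density_nonneg[OF F c that] weight_density_nonneg[OF G c that]])
qed

lemma weight_density_isCont:
  assumes "holomorphic_atlas A" "weight_density A k F" "c \<in> A" "p \<in> cdom c"
  shows "isCont (\<lambda>w. F c (chart_inv c w)) (coord c p)"
  using weight_density_continuous[OF assms(2,3)] assms(4)
  by (simp add: continuous_on_eq_continuous_at[OF chart_open(2)[OF assms(1,3)]])

text \<open>
  The factors \<open>\<bar>K\<bar>\<^sup>2\<^sup>k\<close> cancel in the quotient.
\<close>

lemma ratio_function:
  fixes A :: "'a::t2_space chart set"
  assumes A: "holomorphic_atlas A" and F: "weight_density A k F" and G: "weight_density A k G"
    and pos: "\<And>c p. c \<in> A \<Longrightarrow> p \<in> cdom c \<Longrightarrow> 0 < G c p"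
  shows "\<exists>R. continuous_on UNIV R \<and> (\<forall>c\<in>A. \<forall>p\<in>cdom c. R p = F c p / G c p)"
proof -
  define ch where "ch = (\<lambda>p. SOME c. c \<in> A \<and> p \<in> cdom c)"
  define R where "R = (\<lambda>p. F (ch p) p / G (ch p) p)"
  have "\<exists>c. c \<in> A \<and> p \<in> cdom c" for p
    by (rule atlas_cover[OF A, of p]) blast
  then have ch: "ch p \<in> A \<and> p \<in> cdom (ch p)" for p
    unfolding ch_def by (rule someI_ex)
  have R: "R p = F c p / G c p" if "c \<in> A" "p \<in> cdom c" for c p
  proof -
    have "F c p = cmod (canonical_lb c (ch p) p) ^ (2 * k) * F (ch p) p"
      "G c p = cmod (canonical_lb c (ch p) p) ^ (2 * k) * G (ch p) p"
      by (rule weight_density_change[OF F that(1) conjunct1[OF ch] that(2) conjunct2[OF ch]])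
        (rule weight_density_change[OF G that(1) conjunct1[OF ch] that(2) conjunct2[OF ch]])
    moreover have "canonical_lb c (ch p) p \<noteq> 0"
      by (rule canonical_lb_nonzero[OF A that(1) conjunct1[OF ch] that(2) conjunct2[OF ch]])
    ultimately show ?thesis by (simp add: R_def)
  qed
  have "continuous_on (cdom c) R" if "c \<in> A" for c
  proof -
    have "continuous_on (coord c ` cdom c) (\<lambda>w. F c (chart_inv c w) / G c (chart_inv c w))"
      using pos[OF that coord_chart_inv(2)[OF A that]]
      by (intro continuous_on_divide weight_density_continuous[OF F that] weight_density_continuous[OF G that])
        fastforce
    moreover have "continuous_on (cdom c) (coord c)"
      using chart_open(3)[OF A that] by (simp add: homeomorphism_def)
    ultimately have "continuous_on (cdom c) (\<lambda>p. F c (chart_inv c (coord c p)) / G c (chart_inv c (coord c p)))"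
      using continuous_on_compose2 by blast
    then show ?thesis
      by (rule continuous_on_eq) (simp add: R[OF that] chart_inv_coord[OF A that])
  qed
  then have "continuous_on (\<Union>c\<in>A. cdom c) R"
    using chart_open(1)[OF A] by (intro continuous_on_open_UN) auto
  then have "continuous_on UNIV R"
    using A by (simp add: holomorphic_atlas_def)
  then show ?thesis using R by blast
qed

text \<open>
  The weak maximum principle in the form used throughout: \<open>M\<close> is the maximum of the quotient \<open>F / G\<close>
  on the compact surface, attained at \<open>p\<close>, and the comparison of the two values of \<open>\<partial>\<partial>\<^sup>* log\<close> is the second
  derivative test for \<open>log F - log G\<close>.
\<close>

lemma ratio_maximum_point:
  fixes A :: "'a::t2_space chart set"
  assumes surface: "closed_riemann_surface A"
    and F: "weight_density A k F" and G: "weight_density A k G"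
    and pos: "\<And>c p. c \<in> A \<Longrightarrow> p \<in> cdom c \<Longrightarrow> 0 < G c p"
  obtains M c p where "c \<in> A" "p \<in> cdom c" "F c p = M * G c p" "0 \<le> M"
    and "\<And>d x. d \<in> A \<Longrightarrow> x \<in> cdom d \<Longrightarrow> F d x \<le> M * G d x"
    and "\<And>l m. log_ddbar c F p l \<Longrightarrow> log_ddbar c G p m \<Longrightarrow> l \<le> m"
proof -
  have A: "holomorphic_atlas A" and comp: "compact (UNIV :: 'a set)"
    using surface by (auto simp: closed_riemann_surface_def)
  obtain R where "continuous_on UNIV R \<and> (\<forall>c\<in>A. \<forall>p\<in>cdom c. R p = F c p / G c p)"
    using ratio_function[OF A F G pos] by (rule exE)
  then have R: "continuous_on UNIV R" "\<And>c p. c \<in> A \<Longrightarrow> p \<in> cdom c \<Longrightarrow> R p = F c p / G c p"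
    by auto
  obtain p where p: "\<And>x. R x \<le> R p"
    using continuous_attains_sup[OF comp _ R(1)] by auto
  obtain c where c: "c \<in> A" "p \<in> cdom c" by (rule atlas_cover[OF A])
  have eq: "F c p = R p * G c p" using R(2)[OF c] pos[OF c] by simp
  have le: "F d x \<le> R p * G d x" if "d \<in> A" "x \<in> cdom d" for d x
    using p[of x] R(2)[OF that] pos[OF that] by (simp add: field_simps)
  have max: "l \<le> m" if l: "log_ddbar c F p l" and m: "log_ddbar c G p m" for l m
  proof -
    let ?z = "coord c p"
    have "has_ddbar (\<lambda>w. 1 * ln (F c (chart_inv c w)) + - 1 * ln (G c (chart_inv c w))) ?z (1 * l + - 1 * m)"
      using l m by (intro has_ddbar_lincomb) (auto simp: log_ddbar_def)
    moreover have "\<forall>\<^sub>F w in nhds ?z. w \<in> coord c ` cdom c \<and> 0 < F c (chart_inv c w)"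
      using l eventually_in_chart[OF A c] by (auto simp: log_ddbar_def eventually_conj_iff)
    then have "\<forall>\<^sub>F w in nhds ?z. 1 * ln (F c (chart_inv c w)) + - 1 * ln (G c (chart_inv c w))
        \<le> 1 * ln (F c (chart_inv c ?z)) + - 1 * ln (G c (chart_inv c ?z))"
    proof eventually_elim
      case (elim w)
      let ?x = "chart_inv c w"
      have x: "?x \<in> cdom c" using coord_chart_inv(2)[OF A c(1)] elim by blast
      have "R ?x > 0" using R(2)[OF c(1) x] elim pos[OF c(1) x] by simp
      have "ln (F c y) - ln (G c y) = ln (R y)" if "y \<in> cdom c" "R y > 0" for y
        using R(2)[OF c(1) that(1)] that(2) pos[OF c(1) that(1)]
        by (simp add: ln_div zero_less_divide_iff)
      moreover have "R p > 0" using p[of ?x] \<open>R ?x > 0\<close> by simp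
      moreover have "ln (R ?x) \<le> ln (R p)" using p[of ?x] \<open>R ?x > 0\<close> by simp
      ultimately show ?case using x c(2) \<open>R ?x > 0\<close> chart_inv_coord[OF A c] by simp
    qed
    ultimately have "1 * l + - 1 * m \<le> 0" by (rule has_ddbar_local_max)
    then show ?thesis by simp
  qed
  have "0 \<le> R p" using R(2)[OF c] pos[OF c] weight_density_nonneg[OF F c] by simp
  then show ?thesis by (rule that[OF c eq _ le max])
qed

lemma isCont_tendsto_nhds: "isCont f z \<Longrightarrow> (f \<longlongrightarrow> f z) (nhds z)"
  by (simp add: isCont_def tendsto_at_iff_tendsto_nhds)

text \<open>
  The set where \<open>F = G\<close> is closed, and it is open by the strong maximum principle applied to
  \<open>v = log G - log F\<close>: near a point of this set the hypothesis gives
  \<open>\<partial>\<partial>\<^sup>* v \<le> B (1 - F / G) \<le> B v\<close>, since \<open>log x \<le> x - 1\<close>, and \<open>B\<close> is locally bounded. Requiring the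
  inequality only where \<open>F > \<theta> G\<close> keeps it away from the zeros of \<open>F\<close>.
\<close>

lemma ratio_strong_maximum:
  fixes A :: "'a::t2_space chart set"
  assumes surface: "closed_riemann_surface A"
    and F: "weight_density A k F" and G: "weight_density A k G" and B: "weight_density A j B"
    and pos: "\<And>c p. c \<in> A \<Longrightarrow> p \<in> cdom c \<Longrightarrow> 0 < G c p"
    and le: "\<And>c p. c \<in> A \<Longrightarrow> p \<in> cdom c \<Longrightarrow> F c p \<le> G c p"
    and dF: "\<And>c p. c \<in> A \<Longrightarrow> p \<in> cdom c \<Longrightarrow> 0 < F c p \<Longrightarrow> log_ddbar c F p (lF c p)"
    and dG: "\<And>c p. c \<in> A \<Longrightarrow> p \<in> cdom c \<Longrightarrow> log_ddbar c G p (lG c p)"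
    and \<theta>: "0 \<le> \<theta>" "\<theta> < 1"
    and ineq: "\<And>c p. c \<in> A \<Longrightarrow> p \<in> cdom c \<Longrightarrow> \<theta> * G c p < F c p \<Longrightarrow>
        B c p * (F c p / G c p - 1) \<le> lF c p - lG c p"
  shows "(\<forall>c\<in>A. \<forall>p\<in>cdom c. F c p < G c p) \<or>
         (\<forall>c\<in>A. \<forall>p\<in>cdom c. F c p = G c p \<and> lF c p = lG c p)"
proof -
  have A: "holomorphic_atlas A" and conn: "connected (UNIV :: 'a set)"
    using surface by (auto simp: closed_riemann_surface_def)
  obtain R where "continuous_on UNIV R \<and> (\<forall>c\<in>A. \<forall>p\<in>cdom c. R p = F c p / G c p)"
    using ratio_function[OF A F G pos] by (rule exE)
  then have R: "continuous_on UNIV R" "\<And>c p. c \<in> A \<Longrightarrow> p \<in> cdom c \<Longrightarrow> R p = F c p / G c p"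
    by auto
  define Z where "Z = {p. R p = 1}"
  have eq_iff: "R p = 1 \<longleftrightarrow> F c p = G c p" if "c \<in> A" "p \<in> cdom c" for c p
    unfolding R(2)[OF that] using pos[OF that] by (auto simp: divide_eq_1_iff)
  have "closed Z"
    using continuous_closed_preimage_constant[OF R(1) closed_UNIV, of 1] by (simp add: Z_def)
  moreover have "open Z"
  proof (subst open_subopen, intro ballI)
    fix p assume "p \<in> Z"
    obtain c where c: "c \<in> A" "p \<in> cdom c" by (rule atlas_cover[OF A])
    let ?z = "coord c p"
    define v where "v = (\<lambda>w. - 1 * ln (F c (chart_inv c w)) + 1 * ln (G c (chart_inv c w)))"
    have eq: "F c p = G c p" using \<open>p \<in> Z\<close> eq_iff[OF c] by (simp add: Z_def)
    have inv: "chart_inv c ?z = p" by (rule chart_inv_coord[OF A c])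
    have cF: "isCont (\<lambda>w. F c (chart_inv c w)) ?z" and cG: "isCont (\<lambda>w. G c (chart_inv c w)) ?z"
      and cB: "isCont (\<lambda>w. B c (chart_inv c w)) ?z"
      using weight_density_isCont[OF A _ c] F G B by blast+
    have "isCont (\<lambda>w. F c (chart_inv c w) - \<theta> * G c (chart_inv c w)) ?z"
      using cF cG by (intro continuous_intros)
    from isCont_tendsto_nhds[OF this]
    have "((\<lambda>w. F c (chart_inv c w) - \<theta> * G c (chart_inv c w)) \<longlongrightarrow> F c p - \<theta> * G c p) (nhds ?z)"
      by (simp add: inv)
    moreover have "F c p - \<theta> * G c p > 0" using eq pos[OF c] \<theta> by simp
    ultimately have "\<forall>\<^sub>F w in nhds ?z. 0 < F c (chart_inv c w) - \<theta> * G c (chart_inv c w)"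
      by (rule order_tendstoD(1))
    moreover have "((\<lambda>w. B c (chart_inv c w)) \<longlongrightarrow> B c p) (nhds ?z)"
      using isCont_tendsto_nhds[OF cB] by (simp add: inv)
    then have "\<forall>\<^sub>F w in nhds ?z. B c (chart_inv c w) < B c p + 1"
      by (rule order_tendstoD(2)) simp
    ultimately have "\<forall>\<^sub>F w in nhds ?z. w \<in> coord c ` cdom c \<and>
        0 < F c (chart_inv c w) - \<theta> * G c (chart_inv c w) \<and> B c (chart_inv c w) < B c p + 1"
      using eventually_in_chart[OF A c] by eventually_elim auto
    then obtain r where r: "r > 0" "\<And>w. w \<in> ball ?z r \<Longrightarrow> w \<in> coord c ` cdom c \<and>
        0 < F c (chart_inv c w) - \<theta> * G c (chart_inv c w) \<and> B c (chart_inv c w) < B c p + 1"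
      unfolding eventually_nhds_metric by (auto simp: dist_commute)
    have super: "0 \<le> v w \<and> (\<exists>l. has_ddbar v w l \<and> l \<le> (B c p + 1) * v w) \<and>
        (v w = 0 \<longrightarrow> chart_inv c w \<in> Z)" if w: "w \<in> ball ?z r" for w
    proof -
      let ?x = "chart_inv c w"
      have x: "?x \<in> cdom c" "coord c ?x = w" using coord_chart_inv[OF A c(1)] r(2)[OF w] by blast+
      have gt: "\<theta> * G c ?x < F c ?x" using r(2)[OF w] by simp
      moreover have "0 \<le> \<theta> * G c ?x" using \<theta> pos[OF c(1) x(1)] by simp
      ultimately have Fx: "0 < F c ?x" by linarith
      have Gx: "0 < G c ?x" by (rule pos[OF c(1) x(1)])
      have v: "v w = - ln (F c ?x / G c ?x)" using Fx Gx by (simp add: v_def ln_div)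
      have q: "F c ?x / G c ?x \<le> 1" using le[OF c(1) x(1)] Gx by simp
      have "ln (F c ?x / G c ?x) \<le> F c ?x / G c ?x - 1" using Fx Gx by (intro ln_le_minus_one) simp
      then have v_ge: "1 - F c ?x / G c ?x \<le> v w" by (simp add: v)
      have "has_ddbar v w (- 1 * lF c ?x + 1 * lG c ?x)"
        using has_ddbar_lincomb[of _ "coord c ?x"] dF[OF c(1) x(1) Fx] dG[OF c(1) x(1)]
        unfolding v_def log_ddbar_def x(2) by blast
      moreover have "- 1 * lF c ?x + 1 * lG c ?x \<le> (B c p + 1) * v w"
      proof -
        have "lG c ?x - lF c ?x \<le> B c ?x * (1 - F c ?x / G c ?x)"
          using ineq[OF c(1) x(1) gt] by (simp add: algebra_simps)
        also have "\<dots> \<le> (B c p + 1) * (1 - F c ?x / G c ?x)"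
          using r(2)[OF w] q by (intro mult_right_mono) auto
        also have "\<dots> \<le> (B c p + 1) * v w"
          using v_ge weight_density_nonneg[OF B c] by (intro mult_left_mono) auto
        finally show ?thesis by simp
      qed
      moreover have "0 \<le> v w" using v_ge q by linarith
      moreover have "?x \<in> Z" if "v w = 0"
        using that Fx Gx eq_iff[OF c(1) x(1)] by (simp add: v Z_def)
      ultimately show ?thesis by blast
    qed
    have "v w = 0" if "w \<in> ball ?z (r / 2)" for w
    proof (rule strong_maximum_local[OF _ _ _ _ that])
      show "0 \<le> B c p + 1" using weight_density_nonneg[OF B c] by simp
      show "v ?z = 0" by (simp add: v_def inv eq)
    qed (use super in blast)+
    then have Zw: "chart_inv c w \<in> Z" if "w \<in> ball ?z (r / 2)" for w
      using super[of w] that r(1) by auto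
    define T where "T = cdom c \<inter> coord c -` ball ?z (r / 2)"
    have "open T"
      unfolding T_def using chart_open(3)[OF A c(1)]
      by (intro continuous_open_preimage chart_open(1)[OF A c(1)]) (auto simp: homeomorphism_def)
    moreover have "p \<in> T" using c r(1) by (simp add: T_def)
    moreover have "T \<subseteq> Z" using Zw chart_inv_coord[OF A c(1)] by (force simp: T_def)
    ultimately show "\<exists>T. open T \<and> p \<in> T \<and> T \<subseteq> Z" by blast
  qed
  ultimately have "Z = {} \<or> Z = UNIV" using conn by (simp add: connected_clopen)
  then show ?thesis
  proof
    assume "Z = {}"
    then show ?thesis using eq_iff le by (fastforce simp: Z_def less_le)
  next
    assume Z: "Z = UNIV"
    have FG: "F c p = G c p" if "c \<in> A" "p \<in> cdom c" for c p
      using eq_iff[OF that] Z by (auto simp: Z_def)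
    have "lF c p = lG c p" if c: "c \<in> A" "p \<in> cdom c" for c p
    proof -
      have "has_ddbar (\<lambda>w. ln (F c (chart_inv c w))) (coord c p) (lF c p)"
        using dF[OF c] pos[OF c] FG[OF c] by (simp add: log_ddbar_def)
      moreover have "\<forall>\<^sub>F w in nhds (coord c p). ln (F c (chart_inv c w)) = ln (G c (chart_inv c w))"
        using eventually_in_chart[OF A c]
        by eventually_elim (use FG[OF c(1)] coord_chart_inv(2)[OF A c(1)] in auto)
      ultimately have "has_ddbar (\<lambda>w. ln (G c (chart_inv c w))) (coord c p) (lF c p)"
        by (rule has_ddbar_cong)
      moreover have "has_ddbar (\<lambda>w. ln (G c (chart_inv c w))) (coord c p) (lG c p)"
        using dG[OF c] by (simp add: log_ddbar_def)
      ultimately show ?thesis by (rule has_ddbar_unique)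
    qed
    then show ?thesis using FG by blast
  qed
qed

text \<open>
  If \<open>\<partial>\<partial>\<^sup>* log F\<close> exceeds \<open>\<partial>\<partial>\<^sup>* log G\<close> wherever \<open>F > G\<close>, then the maximum of \<open>F / G\<close> cannot be larger
  than 1.
\<close>

lemma ratio_le:
  fixes A :: "'a::t2_space chart set"
  assumes surface: "closed_riemann_surface A"
    and F: "weight_density A k F" and G: "weight_density A k G"
    and pos: "\<And>c p. c \<in> A \<Longrightarrow> p \<in> cdom c \<Longrightarrow> 0 < G c p"
    and bad: "\<And>c p. c \<in> A \<Longrightarrow> p \<in> cdom c \<Longrightarrow> G c p < F c p \<Longrightarrow>
      \<exists>l m. log_ddbar c F p l \<and> log_ddbar c G p m \<and> m < l"
    and cp: "c \<in> A" "p \<in> cdom c"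
  shows "F c p \<le> G c p"
proof -
  obtain M d x where x: "d \<in> A" "x \<in> cdom d" "F d x = M * G d x"
    and le: "\<And>d x. d \<in> A \<Longrightarrow> x \<in> cdom d \<Longrightarrow> F d x \<le> M * G d x"
    and max: "\<And>l m. log_ddbar d F x l \<Longrightarrow> log_ddbar d G x m \<Longrightarrow> l \<le> m"
    using ratio_maximum_point[OF surface F G pos] by metis
  have "F d x \<le> G d x" using bad[OF x(1,2)] max by force
  then have "M \<le> 1" using x(3) pos[OF x(1,2)] by simp
  then have "M * G c p \<le> G c p" using pos[OF cp] by simp
  then show ?thesis using le[OF cp] by linarith
qed

section \<open>Sums of numbers with dominated partial products\<close>

text \<open>
  Put \<open>d\<^sub>i = log (y\<^sub>i / x\<^sub>i)\<close>. Then \<open>y\<^sub>i - x\<^sub>i \<ge> x\<^sub>i d\<^sub>i\<close> because \<open>t - 1 \<ge> log t\<close>. The partial sums of the \<open>d\<^sub>i\<close>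
  are nonnegative by the hypothesis on products, and \<open>x\<close> is decreasing, so \<open>\<Sum>\<^sub>i x\<^sub>i d\<^sub>i \<ge> 0\<close> by
  summation by parts. Vanishing entries of \<open>x\<close> form a final segment and contribute \<open>y\<^sub>i \<ge> 0\<close>.
\<close>

lemma sum_less_of_partial_products:
  fixes x y :: "nat \<Rightarrow> real"
  assumes nonneg: "\<And>i. i < n \<Longrightarrow> 0 \<le> x i" "\<And>i. i < n \<Longrightarrow> 0 \<le> y i"
    and desc: "\<And>i j. i \<le> j \<Longrightarrow> j < n \<Longrightarrow> x j \<le> x i"
    and prods: "\<And>k. k \<le> n \<Longrightarrow> (\<Prod>i<k. x i) \<le> (\<Prod>i<k. y i)"
    and neq: "\<exists>i<n. x i \<noteq> y i"
  shows "(\<Sum>i<n. x i) < (\<Sum>i<n. y i)"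
proof -
  define d where "d = (\<lambda>i. ln (y i / x i))"
  have xpos: "0 < (\<Prod>i<Suc k. x i)" if "k < n" "0 < x k" for k
    using that desc[of _ k] by (intro prod_pos) (auto simp: less_Suc_eq_le intro: less_le_trans)
  have ypos: "0 < y k" if "k < n" "0 < x k" for k
  proof -
    have "0 < (\<Prod>i<Suc k. y i)"
      using xpos[OF that] prods[of "Suc k"] that by simp
    then have "y k \<noteq> 0" by auto
    then show ?thesis using nonneg(2)[OF that(1)] by simp
  qed
  have abel: "0 \<le> (\<Sum>i<k. x i * d i) \<and>
      (\<forall>j. k = Suc j \<longrightarrow> 0 < x j \<longrightarrow> x j * (\<Sum>i<k. d i) \<le> (\<Sum>i<k. x i * d i))" if "k \<le> n" for k
    using that
  proof (induction k)
    case 0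
    then show ?case by simp
  next
    case (Suc k)
    then have k: "k < n" and IH: "0 \<le> (\<Sum>i<k. x i * d i)"
      "\<And>j. k = Suc j \<Longrightarrow> 0 < x j \<Longrightarrow> x j * (\<Sum>i<k. d i) \<le> (\<Sum>i<k. x i * d i)"
      by auto
    show ?case
    proof (cases "x k = 0")
      case True
      then show ?thesis using IH(1) by simp
    next
      case False
      then have xk: "0 < x k" using nonneg(1)[OF k] by simp
      have sum_d: "0 \<le> (\<Sum>i<l. d i)" if l: "l \<le> Suc k" for l
      proof -
        have p: "0 < x i \<and> 0 < y i" if "i < l" for i
          using desc[of i k] ypos[of i] that l k xk by auto
        then have "d i = ln (y i) - ln (x i)" if "i < l" for i
          using p[OF that] by (simp add: d_def ln_div)
        then have "(\<Sum>i<l. d i) = (\<Sum>i<l. ln (y i)) - (\<Sum>i<l. ln (x i))"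
          unfolding sum_subtractf[symmetric] by (intro sum.cong) auto
        also have "\<dots> = ln (\<Prod>i<l. y i) - ln (\<Prod>i<l. x i)"
          using p by (subst (1 2) ln_prod) (auto dest!: p)
        also have "\<dots> \<ge> 0"
          using p prods[of l] l k prod_pos[of "{..<l}" x] by auto
        finally show ?thesis .
      qed
      have "x k * (\<Sum>i<k. d i) \<le> (\<Sum>i<k. x i * d i)"
      proof (cases k)
        case (Suc j)
        have "x k \<le> x j" using desc[of j k] Suc k by simp
        then have "x k * (\<Sum>i<k. d i) \<le> x j * (\<Sum>i<k. d i)"
          using sum_d[of k] by (intro mult_right_mono) auto
        also have "\<dots> \<le> (\<Sum>i<k. x i * d i)" using IH(2)[OF Suc] xk \<open>x k \<le> x j\<close> by simp
        finally show ?thesis .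
      qed simp
      then have A: "x k * (\<Sum>i<Suc k. d i) \<le> (\<Sum>i<Suc k. x i * d i)"
        by (simp add: distrib_left)
      have B: "0 \<le> x k * (\<Sum>i<Suc k. d i)" using sum_d[of "Suc k"] xk by simp
      show ?thesis
      proof (intro conjI allI impI)
        show "0 \<le> (\<Sum>i<Suc k. x i * d i)" using A B by linarith
        show "x j * (\<Sum>i<Suc k. d i) \<le> (\<Sum>i<Suc k. x i * d i)" if "Suc k = Suc j" for j
          using A that by simp
      qed
    qed
  qed
  have le: "x i * d i \<le> y i - x i" and strict: "x i \<noteq> y i \<Longrightarrow> x i * d i < y i - x i" if i: "i < n" for i
  proof -
    have "x i * d i \<le> y i - x i \<and> (x i \<noteq> y i \<longrightarrow> x i * d i < y i - x i)"
    proof (cases "x i = 0")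
      case False
      then have x: "0 < x i" using nonneg(1)[OF i] by simp
      then have "0 < y i / x i" using ypos[OF i] by simp
      then have "d i \<le> y i / x i - 1" "y i / x i \<noteq> 1 \<longrightarrow> d i < y i / x i - 1"
        unfolding d_def using ln_le_minus_one[OF \<open>0 < y i / x i\<close>] ln_eq_minus_one[OF \<open>0 < y i / x i\<close>]
        by (auto simp: less_le)
      moreover have "x i * (y i / x i - 1) = y i - x i" using x by (simp add: field_simps)
      ultimately show ?thesis
        using x mult_left_mono[of "d i" "y i / x i - 1" "x i"]
          mult_strict_left_mono[of "d i" "y i / x i - 1" "x i"] by auto
    qed (use nonneg(2)[OF i] in auto)
    then show "x i * d i \<le> y i - x i" "x i \<noteq> y i \<Longrightarrow> x i * d i < y i - x i" by auto
  qed
  have "(\<Sum>i<n. x i * d i) < (\<Sum>i<n. y i - x i)"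
    using neq le strict by (intro sum_strict_mono_ex1) auto
  then show ?thesis using abel[of n] by (simp add: sum_subtractf)
qed

text \<open>
  The instance with four entries; shorter sequences are padded with zeros.
\<close>

lemma sum4_less_of_partial_products:
  fixes x1 :: real
  assumes "x4 \<le> x3" "x3 \<le> x2" "x2 \<le> x1" "0 \<le> x4"
    and "0 \<le> y1" "0 \<le> y2" "0 \<le> y3" "0 \<le> y4"
    and "x1 \<le> y1" "x1 * x2 \<le> y1 * y2" "x1 * x2 * x3 \<le> y1 * y2 * y3"
      "x1 * x2 * x3 * x4 \<le> y1 * y2 * y3 * y4"
    and "x1 \<noteq> y1 \<or> x2 \<noteq> y2"
  shows "x1 + x2 + x3 + x4 < y1 + y2 + y3 + y4"
proof -
  have four: "i = 0 \<or> i = 1 \<or> i = 2 \<or> i = 3" if "i < 4" for i :: nat using that by auto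
  have "(\<Sum>i<4. [x1, x2, x3, x4] ! i) < (\<Sum>i<4. [y1, y2, y3, y4] ! i)"
  proof (rule sum_less_of_partial_products)
    fix i j :: nat assume "i \<le> j" "j < 4"
    then show "[x1, x2, x3, x4] ! j \<le> [x1, x2, x3, x4] ! i"
      using assms(1-3) four[of i] four[of j] by auto
  next
    fix k :: nat assume "k \<le> 4"
    then have "k = 0 \<or> k = Suc 0 \<or> k = Suc (Suc 0) \<or> k = Suc (Suc (Suc 0)) \<or> k = Suc (Suc (Suc (Suc 0)))" by auto
    then show "(\<Prod>i<k. [x1, x2, x3, x4] ! i) \<le> (\<Prod>i<k. [y1, y2, y3, y4] ! i)"
      using assms by (auto simp: mult_ac)
  next
    have "[x1, x2, x3, x4] ! 0 \<noteq> [y1, y2, y3, y4] ! 0 \<or> [x1, x2, x3, x4] ! 1 \<noteq> [y1, y2, y3, y4] ! 1"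
      using assms by simp
    moreover have "(0::nat) < 4" "(1::nat) < 4" by simp_all
    ultimately show "\<exists>i<4. [x1, x2, x3, x4] ! i \<noteq> [y1, y2, y3, y4] ! i"
      by blast
  next
    fix i :: nat assume "i < 4"
    then show "0 \<le> [x1, x2, x3, x4] ! i" "0 \<le> [y1, y2, y3, y4] ! i"
      using assms(1-8) four[of i] by auto
  qed
  then show ?thesis by (simp add: eval_nat_numeral)
qed

section \<open>Comparison of Toda systems of rank two\<close>

text \<open>
  This turns a bound by \<open>1 - 1 / R\<close>, which arises when one factor of a fixed product is multiplied
  by \<open>R\<close>, into the linear bound required by the strong maximum principle.
\<close>

lemma one_minus_inverse_ge:
  fixes R :: real
  assumes "1 / 2 < R" "R \<le> 1"
  shows "2 * (R - 1) \<le> 1 - 1 / R"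
proof -
  have "1 - 1 / R - 2 * (R - 1) = (1 - R) * (2 * R - 1) / R" using assms by (simp add: field_simps)
  also have "\<dots> \<ge> 0" using assms by simp
  finally show ?thesis by simp
qed

text \<open>
  Where \<open>a > a'\<close>, the equality of products gives \<open>b \<le> b'\<close>, so \<open>2a - 2b > 2a' - 2b'\<close>; hence \<open>a \<le> a'\<close>. With
  \<open>R = a / a'\<close> the other factor is \<open>b = b' / R\<close>, and \<open>\<partial>\<partial>\<^sup>* log R\<close> is
  \<open>2 a' (R - 1) + 2 b' (1 - 1 / R)\<close>, of the form required by the strong maximum principle.
  Identical equality is impossible because \<open>a\<close> has a zero and \<open>a'\<close> has none.
\<close>

lemma toda2_less:
  assumes surface: "closed_riemann_surface A"
    and dens: "weight_density A 1 a" "weight_density A 1 b" "weight_density A 1 a'" "weight_density A 1 b'"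
    and pos: "\<And>c p. c \<in> A \<Longrightarrow> p \<in> cdom c \<Longrightarrow> 0 < a' c p"
    and da: "\<And>c p. c \<in> A \<Longrightarrow> p \<in> cdom c \<Longrightarrow> 0 < a c p \<Longrightarrow> log_ddbar c a p (2 * a c p - 2 * b c p)"
    and da': "\<And>c p. c \<in> A \<Longrightarrow> p \<in> cdom c \<Longrightarrow> log_ddbar c a' p (2 * a' c p - 2 * b' c p)"
    and prod: "\<And>c p. c \<in> A \<Longrightarrow> p \<in> cdom c \<Longrightarrow> a c p * b c p = a' c p * b' c p"
    and zero: "\<exists>c\<in>A. \<exists>p\<in>cdom c. a c p = 0"
    and cp: "c \<in> A" "p \<in> cdom c"
  shows "a c p < a' c p"
proof -
  have le: "a c p \<le> a' c p" if "c \<in> A" "p \<in> cdom c" for c p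
  proof (rule ratio_le[OF surface dens(1,3) pos _ that])
    fix c p assume cp: "c \<in> A" "p \<in> cdom c" and gt: "a' c p < a c p"
    note a' = pos[OF cp]
    have "a c p * b c p \<le> a c p * b' c p"
      unfolding prod[OF cp] using gt weight_density_nonneg[OF dens(4) cp] by (intro mult_right_mono) auto
    then have "b c p \<le> b' c p" using gt a' by simp
    then have "2 * a' c p - 2 * b' c p < 2 * a c p - 2 * b c p" using gt by simp
    then show "\<exists>l m. log_ddbar c a p l \<and> log_ddbar c a' p m \<and> m < l"
      using da[OF cp] da'[OF cp] gt a' by fastforce
  qed
  have B: "weight_density A 1 (\<lambda>c p. 2 * a' c p + 4 * b' c p)"
    using dens by (intro weight_density_add weight_density_scale) auto
  have "(\<forall>c\<in>A. \<forall>p\<in>cdom c. a c p < a' c p) \<or>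
      (\<forall>c\<in>A. \<forall>p\<in>cdom c. a c p = a' c p \<and> 2 * a c p - 2 * b c p = 2 * a' c p - 2 * b' c p)"
  proof (rule ratio_strong_maximum[OF surface dens(1) dens(3) B pos le da da', where \<theta> = "1 / 2"])
    fix c p assume cp: "c \<in> A" "p \<in> cdom c" and half: "1 / 2 * a' c p < a c p"
    note a' = pos[OF cp]
    define R where "R = a c p / a' c p"
    have R: "1 / 2 < R" "R \<le> 1" "a c p = R * a' c p"
      using half le[OF cp] a' by (auto simp: R_def field_simps)
    have "a' c p * b' c p = a' c p * (R * b c p)" using prod[OF cp] R(3) by (simp only: mult_ac)
    then have b: "b c p = b' c p * (1 / R)" using a' R(1) by (simp add: field_simps)
    have "b' c p * (2 * (R - 1)) \<le> b' c p * (1 - 1 / R)"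
      using one_minus_inverse_ge[OF R(1,2)] weight_density_nonneg[OF dens(4) cp] by (rule mult_left_mono)
    then show "(2 * a' c p + 4 * b' c p) * (a c p / a' c p - 1)
        \<le> 2 * a c p - 2 * b c p - (2 * a' c p - 2 * b' c p)"
      unfolding R_def[symmetric] unfolding b R(3) by (simp add: algebra_simps)
  qed auto
  then show ?thesis using zero pos cp by fastforce
qed

text \<open>
  Both \<open>a\<close> and \<open>b\<close> stay below \<open>a'\<close>, so the larger of them does, and the products agree.
\<close>

lemma toda2_sum_less:
  assumes surface: "closed_riemann_surface A"
    and dens: "weight_density A 1 a" "weight_density A 1 b" "weight_density A 1 a'" "weight_density A 1 b'"
    and pos: "\<And>c p. c \<in> A \<Longrightarrow> p \<in> cdom c \<Longrightarrow> 0 < a' c p"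
    and da: "\<And>c p. c \<in> A \<Longrightarrow> p \<in> cdom c \<Longrightarrow> 0 < a c p \<Longrightarrow> log_ddbar c a p (2 * a c p - 2 * b c p)"
    and db: "\<And>c p. c \<in> A \<Longrightarrow> p \<in> cdom c \<Longrightarrow> 0 < b c p \<Longrightarrow> log_ddbar c b p (2 * b c p - 2 * a c p)"
    and da': "\<And>c p. c \<in> A \<Longrightarrow> p \<in> cdom c \<Longrightarrow> log_ddbar c a' p (2 * a' c p - 2 * b' c p)"
    and prod: "\<And>c p. c \<in> A \<Longrightarrow> p \<in> cdom c \<Longrightarrow> a c p * b c p = a' c p * b' c p"
    and zero: "\<exists>c\<in>A. \<exists>p\<in>cdom c. a c p = 0" "\<exists>c\<in>A. \<exists>p\<in>cdom c. b c p = 0"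
    and cp: "c \<in> A" "p \<in> cdom c"
  shows "a c p + b c p < a' c p + b' c p"
proof -
  have prod': "b c p * a c p = a' c p * b' c p" if "c \<in> A" "p \<in> cdom c" for c p
    using prod[OF that] by (simp add: mult.commute)
  have a: "a c p < a' c p" by (rule toda2_less[OF surface dens pos da da' prod zero(1) cp])
  have b: "b c p < a' c p"
    by (rule toda2_less[OF surface dens(2,1,3,4) pos db da' prod' zero(2) cp])
  note nn = weight_density_nonneg[OF dens(1) cp] weight_density_nonneg[OF dens(2) cp]
    weight_density_nonneg[OF dens(3) cp] weight_density_nonneg[OF dens(4) cp]
  show ?thesis
  proof (cases "b c p \<le> a c p")
    case True
    then show ?thesis
      using sum4_less_of_partial_products[of 0 0 "b c p" "a c p" "a' c p" "b' c p" 0 0] a nn prod[OF cp]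
      by simp
  next
    case False
    then show ?thesis
      using sum4_less_of_partial_products[of 0 0 "a c p" "b c p" "a' c p" "b' c p" 0 0] b nn prod'[OF cp]
      by simp
  qed
qed

section \<open>Comparison of Toda systems of rank three\<close>

text \<open>
  The cyclic Toda system away from the zeros of the functions \<open>f i\<close>.
\<close>

definition toda_solution :: "'a::topological_space chart set \<Rightarrow> nat \<Rightarrow> (nat \<Rightarrow> 'a chart \<Rightarrow> 'a \<Rightarrow> real) \<Rightarrow> bool" where
  "toda_solution A n f \<longleftrightarrow>
     (\<forall>i<n. weight_density A 1 (f i)) \<and>
     (\<forall>i<n. \<forall>c\<in>A. \<forall>p\<in>cdom c. 0 < f i c p \<longrightarrow>
        log_ddbar c (f i) p (2 * f i c p - f ((i + n - 1) mod n) c p - f (Suc i mod n) c p))"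

lemma toda_solution_density: "toda_solution A n f \<Longrightarrow> i < n \<Longrightarrow> weight_density A 1 (f i)"
  by (simp add: toda_solution_def)

lemma toda_solution_ddbar:
  assumes "toda_solution A n f" "i < n" "c \<in> A" "p \<in> cdom c" "0 < f i c p"
  shows "log_ddbar c (f i) p (2 * f i c p - f ((i + n - 1) mod n) c p - f (Suc i mod n) c p)"
  using assms unfolding toda_solution_def by blast

text \<open>
  Where \<open>f > g\<close> the difference of the two equations is positive, so \<open>ratio_le\<close> applies. Used in both
  directions, this gives the symmetry of the Hitchin solution.
\<close>

lemma le_of_log_ddbar_difference:
  assumes surface: "closed_riemann_surface A"
    and dens: "weight_density A 1 f" "weight_density A 1 g"
    and pos: "\<And>c p. c \<in> A \<Longrightarrow> p \<in> cdom c \<Longrightarrow> 0 < g c p"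
    and df: "\<And>c p. c \<in> A \<Longrightarrow> p \<in> cdom c \<Longrightarrow> log_ddbar c f p (lf c p)"
    and dg: "\<And>c p. c \<in> A \<Longrightarrow> p \<in> cdom c \<Longrightarrow> log_ddbar c g p (lg c p)"
    and diff: "\<And>c p. c \<in> A \<Longrightarrow> p \<in> cdom c \<Longrightarrow> lf c p - lg c p = k * (f c p - g c p)" and k: "0 < k"
    and cp: "c \<in> A" "p \<in> cdom c"
  shows "f c p \<le> g c p"
proof (rule ratio_le[OF surface dens pos _ cp])
  fix c p assume cp: "c \<in> A" "p \<in> cdom c" and gt: "g c p < f c p"
  then have "lg c p < lf c p" using diff[OF cp] k by (smt (verit) mult_pos_pos)
  then show "\<exists>l m. log_ddbar c f p l \<and> log_ddbar c g p m \<and> m < l"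
    using df[OF cp] dg[OF cp] by blast
qed

text \<open>
  The bounds \<open>u, v, w \<le> s\<close> dominate every product of one or two of these numbers, whatever their order.
\<close>

lemma sum3_less:
  fixes u v w s t :: real
  assumes le: "u \<le> s" "v \<le> s" "w \<le> s" and nn: "0 \<le> u" "0 \<le> v" "0 \<le> w" "0 \<le> s" "0 \<le> t"
    and prod: "u * v * w = s * s * t" and neq: "u < s" "v < s"
  shows "u + v + w < s + s + t"
proof -
  have *: "x + y + z < s + s + t"
    if "y \<le> x" "z \<le> y" "0 \<le> z" "x \<le> s" "y \<le> s" "x * y * z = s * s * t" "x \<noteq> s \<or> y \<noteq> s" for x y z
    using that nn sum4_less_of_partial_products[of 0 z y x s s t 0] mult_mono[of x s y s] by simp
  have p: "v * u * w = s * s * t" "u * w * v = s * s * t" "v * w * u = s * s * t"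
    "w * u * v = s * s * t" "w * v * u = s * s * t" using prod by (simp_all add: mult_ac)
  consider "u \<ge> v" "v \<ge> w" | "u \<ge> w" "w \<ge> v" | "v \<ge> u" "u \<ge> w" | "v \<ge> w" "w \<ge> u"
    | "w \<ge> u" "u \<ge> v" | "w \<ge> v" "v \<ge> u" by linarith
  then show ?thesis
  proof cases
    case 1 then show ?thesis using *[of v u w] le nn prod neq by auto
  next
    case 2 then show ?thesis using *[of w u v] le nn p neq by auto
  next
    case 3 then show ?thesis using *[of u v w] le nn p neq by auto
  next
    case 4 then show ?thesis using *[of w v u] le nn p neq by auto
  next
    case 5 then show ?thesis using *[of u w v] le nn p neq by auto
  next
    case 6 then show ?thesis using *[of v w u] le nn p neq by auto
  qed
qed

text \<open>
  The two components without zeros coincide, so write \<open>s = g\<^sub>0 = g\<^sub>1\<close> and \<open>t = g\<^sub>2\<close>. Each \<open>f\<^sub>i\<close> is at most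
  \<open>s\<close>: let \<open>N\<close> be the largest of the maxima of the three quotients \<open>f\<^sub>i / s\<close>, attained by
  \<open>u = f\<^sub>i = N s\<close>. The two other values \<open>v\<close> and \<open>w\<close> are at most \<open>N s\<close> and their product is \<open>s t / N\<close>, so
  \<open>(N s - v) (N s - w) \<ge> 0\<close> bounds \<open>v + w\<close> by \<open>N s + t / N\<^sup>2\<close>, and for \<open>N > 1\<close> this
  contradicts \<open>2u - v - w \<le> s - t\<close>. The same estimate with \<open>N\<close> replaced by a quotient \<open>R \<le> 1\<close> feeds
  the strong maximum principle for the two components that have zeros.
\<close>

lemma toda3_sum_less:
  assumes surface: "closed_riemann_surface A"
    and f: "toda_solution A 3 f" and g: "toda_solution A 3 g"
    and pos0: "\<And>c p. c \<in> A \<Longrightarrow> p \<in> cdom c \<Longrightarrow> 0 < g 0 c p"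
    and pos1: "\<And>c p. c \<in> A \<Longrightarrow> p \<in> cdom c \<Longrightarrow> 0 < g 1 c p"
    and prod: "\<And>c p. c \<in> A \<Longrightarrow> p \<in> cdom c \<Longrightarrow>
      f 0 c p * f 1 c p * f 2 c p = g 0 c p * g 1 c p * g 2 c p"
    and zero: "\<exists>c\<in>A. \<exists>p\<in>cdom c. f 0 c p = 0" "\<exists>c\<in>A. \<exists>p\<in>cdom c. f 1 c p = 0"
    and cp: "c \<in> A" "p \<in> cdom c"
  shows "f 0 c p + f 1 c p + f 2 c p < g 0 c p + g 1 c p + g 2 c p"
proof -
  note df = toda_solution_ddbar[OF f] and dg = toda_solution_ddbar[OF g]
  have fd: "weight_density A 1 (f i)" and gd: "weight_density A 1 (g i)" if "i < 3" for i
    by (rule toda_solution_density[OF f that] toda_solution_density[OF g that])+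
  have g0: "log_ddbar c (g 0) p (2 * g 0 c p - g 2 c p - g 1 c p)"
    and g1: "log_ddbar c (g 1) p (2 * g 1 c p - g 0 c p - g 2 c p)"
    if "c \<in> A" "p \<in> cdom c" for c p
    using dg[OF _ that, of 0] dg[OF _ that, of 1] pos0[OF that] pos1[OF that]
    by (simp_all add: numeral_2_eq_2)
  have "g 0 c p \<le> g 1 c p" if "c \<in> A" "p \<in> cdom c" for c p
    by (rule le_of_log_ddbar_difference[OF surface gd gd pos1 g0 g1 _ _ that, where k = 3]) auto
  moreover have "g 1 c p \<le> g 0 c p" if "c \<in> A" "p \<in> cdom c" for c p
    by (rule le_of_log_ddbar_difference[OF surface gd gd pos0 g1 g0 _ _ that, where k = 3]) auto
  ultimately have g_eq: "g 1 c p = g 0 c p" if "c \<in> A" "p \<in> cdom c" for c p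
    using that by (simp add: order_antisym)
  have dg0: "log_ddbar c (g 0) p (g 0 c p - g 2 c p)" if "c \<in> A" "p \<in> cdom c" for c p
    using g0[OF that] g_eq[OF that] by simp
  have prod3: "f i c p * (f ((i + 3 - 1) mod 3) c p * f (Suc i mod 3) c p) = g 0 c p * (g 0 c p * g 2 c p)"
    if i: "i < 3" and cp: "c \<in> A" "p \<in> cdom c" for i c p
  proof -
    have "i = 0 \<or> i = 1 \<or> i = 2" using i by auto
    then show ?thesis using prod[OF cp] g_eq[OF cp] by (auto simp: numeral_2_eq_2 mult_ac)
  qed
  have f_nn: "0 \<le> f i c p" if "i < 3" "c \<in> A" "p \<in> cdom c" for i c p
    using weight_density_nonneg[OF fd] that by blast
  have g2_nn: "0 \<le> g 2 c p" if "c \<in> A" "p \<in> cdom c" for c p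
    using weight_density_nonneg[OF gd that, of 2] by simp
  define J where "J = (\<lambda>i::nat. (i + 3 - 1) mod 3)"
  define K where "K = (\<lambda>i::nat. Suc i mod 3)"
  have JK: "J i < 3" "K i < 3" for i by (auto simp: J_def K_def)
  have f_le: "f i c p \<le> g 0 c p" if i: "i < 3" and cp: "c \<in> A" "p \<in> cdom c" for i c p
  proof -
    have "\<exists>M d x. d \<in> A \<and> x \<in> cdom d \<and> f i d x = M * g 0 d x \<and>
      (\<forall>d\<in>A. \<forall>x\<in>cdom d. f i d x \<le> M * g 0 d x) \<and>
      (\<forall>l m. log_ddbar d (f i) x l \<longrightarrow> log_ddbar d (g 0) x m \<longrightarrow> l \<le> m)" if "i < 3" for i
      using ratio_maximum_point[OF surface fd[OF that] gd[of 0] pos0] by (metis zero_less_numeral)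
    then obtain M d x where M: "\<And>i. i < 3 \<Longrightarrow> d i \<in> A \<and> x i \<in> cdom (d i) \<and> f i (d i) (x i) = M i * g 0 (d i) (x i) \<and>
      (\<forall>d\<in>A. \<forall>x\<in>cdom d. f i d x \<le> M i * g 0 d x) \<and>
      (\<forall>l m. log_ddbar (d i) (f i) (x i) l \<longrightarrow> log_ddbar (d i) (g 0) (x i) m \<longrightarrow> l \<le> m)"
      by metis
    \<comment> \<open>Only at the largest of the three maxima are the two neighbours controlled.\<close>
    have "\<exists>i<3. \<forall>j<3. M j \<le> M i"
    proof -
      have "M 0 \<in> M ` {..<3}" by simp
      then have "Max (M ` {..<3}) \<in> M ` {..<3}" by (intro Max_in) blast+
      then obtain i where "i < 3" "M i = Max (M ` {..<3})" by auto
      then show ?thesis by (intro exI[of _ i]) auto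
    qed
    then obtain m where m: "m < 3" "\<And>j. j < 3 \<Longrightarrow> M j \<le> M m" by blast
    let ?d = "d m" and ?x = "x m"
    have dx: "?d \<in> A" "?x \<in> cdom ?d" using M[OF m(1)] by auto
    note s = pos0[OF dx]
    have "M m \<le> 1"
    proof (rule ccontr)
      assume "\<not> M m \<le> 1"
      define N u v w s t where "N = M m" and "u = f m ?d ?x" and "v = f (J m) ?d ?x"
        and "w = f (K m) ?d ?x" and "s = g 0 ?d ?x" and "t = g 2 ?d ?x"
      have N: "1 < N" using \<open>\<not> M m \<le> 1\<close> by (simp add: N_def)
      have s: "0 < s" using pos0[OF dx] by (simp add: s_def)
      have t: "0 \<le> t" using g2_nn[OF dx] by (simp add: t_def)
      have u: "u = N * s" using M[OF m(1)] by (simp add: u_def N_def s_def)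
      have le: "f j ?d ?x \<le> N * s" if "j < 3" for j
      proof -
        have "f j ?d ?x \<le> M j * s" using M[OF that] dx by (simp add: s_def)
        also have "\<dots> \<le> N * s" using m(2)[OF that] s by (simp add: N_def)
        finally show ?thesis .
      qed
      have v: "v \<le> N * s" "w \<le> N * s" using le JK by (auto simp: v_def w_def)
      have "s * (N * (v * w)) = s * (s * t)"
        using prod3[OF m(1) dx] u by (simp add: u_def v_def w_def s_def t_def J_def K_def mult_ac)
      then have vw: "N * (v * w) = s * t" using s by simp
      have "2 * u - v - w \<le> s - t"
        using M[OF m(1)] df[OF m(1) dx] dg0[OF dx] u N s
        by (auto simp: u_def v_def w_def s_def t_def J_def K_def)
      then have "N\<^sup>2 * (2 * (N * s) - s + t) \<le> N\<^sup>2 * (v + w)"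
        using u by (intro mult_left_mono) auto
      moreover have "0 \<le> (N * s - v) * (N * s - w)" using v by simp
      then have "0 \<le> N * ((N * s - v) * (N * s - w))" using N by simp
      then have "N\<^sup>2 * s * (v + w) \<le> N * (N * s)\<^sup>2 + N * (v * w)"
        by (simp add: algebra_simps power2_eq_square)
      then have "s * (N\<^sup>2 * (v + w)) \<le> s * (N ^ 3 * s + t)"
        unfolding vw by (simp add: algebra_simps power2_eq_square power3_eq_cube)
      then have "N\<^sup>2 * (v + w) \<le> N ^ 3 * s + t" using s by simp
      ultimately have "N\<^sup>2 * (2 * (N * s) - s + t) \<le> N ^ 3 * s + t" by linarith
      then have "N\<^sup>2 * s * (N - 1) + (N\<^sup>2 - 1) * t \<le> 0"
        by (simp add: algebra_simps power2_eq_square power3_eq_cube)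
      moreover have "0 < N\<^sup>2 * s * (N - 1)" using N s by simp
      moreover have "1 \<le> N\<^sup>2" using N by (simp add: one_le_power)
      then have "0 \<le> (N\<^sup>2 - 1) * t" using t by simp
      ultimately show False by linarith
    qed
    then have "M i \<le> 1" using m(2)[OF i] by simp
    then have "M i * g 0 c p \<le> g 0 c p" using pos0[OF cp] by simp
    moreover have "f i c p \<le> M i * g 0 c p" using M[OF i] cp by blast
    ultimately show ?thesis by linarith
  qed
  have strict: "f i c p < g 0 c p" if i: "i < 3" and z: "\<exists>c\<in>A. \<exists>p\<in>cdom c. f i c p = 0"
    and cp: "c \<in> A" "p \<in> cdom c" for i c p
  proof -
    have B: "weight_density A 1 (\<lambda>c p. 2 * g 0 c p + 2 * g 2 c p)"
      by (intro weight_density_add weight_density_scale gd) auto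
    have "(\<forall>c\<in>A. \<forall>p\<in>cdom c. f i c p < g 0 c p) \<or>
      (\<forall>c\<in>A. \<forall>p\<in>cdom c. f i c p = g 0 c p \<and>
         2 * f i c p - f ((i + 3 - 1) mod 3) c p - f (Suc i mod 3) c p = g 0 c p - g 2 c p)"
    proof (rule ratio_strong_maximum[OF surface fd[OF i] gd B pos0 f_le[OF i] df[OF i] dg0, where \<theta> = "1 / 2"])
      fix c p assume cp: "c \<in> A" "p \<in> cdom c" and half: "1 / 2 * g 0 c p < f i c p"
      define R v w s t where "R = f i c p / g 0 c p" and "v = f (J i) c p"
        and "w = f (K i) c p" and "s = g 0 c p" and "t = g 2 c p"
      have s: "0 < s" using pos0[OF cp] by (simp add: s_def)
      have t: "0 \<le> t" using g2_nn[OF cp] by (simp add: t_def)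
      have R: "1 / 2 < R" "R \<le> 1" "f i c p = R * s"
        using half f_le[OF i cp] s by (auto simp: R_def s_def field_simps)
      have v: "v \<le> s" "w \<le> s" using f_le[OF _ cp] JK by (auto simp: v_def w_def s_def)
      have "s * (R * (v * w)) = s * (s * t)"
        using prod3[OF i cp] R by (simp add: v_def w_def s_def t_def J_def K_def mult_ac)
      then have vw: "v * w = s * (t * (1 / R))" using s R(1) by (simp add: field_simps)
      have "0 \<le> (s - v) * (s - w)" using v by simp
      then have "s * (v + w) \<le> s * (s + t * (1 / R))" using vw by (simp add: algebra_simps)
      then have "v + w \<le> s + t * (1 / R)" using s by simp
      moreover have "t * (2 * (R - 1)) \<le> t * (1 - 1 / R)"
        using one_minus_inverse_ge[OF R(1,2)] t by (rule mult_left_mono)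
      ultimately have "(2 * s + 2 * t) * (R - 1) \<le> 2 * (R * s) - v - w - (s - t)"
        by (simp add: algebra_simps)
      then show "(2 * g 0 c p + 2 * g 2 c p) * (f i c p / g 0 c p - 1) \<le>
          2 * f i c p - f ((i + 3 - 1) mod 3) c p - f (Suc i mod 3) c p - (g 0 c p - g 2 c p)"
        unfolding R_def[symmetric] unfolding R(3) by (simp only: v_def w_def s_def t_def J_def K_def)
    qed auto
    then show ?thesis
    proof
      assume eq: "\<forall>c\<in>A. \<forall>p\<in>cdom c. f i c p = g 0 c p \<and>
         2 * f i c p - f ((i + 3 - 1) mod 3) c p - f (Suc i mod 3) c p = g 0 c p - g 2 c p"
      obtain d x where x: "d \<in> A" "x \<in> cdom d" "f i d x = 0" using z by blast
      have "f i d x = g 0 d x" using eq x(1,2) by blast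
      then show ?thesis using x(3) pos0[OF x(1,2)] by simp
    qed (use cp in blast)
  qed
  have "f 0 c p + f 1 c p + f 2 c p < g 0 c p + g 0 c p + g 2 c p"
  proof (rule sum3_less)
    show "f 0 c p < g 0 c p" "f 1 c p < g 0 c p"
      using strict[OF _ zero(1) cp] strict[OF _ zero(2) cp] by simp_all
    then show "f 0 c p \<le> g 0 c p" "f 1 c p \<le> g 0 c p" "0 \<le> g 0 c p" using pos0[OF cp] by simp_all
    show "f 2 c p \<le> g 0 c p" by (rule f_le[OF _ cp]) simp
    show "f 0 c p * f 1 c p * f 2 c p = g 0 c p * g 0 c p * g 2 c p"
      using prod[OF cp] g_eq[OF cp] by simp
    show "0 \<le> f 0 c p" "0 \<le> f 1 c p" "0 \<le> f 2 c p" by (rule f_nn[OF _ cp], simp)+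
  qed (rule g2_nn[OF cp])
  then show ?thesis using g_eq[OF cp] by simp
qed

section \<open>Comparison of symmetric Toda systems of rank four\<close>

text \<open>
  The cyclic Toda system for \<open>(a, m, a, b)\<close>, whose first and third unknowns coincide. It is invariant under
  exchanging \<open>m\<close> and \<open>b\<close>, which is a rotation of the cycle by two.
\<close>

definition symmetric_toda4 ::
    "'a::topological_space chart set \<Rightarrow> ('a chart \<Rightarrow> 'a \<Rightarrow> real) \<Rightarrow> ('a chart \<Rightarrow> 'a \<Rightarrow> real) \<Rightarrow>
     ('a chart \<Rightarrow> 'a \<Rightarrow> real) \<Rightarrow> bool" where
  "symmetric_toda4 A a m b \<longleftrightarrow>
     weight_density A 1 a \<and> weight_density A 1 m \<and> weight_density A 1 b \<and>
     (\<forall>c\<in>A. \<forall>p\<in>cdom c.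
        (0 < a c p \<longrightarrow> log_ddbar c a p (2 * a c p - m c p - b c p)) \<and>
        (0 < m c p \<longrightarrow> log_ddbar c m p (2 * m c p - 2 * a c p)) \<and>
        (0 < b c p \<longrightarrow> log_ddbar c b p (2 * b c p - 2 * a c p)))"

lemma symmetric_toda4_swap: "symmetric_toda4 A a m b \<Longrightarrow> symmetric_toda4 A a b m"
  unfolding symmetric_toda4_def by (simp add: algebra_simps)

lemma symmetric_toda4D:
  assumes "symmetric_toda4 A a m b"
  shows "weight_density A 1 a" "weight_density A 1 m" "weight_density A 1 b"
    and "\<And>c p. c \<in> A \<Longrightarrow> p \<in> cdom c \<Longrightarrow> 0 < a c p \<Longrightarrow> log_ddbar c a p (2 * a c p - m c p - b c p)"
    and "\<And>c p. c \<in> A \<Longrightarrow> p \<in> cdom c \<Longrightarrow> 0 < m c p \<Longrightarrow> log_ddbar c m p (2 * m c p - 2 * a c p)"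
    and "\<And>c p. c \<in> A \<Longrightarrow> p \<in> cdom c \<Longrightarrow> 0 < b c p \<Longrightarrow> log_ddbar c b p (2 * b c p - 2 * a c p)"
    and "\<And>c p. c \<in> A \<Longrightarrow> p \<in> cdom c \<Longrightarrow> 0 \<le> a c p"
    and "\<And>c p. c \<in> A \<Longrightarrow> p \<in> cdom c \<Longrightarrow> 0 \<le> m c p"
    and "\<And>c p. c \<in> A \<Longrightarrow> p \<in> cdom c \<Longrightarrow> 0 \<le> b c p"
  using assms unfolding symmetric_toda4_def by (blast intro: weight_density_nonneg)+

text \<open>
  For the Hitchin solution \<open>a\<close> and \<open>m\<close> have no zeros. First \<open>b \<le> m\<close>, as these two have equal neighbours;
  the maximum principle for \<open>a / m\<close> and \<open>b / a\<close> then sorts the three. The last bound comes from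
  \<open>\<partial>\<partial>\<^sup>* log (m / a) = 3m - 4a + b\<close>. In the Fuchsian case \<open>b = 0\<close> it is an equality.
\<close>

lemma toda4_order:
  fixes A :: "'a::t2_space chart set"
  assumes surface: "closed_riemann_surface A"
    and toda: "symmetric_toda4 A a m b"
    and pos: "\<And>c p. c \<in> A \<Longrightarrow> p \<in> cdom c \<Longrightarrow> 0 < a c p" "\<And>c p. c \<in> A \<Longrightarrow> p \<in> cdom c \<Longrightarrow> 0 < m c p"
    and cp: "c \<in> A" "p \<in> cdom c"
  shows "b c p \<le> a c p" and "a c p \<le> m c p" and "3 * m c p \<le> 4 * a c p"
proof -
  note t = symmetric_toda4D[OF toda]
  have bm: "b c p \<le> m c p" if "c \<in> A" "p \<in> cdom c" for c p
  proof (rule ratio_le[OF surface t(3,2) pos(2) _ that])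
    fix c p assume cp: "c \<in> A" "p \<in> cdom c" and gt: "m c p < b c p"
    then have "0 < b c p" using pos(2)[OF cp] by linarith
    then show "\<exists>k l. log_ddbar c b p k \<and> log_ddbar c m p l \<and> l < k"
      using t(5)[OF cp pos(2)[OF cp]] t(6)[OF cp] gt by fastforce
  qed
  show "a c p \<le> m c p"
  proof (rule ratio_le[OF surface t(1,2) pos(2) _ cp])
    fix c p assume cp: "c \<in> A" "p \<in> cdom c" and gt: "m c p < a c p"
    then have "2 * m c p - 2 * a c p < 2 * a c p - m c p - b c p" using bm[OF cp] by linarith
    then show "\<exists>k l. log_ddbar c a p k \<and> log_ddbar c m p l \<and> l < k"
      using t(4)[OF cp pos(1)[OF cp]] t(5)[OF cp pos(2)[OF cp]] by blast
  qed
  show "b c p \<le> a c p"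
  proof (rule ratio_le[OF surface t(3,1) pos(1) _ cp])
    fix c p assume cp: "c \<in> A" "p \<in> cdom c" and gt: "a c p < b c p"
    then have "2 * a c p - m c p - b c p < 2 * b c p - 2 * a c p" using bm[OF cp] by linarith
    moreover have "0 < b c p" using gt pos(1)[OF cp] by linarith
    ultimately show "\<exists>k l. log_ddbar c b p k \<and> log_ddbar c a p l \<and> l < k"
      using t(4)[OF cp pos(1)[OF cp]] t(6)[OF cp] by blast
  qed
  define F where "F = (\<lambda>c p. 3 * m c p)"
  define G where "G = (\<lambda>c p. 4 * a c p)"
  have "F c p \<le> G c p"
  proof (rule ratio_le[OF surface _ _ _ _ cp])
    show "weight_density A 1 F" "weight_density A 1 G"
      unfolding F_def G_def by (rule weight_density_scale[OF t(2)] weight_density_scale[OF t(1)], simp)+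
    show "0 < G c p" if "c \<in> A" "p \<in> cdom c" for c p using pos(1)[OF that] by (simp add: G_def)
    fix c p assume cp: "c \<in> A" "p \<in> cdom c" and gt: "G c p < F c p"
    then have "2 * a c p - m c p - b c p < 2 * m c p - 2 * a c p"
      using t(9)[OF cp] unfolding F_def G_def by linarith
    moreover have "log_ddbar c F p (2 * m c p - 2 * a c p)" "log_ddbar c G p (2 * a c p - m c p - b c p)"
      unfolding F_def G_def using t(4)[OF cp pos(1)[OF cp]] t(5)[OF cp pos(2)[OF cp]]
      by (auto intro: log_ddbar_scale)
    ultimately show "\<exists>k l. log_ddbar c F p k \<and> log_ddbar c G p l \<and> l < k" by blast
  qed
  then show "3 * m c p \<le> 4 * a c p" by (simp add: F_def G_def)
qed

text \<open>
  After sorting \<open>a, a, m, b\<close> in decreasing order, the products of the first one, two and three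
  entries are dominated by those of \<open>m', a', a', b'\<close>. The triple \<open>a m b\<close> is bounded through
  \<open>(a m b)\<^sup>2 = (a'\<^sup>2 m' b') (m b)\<close>.
\<close>

lemma toda4_inequality:
  fixes a m b a' m' b' :: real
  assumes nn: "0 \<le> a" "0 \<le> m" "0 \<le> b" "0 < a'" "0 < m'" "0 \<le> b'" and ord: "b' \<le> a'"
    and lt: "a < m'" "m < m'" "b < m'"
    and pairs: "a * m \<le> a' * m'" "a * b \<le> a' * m'" "a\<^sup>2 \<le> m' * a'" "m * b \<le> m' * a'"
    and triples: "a\<^sup>2 * m \<le> a'\<^sup>2 * m'" "a\<^sup>2 * b \<le> a'\<^sup>2 * m'"
    and prod: "a\<^sup>2 * m * b = a'\<^sup>2 * m' * b'"
  shows "2 * a + m + b < 2 * a' + m' + b'"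
proof -
  have triple: "a * m * b \<le> m' * a'\<^sup>2"
  proof (rule power2_le_imp_le)
    have "(a * m * b)\<^sup>2 = (a'\<^sup>2 * m' * b') * (m * b)"
      unfolding prod[symmetric] by (simp add: power2_eq_square mult_ac)
    also have "\<dots> \<le> (a'\<^sup>2 * m' * a') * (m' * a')"
    proof (rule mult_mono[OF _ pairs(4)])
      show "a'\<^sup>2 * m' * b' \<le> a'\<^sup>2 * m' * a'" using nn ord by (intro mult_left_mono) auto
    qed (use nn in auto)
    finally show "(a * m * b)\<^sup>2 \<le> (m' * a'\<^sup>2)\<^sup>2" by (simp add: power2_eq_square mult_ac)
  qed (use nn in simp)
  have *: "x + y + z + w < m' + a' + a' + b'"
    if "y \<le> x" "z \<le> y" "w \<le> z" "0 \<le> w" "x < m'" "x * y \<le> m' * a'" "x * y * z \<le> m' * a'\<^sup>2"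
      "x * y * z * w = a'\<^sup>2 * m' * b'" for x y z w
    using that nn sum4_less_of_partial_products[of w z y x m' a' a' b']
    by (simp add: power2_eq_square mult_ac)
  note facts = nn lt pairs triples triple prod
  consider "m \<le> a" "b \<le> m" | "b \<le> a" "m \<le> b" | "a \<le> m" "b \<le> a" | "a \<le> b" "m \<le> a"
    | "b \<le> m" "a \<le> b" | "m \<le> b" "a \<le> m" by linarith
  then have "a + a + m + b < m' + a' + a' + b'"
  proof cases
    case 1 show ?thesis using *[of a a m b] 1 facts by (simp add: power2_eq_square mult_ac)
  next
    case 2 show ?thesis using *[of a a b m] 2 facts by (simp add: power2_eq_square mult_ac)
  next
    case 3 show ?thesis using *[of a m a b] 3 facts by (simp add: power2_eq_square mult_ac)
  next
    case 4 show ?thesis using *[of a b a m] 4 facts by (simp add: power2_eq_square mult_ac)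
  next
    case 5 show ?thesis using *[of b m a a] 5 facts by (simp add: power2_eq_square mult_ac)
  next
    case 6 show ?thesis using *[of m b a a] 6 facts by (simp add: power2_eq_square mult_ac)
  qed
  then show ?thesis by simp
qed

text \<open>
  A symmetric solution \<open>(a, m, b)\<close> and the Hitchin solution \<open>(a', m', b')\<close> with the same total product.
\<close>

locale toda4_comparison =
  fixes A :: "'a::t2_space chart set" and a m b a' m' b' :: "'a chart \<Rightarrow> 'a \<Rightarrow> real"
  assumes surface: "closed_riemann_surface A"
    and toda: "symmetric_toda4 A a m b" and toda': "symmetric_toda4 A a' m' b'"
    and pos: "\<And>c p. c \<in> A \<Longrightarrow> p \<in> cdom c \<Longrightarrow> 0 < a' c p" "\<And>c p. c \<in> A \<Longrightarrow> p \<in> cdom c \<Longrightarrow> 0 < m' c p"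
    and prod: "\<And>c p. c \<in> A \<Longrightarrow> p \<in> cdom c \<Longrightarrow>
      (a c p)\<^sup>2 * m c p * b c p = (a' c p)\<^sup>2 * m' c p * b' c p"
begin

lemmas t = symmetric_toda4D[OF toda]
lemmas t' = symmetric_toda4D[OF toda']

lemma order:
  assumes cp: "c \<in> A" "p \<in> cdom c"
  shows "b' c p \<le> a' c p" "a' c p \<le> m' c p" "3 * m' c p \<le> 4 * a' c p"
proof -
  show "b' c p \<le> a' c p" by (rule toda4_order(1)[OF surface toda' pos cp])
  show "a' c p \<le> m' c p" by (rule toda4_order(2)[OF surface toda' pos cp])
  show "3 * m' c p \<le> 4 * a' c p" by (rule toda4_order(3)[OF surface toda' pos cp])
qed

lemma swap: "toda4_comparison A a b m a' m' b'"
  by (rule toda4_comparison.intro[OF surface symmetric_toda4_swap[OF toda] toda' pos])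
    (use prod in \<open>simp_all add: mult_ac\<close>)

text \<open>
  Let \<open>M\<close> and \<open>N\<close> be the maxima of \<open>m / m'\<close> and of \<open>a\<^sup>2 m / (a'\<^sup>2 m')\<close>. The second quotient is \<open>b' / b\<close> where
  \<open>b\<close> does not vanish, and \<open>\<partial>\<partial>\<^sup>* log (a\<^sup>2 m) = 2a - 2b\<close>. If \<open>M > 1\<close> then \<open>a > a'\<close> at the first maximum, whence
  \<open>N > M\<close>. If \<open>N > 1\<close> then \<open>b \<le> b'\<close> and so \<open>a \<le> a'\<close> at the second maximum, whence \<open>M \<ge> N\<close>. These are
  incompatible unless both maxima are at most 1.
\<close>

lemma le:
  assumes cp: "c \<in> A" "p \<in> cdom c"
  shows "m c p \<le> m' c p" and "(a c p)\<^sup>2 * m c p \<le> (a' c p)\<^sup>2 * m' c p"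
proof -
  define F G where "F = (\<lambda>c p. (a c p)\<^sup>2 * m c p)" and "G = (\<lambda>c p. (a' c p)\<^sup>2 * m' c p)"
  have dens: "weight_density A (2 * 1 + 1) F" "weight_density A (2 * 1 + 1) G"
    unfolding F_def G_def by (intro weight_density_mult weight_density_square t t')+
  have G_pos: "0 < G c p" if "c \<in> A" "p \<in> cdom c" for c p
    using pos(1)[OF that] pos(2)[OF that] by (simp add: G_def)
  \<comment> \<open>The terms in \<open>m\<close> cancel.\<close>
  have dF: "log_ddbar c F p (2 * a c p - 2 * b c p)" if "c \<in> A" "p \<in> cdom c" "0 < a c p" "0 < m c p" for c p
    using log_ddbar_mult[OF log_ddbar_square[OF t(4)] t(5), OF that(1,2,3,1,2,4)] by (simp add: F_def)
  have dG: "log_ddbar c G p (2 * a' c p - 2 * b' c p)" if "c \<in> A" "p \<in> cdom c" for c p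
    using log_ddbar_mult[OF log_ddbar_square[OF t'(4)] t'(5), OF that pos(1)[OF that] that pos(2)[OF that]]
    by (simp add: G_def)
  obtain M d x where x: "d \<in> A" "x \<in> cdom d" "m d x = M * m' d x"
    and le: "\<And>d x. d \<in> A \<Longrightarrow> x \<in> cdom d \<Longrightarrow> m d x \<le> M * m' d x"
    and max: "\<And>k l. log_ddbar d m x k \<Longrightarrow> log_ddbar d m' x l \<Longrightarrow> k \<le> l"
    using ratio_maximum_point[OF surface t(2) t'(2) pos(2)] by metis
  obtain N e y where y: "e \<in> A" "y \<in> cdom e" "F e y = N * G e y"
    and le_FG: "\<And>d x. d \<in> A \<Longrightarrow> x \<in> cdom d \<Longrightarrow> F d x \<le> N * G d x"
    and max_FG: "\<And>k l. log_ddbar e F y k \<Longrightarrow> log_ddbar e G y l \<Longrightarrow> k \<le> l"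
    using ratio_maximum_point[OF surface dens G_pos] by metis
  have MN: "M < N" if "1 < M"
  proof -
    note a' = pos(1)[OF x(1,2)] and m' = pos(2)[OF x(1,2)]
    have gt: "m' d x < m d x" using that x(3) m' by simp
    then have "2 * m d x - 2 * a d x \<le> 2 * m' d x - 2 * a' d x"
      using max[OF t(5) t'(5)] x(1,2) m' by fastforce
    then have "a' d x < a d x" using gt by simp
    then have "(a' d x)\<^sup>2 < (a d x)\<^sup>2" using a' by (intro power_strict_mono) auto
    then have "(a' d x)\<^sup>2 * m d x < (a d x)\<^sup>2 * m d x" using gt m' by (intro mult_strict_right_mono) auto
    also have "\<dots> \<le> N * ((a' d x)\<^sup>2 * m' d x)" using le_FG[OF x(1,2)] by (simp add: F_def G_def)
    finally have "((a' d x)\<^sup>2 * m' d x) * M < ((a' d x)\<^sup>2 * m' d x) * N" using x(3) by (simp add: mult_ac)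
    then show ?thesis using a' m' by simp
  qed
  have NM: "N \<le> M" if "1 < N"
  proof -
    note a' = pos(1)[OF y(1,2)] and m' = pos(2)[OF y(1,2)]
    have G: "0 < G e y" by (rule G_pos[OF y(1,2)])
    have "0 < F e y" using y(3) G that by simp
    then have a: "0 < a e y" and m: "0 < m e y"
      using t(7)[OF y(1,2)] t(8)[OF y(1,2)] by (auto simp: F_def less_le)
    have "G e y * (N * b e y) = G e y * b' e y"
      using prod[OF y(1,2)] y(3) by (simp add: F_def G_def mult_ac)
    then have "N * b e y = b' e y" using G by simp
    then have "b e y \<le> b' e y" using that t(9)[OF y(1,2)] mult_right_mono[of 1 N "b e y"] by simp
    moreover have "2 * a e y - 2 * b e y \<le> 2 * a' e y - 2 * b' e y"
      by (rule max_FG[OF dF[OF y(1,2) a m] dG[OF y(1,2)]])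
    ultimately have "a e y \<le> a' e y" by simp
    then have "(a e y)\<^sup>2 * m e y \<le> (a' e y)\<^sup>2 * m e y" using a m by (intro mult_right_mono power_mono) auto
    then have "(a' e y)\<^sup>2 * (N * m' e y) \<le> (a' e y)\<^sup>2 * m e y" using y(3) by (simp add: F_def G_def mult_ac)
    then have "N * m' e y \<le> m e y" using a' by simp
    also have "\<dots> \<le> M * m' e y" by (rule le[OF y(1,2)])
    finally show ?thesis using m' by simp
  qed
  have "M \<le> 1" "N \<le> 1" using MN NM by linarith+
  then have "M * m' c p \<le> m' c p" "N * G c p \<le> G c p" using pos(2)[OF cp] G_pos[OF cp] by simp_all
  then show "m c p \<le> m' c p" "(a c p)\<^sup>2 * m c p \<le> (a' c p)\<^sup>2 * m' c p"
    using le[OF cp] le_FG[OF cp] unfolding F_def G_def by linarith+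
qed

text \<open>
  By \<open>le\<close>, \<open>R = m / m'\<close> satisfies \<open>a \<le> a' / R\<close>, which gives the inequality for the strong maximum
  principle. If \<open>m = m'\<close> everywhere, the equations force \<open>a = a'\<close>, and \<open>a m\<close> would have no zero.
\<close>

lemma less:
  assumes zero: "\<exists>c\<in>A. \<exists>p\<in>cdom c. a c p * m c p = 0" and cp: "c \<in> A" "p \<in> cdom c"
  shows "m c p < m' c p"
proof -
  have B: "weight_density A 1 (\<lambda>c p. 2 * m' c p + 4 * a' c p)"
    by (intro weight_density_add weight_density_scale t') auto
  have "(\<forall>c\<in>A. \<forall>p\<in>cdom c. m c p < m' c p) \<or>
      (\<forall>c\<in>A. \<forall>p\<in>cdom c. m c p = m' c p \<and> 2 * m c p - 2 * a c p = 2 * m' c p - 2 * a' c p)"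
  proof (rule ratio_strong_maximum[OF surface t(2) t'(2) B pos(2) le(1) t(5) t'(5), where \<theta> = "1 / 2"])
    fix c p assume cp: "c \<in> A" "p \<in> cdom c" and half: "1 / 2 * m' c p < m c p"
    note a' = pos(1)[OF cp] and m' = pos(2)[OF cp]
    define R where "R = m c p / m' c p"
    have R: "1 / 2 < R" "R \<le> 1" "m c p = R * m' c p"
      using half le(1)[OF cp] m' by (auto simp: R_def field_simps)
    have "m' c p * ((a c p)\<^sup>2 * R) \<le> m' c p * (a' c p)\<^sup>2"
      using le(2)[OF cp] R(3) by (simp add: mult_ac)
    then have "(a c p)\<^sup>2 * R \<le> (a' c p)\<^sup>2" using m' by simp
    moreover have "(a c p * R)\<^sup>2 \<le> (a c p)\<^sup>2 * R"
      using R mult_left_mono[of "R * R" R "(a c p)\<^sup>2"] by (simp add: power2_eq_square mult_ac mult_left_le)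
    ultimately have "a c p * R \<le> a' c p" using a' by (intro power2_le_imp_le[of "a c p * R"]) auto
    then have "a c p \<le> a' c p * (1 / R)" using R(1) by (simp add: field_simps)
    moreover have "a' c p * (2 * (R - 1)) \<le> a' c p * (1 - 1 / R)"
      using one_minus_inverse_ge[OF R(1,2)] a' by (intro mult_left_mono) auto
    ultimately have "(2 * m' c p + 4 * a' c p) * (R - 1)
        \<le> 2 * (R * m' c p) - 2 * a c p - (2 * m' c p - 2 * a' c p)"
      by (simp add: algebra_simps)
    then show "(2 * m' c p + 4 * a' c p) * (m c p / m' c p - 1)
        \<le> 2 * m c p - 2 * a c p - (2 * m' c p - 2 * a' c p)"
      unfolding R_def[symmetric] using R(3) by simp
  qed (use pos in auto)
  then show ?thesis
  proof
    assume eq: "\<forall>c\<in>A. \<forall>p\<in>cdom c. m c p = m' c p \<and> 2 * m c p - 2 * a c p = 2 * m' c p - 2 * a' c p"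
    obtain d x where x: "d \<in> A" "x \<in> cdom d" "a d x * m d x = 0" using zero by blast
    have "m d x = m' d x \<and> 2 * m d x - 2 * a d x = 2 * m' d x - 2 * a' d x" using eq x(1,2) by blast
    then have "m d x = m' d x" "a d x = a' d x" by simp_all
    then show ?thesis using x(3) pos(1)[OF x(1,2)] pos(2)[OF x(1,2)] by simp
  qed (use cp in blast)
qed

text \<open>
  The square of \<open>a m\<close> is the product of the two quantities bounded in \<open>le\<close>.
\<close>

lemma neighbours_le:
  assumes cp: "c \<in> A" "p \<in> cdom c"
  shows "a c p * m c p \<le> a' c p * m' c p"
proof (rule power2_le_imp_le)
  have "(a c p * m c p)\<^sup>2 = ((a c p)\<^sup>2 * m c p) * m c p" by (simp add: power2_eq_square mult_ac)
  also have "\<dots> \<le> ((a' c p)\<^sup>2 * m' c p) * m' c p"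
    using t(8)[OF cp] pos(2)[OF cp] by (intro mult_mono[OF le(2)[OF cp] le(1)[OF cp]]) auto
  finally show "(a c p * m c p)\<^sup>2 \<le> (a' c p * m' c p)\<^sup>2" by (simp add: power2_eq_square mult_ac)
  show "0 \<le> a' c p * m' c p" using pos(1)[OF cp] pos(2)[OF cp] by simp
qed

lemmas neighbours_le' = toda4_comparison.neighbours_le[OF swap]

text \<open>
  Put \<open>g = \<surd>(m' a')\<close>. Where \<open>a > g\<close>, the bounds on the products \<open>a m\<close> and \<open>a b\<close> give \<open>m, b \<le> g\<close>, while
  \<open>m b \<le> a' b'\<close> by the equality of total products; then \<open>(g - m) (g - b) \<ge> 0\<close> bounds \<open>m + b\<close>.
  Together with \<open>m' \<le> 4 a'\<close> this makes \<open>2 (2a - m - b)\<close> larger than \<open>m' - b'\<close>, which is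
  \<open>\<partial>\<partial>\<^sup>* log (m' a')\<close>.
\<close>

lemma square_le:
  assumes cp: "c \<in> A" "p \<in> cdom c"
  shows "(a c p)\<^sup>2 \<le> m' c p * a' c p"
proof (rule ratio_le[OF surface _ _ _ _ cp])
  have "weight_density A (2 * 1) (\<lambda>c p. (a c p)\<^sup>2)" "weight_density A (1 + 1) (\<lambda>c p. m' c p * a' c p)"
    by (intro weight_density_mult weight_density_square t t')+
  then show "weight_density A 2 (\<lambda>c p. (a c p)\<^sup>2)" "weight_density A 2 (\<lambda>c p. m' c p * a' c p)"
    by (simp_all add: numeral_2_eq_2)
  show "0 < m' c p * a' c p" if "c \<in> A" "p \<in> cdom c" for c p
    using pos(1)[OF that] pos(2)[OF that] by simp
  fix d x assume x: "d \<in> A" "x \<in> cdom d" and gt: "m' d x * a' d x < (a d x)\<^sup>2"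
  define u v w A' M' B' where defs: "u = a d x" "v = m d x" "w = b d x" "A' = a' d x" "M' = m' d x" "B' = b' d x"
  have nn: "0 \<le> u" "0 \<le> v" "0 \<le> w" "0 < A'" "0 < M'" "0 \<le> B'"
    using t(7-9)[OF x] t'(9)[OF x] pos(1)[OF x] pos(2)[OF x] by (simp_all add: defs)
  have ord: "B' \<le> A'" "A' \<le> M'" "3 * M' \<le> 4 * A'"
    using order[OF x] by (simp_all add: defs)
  define g where "g = sqrt (M' * A')"
  have g: "0 < g" "g\<^sup>2 = M' * A'" using nn by (simp_all add: g_def)
  have gu2: "g\<^sup>2 < u\<^sup>2" unfolding g(2) using gt by (simp add: defs)
  then have gu: "g < u" using nn(1) by (rule power2_less_imp_less)
  have bound: "y \<le> g" if "u * y \<le> A' * M'" for y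
  proof (rule ccontr)
    assume "\<not> y \<le> g"
    then have "g * g < u * y" using gu g(1) by (intro mult_strict_mono) auto
    then show False using that g(2) by (simp add: power2_eq_square mult.commute)
  qed
  have v: "v \<le> g" "w \<le> g"
    using bound neighbours_le[OF x] neighbours_le'[OF x] by (auto simp: defs)
  have "u\<^sup>2 * (v * w) = g\<^sup>2 * (A' * B')"
    using prod[OF x] unfolding g(2) by (simp add: defs power2_eq_square mult_ac)
  moreover have "g\<^sup>2 * (v * w) \<le> u\<^sup>2 * (v * w)" using gu2 nn by (intro mult_right_mono) auto
  ultimately have "g\<^sup>2 * (v * w) \<le> g\<^sup>2 * (A' * B')" by simp
  then have vw: "v * w \<le> A' * B'" using g(1) by simp
  have "0 \<le> (g - v) * (g - w)" using v by simp
  then have "g * (v + w) \<le> g\<^sup>2 + A' * B'" using vw by (simp add: algebra_simps power2_eq_square)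
  moreover have "g \<le> 2 * A'"
  proof (rule power2_le_imp_le)
    show "g\<^sup>2 \<le> (2 * A')\<^sup>2"
      unfolding g(2) using ord nn mult_right_mono[of M' "4 * A'" A'] by (simp add: power2_eq_square)
  qed (use nn in simp)
  then have "0 \<le> (2 * A' - g) * (M' - B')" using ord by (intro mult_nonneg_nonneg) auto
  then have "g * (M' - B') \<le> 2 * g\<^sup>2 - 2 * (A' * B')" unfolding g(2) by (simp add: algebra_simps)
  ultimately have "g * (M' - B') \<le> g * (4 * g - 2 * (v + w))" by (simp add: algebra_simps power2_eq_square)
  then have "M' - B' \<le> 4 * g - 2 * (v + w)" using g(1) by simp
  then have "M' - B' < 4 * u - 2 * (v + w)" using gu by linarith
  then have "(2 * M' - 2 * A') + (2 * A' - M' - B') < 2 * (2 * u - v - w)" by simp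
  moreover have "0 < u" using g(1) gu by linarith
  ultimately show "\<exists>k l. log_ddbar d (\<lambda>c p. (a c p)\<^sup>2) x k \<and> log_ddbar d (\<lambda>c p. m' c p * a' c p) x l \<and> l < k"
    using log_ddbar_square[OF t(4)[OF x]]
      log_ddbar_mult[OF t'(5)[OF x pos(2)[OF x]] t'(4)[OF x pos(1)[OF x]]]
    unfolding defs by blast
qed

text \<open>
  Where \<open>m b > m' a'\<close>, the arithmetic-geometric mean inequality gives \<open>m + b > 2 \<surd>(m' a')\<close>, and the
  equality of total products gives \<open>a \<le> \<surd>(a' b')\<close>. Then \<open>2 (m + b) - 4a\<close> exceeds \<open>m' - b'\<close>, as
  \<open>(\<surd>m' - \<surd>b') (4 \<surd>a' - \<surd>m' - \<surd>b') \<ge> 0\<close>.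
\<close>

lemma product_le:
  assumes cp: "c \<in> A" "p \<in> cdom c"
  shows "m c p * b c p \<le> m' c p * a' c p"
proof (rule ratio_le[OF surface _ _ _ _ cp])
  show "weight_density A (1 + 1) (\<lambda>c p. m c p * b c p)" "weight_density A (1 + 1) (\<lambda>c p. m' c p * a' c p)"
    by (intro weight_density_mult t t')+
  show "0 < m' c p * a' c p" if "c \<in> A" "p \<in> cdom c" for c p
    using pos(1)[OF that] pos(2)[OF that] by simp
  fix d x assume x: "d \<in> A" "x \<in> cdom d" and gt: "m' d x * a' d x < m d x * b d x"
  define u v w A' M' B' where defs: "u = a d x" "v = m d x" "w = b d x" "A' = a' d x" "M' = m' d x" "B' = b' d x"
  have nn: "0 \<le> u" "0 \<le> v" "0 \<le> w" "0 < A'" "0 < M'" "0 \<le> B'"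
    using t(7-9)[OF x] t'(9)[OF x] pos(1)[OF x] pos(2)[OF x] by (simp_all add: defs)
  have ord: "B' \<le> A'" "A' \<le> M'" "3 * M' \<le> 4 * A'"
    using order[OF x] by (simp_all add: defs)
  define \<alpha> \<mu> \<beta> where roots: "\<alpha> = sqrt A'" "\<mu> = sqrt M'" "\<beta> = sqrt B'"
  have sq: "A' = \<alpha>\<^sup>2" "M' = \<mu>\<^sup>2" "B' = \<beta>\<^sup>2" "0 < \<alpha>" "0 < \<mu>" "0 \<le> \<beta>"
    using nn by (simp_all add: roots)
  have vw_gt: "(\<mu> * \<alpha>)\<^sup>2 < v * w"
    unfolding power_mult_distrib sq(1,2)[symmetric] using gt by (simp add: defs)
  have "(2 * (\<mu> * \<alpha>))\<^sup>2 < (v + w)\<^sup>2"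
  proof -
    have "4 * (v * w) \<le> (v + w)\<^sup>2"
      using zero_le_power2[of "v - w"] by (simp add: power2_eq_square algebra_simps)
    then show ?thesis using vw_gt by (simp add: power_mult_distrib)
  qed
  then have vw: "2 * (\<mu> * \<alpha>) < v + w" by (rule power2_less_imp_less) (use nn in simp)
  have vw_pos: "0 < v * w" using vw_gt zero_le_power2[of "\<mu> * \<alpha>"] by linarith
  have "u\<^sup>2 * (v * w) = (\<alpha> * \<beta>)\<^sup>2 * (\<mu> * \<alpha>)\<^sup>2"
    using prod[OF x] unfolding defs[symmetric] unfolding sq(1-3)
    by (simp add: power2_eq_square mult_ac)
  also have "\<dots> \<le> (\<alpha> * \<beta>)\<^sup>2 * (v * w)" using vw_gt by (intro mult_left_mono) auto
  finally have "u\<^sup>2 \<le> (\<alpha> * \<beta>)\<^sup>2" using vw_pos by (rule mult_right_le_imp_le)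
  then have u: "u \<le> \<alpha> * \<beta>" by (rule power2_le_imp_le) (use sq in simp)
  have "\<mu> \<le> 2 * \<alpha>"
  proof (rule power2_le_imp_le)
    have "3 * \<mu>\<^sup>2 \<le> 4 * \<alpha>\<^sup>2" using ord(3) by (simp only: sq(1,2))
    then have "\<mu>\<^sup>2 \<le> 4 * \<alpha>\<^sup>2" using zero_le_power2[of \<mu>] by linarith
    then show "\<mu>\<^sup>2 \<le> (2 * \<alpha>)\<^sup>2" by (simp add: power_mult_distrib)
  qed (use sq in simp)
  moreover have "\<beta> \<le> \<mu>" using ord by (simp add: roots)
  ultimately have "0 \<le> (\<mu> - \<beta>) * (4 * \<alpha> - \<mu> - \<beta>)" by (intro mult_nonneg_nonneg) auto
  then have "M' - B' \<le> 4 * (\<mu> * \<alpha>) - 4 * (\<alpha> * \<beta>)"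
    unfolding sq(2,3) by (simp add: algebra_simps power2_eq_square)
  then have less: "(2 * M' - 2 * A') + (2 * A' - M' - B') < (2 * v - 2 * u) + (2 * w - 2 * u)"
    using vw u by linarith
  have "0 < v" "0 < w" using vw_pos nn by (auto simp: zero_less_mult_iff)
  with less show "\<exists>k l. log_ddbar d (\<lambda>c p. m c p * b c p) x k \<and> log_ddbar d (\<lambda>c p. m' c p * a' c p) x l \<and> l < k"
    using log_ddbar_mult[OF t(5)[OF x] t(6)[OF x]]
      log_ddbar_mult[OF t'(5)[OF x pos(2)[OF x]] t'(4)[OF x pos(1)[OF x]]]
    unfolding defs by blast
qed

text \<open>
  With \<open>R = a / m'\<close>, both \<open>m\<close> and \<open>b\<close> are at most \<open>a' / R\<close>. If \<open>a = m'\<close> everywhere, then \<open>a\<^sup>2 \<le> m' a'\<close> forces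
  \<open>a' = m'\<close>, and the equations give \<open>m + b = 2 m'\<close>, which contradicts \<open>m, b < m'\<close>.
\<close>

lemma diagonal_less:
  assumes m: "m c p < m' c p" and b: "b c p < m' c p" and cp: "c \<in> A" "p \<in> cdom c"
  shows "a c p < m' c p"
proof -
  have a'm': "a' c p \<le> m' c p" if "c \<in> A" "p \<in> cdom c" for c p
    by (rule order(2)[OF that])
  have a_le: "a c p \<le> m' c p" if "c \<in> A" "p \<in> cdom c" for c p
  proof (rule power2_le_imp_le)
    have "m' c p * a' c p \<le> m' c p * m' c p"
      using a'm'[OF that] pos(2)[OF that] by (intro mult_left_mono) auto
    then show "(a c p)\<^sup>2 \<le> (m' c p)\<^sup>2" using square_le[OF that] by (simp add: power2_eq_square)
  qed (use pos(2)[OF that] in simp)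
  have B: "weight_density A 1 (\<lambda>c p. 2 * m' c p + 4 * a' c p)"
    by (intro weight_density_add weight_density_scale t') auto
  have "(\<forall>c\<in>A. \<forall>p\<in>cdom c. a c p < m' c p) \<or>
      (\<forall>c\<in>A. \<forall>p\<in>cdom c. a c p = m' c p \<and> 2 * a c p - m c p - b c p = 2 * m' c p - 2 * a' c p)"
  proof (rule ratio_strong_maximum[OF surface t(1) t'(2) B pos(2) a_le t(4) t'(5), where \<theta> = "1 / 2"])
    fix c p assume cp: "c \<in> A" "p \<in> cdom c" and half: "1 / 2 * m' c p < a c p"
    note a' = pos(1)[OF cp] and m' = pos(2)[OF cp]
    define R where "R = a c p / m' c p"
    have R: "1 / 2 < R" "R \<le> 1" "a c p = R * m' c p"
      using half a_le[OF cp] m' by (auto simp: R_def field_simps)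
    have bound: "y \<le> a' c p * (1 / R)" if "a c p * y \<le> a' c p * m' c p" for y
    proof -
      have "m' c p * (R * y) \<le> m' c p * a' c p" using that R(3) by (simp add: mult_ac)
      then have "R * y \<le> a' c p" using m' by simp
      then show ?thesis using R(1) by (simp add: field_simps)
    qed
    have "m c p \<le> a' c p * (1 / R)" "b c p \<le> a' c p * (1 / R)"
      using bound[OF neighbours_le[OF cp]] bound[OF neighbours_le'[OF cp]] .
    moreover have "a' c p * (2 * (R - 1)) \<le> a' c p * (1 - 1 / R)"
      using one_minus_inverse_ge[OF R(1,2)] a' by (intro mult_left_mono) auto
    ultimately have "(2 * m' c p + 4 * a' c p) * (R - 1)
        \<le> 2 * (R * m' c p) - m c p - b c p - (2 * m' c p - 2 * a' c p)"
      by (simp add: algebra_simps)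
    then show "(2 * m' c p + 4 * a' c p) * (a c p / m' c p - 1)
        \<le> 2 * a c p - m c p - b c p - (2 * m' c p - 2 * a' c p)"
      unfolding R_def[symmetric] using R(3) by simp
  qed (use pos in auto)
  then show ?thesis
  proof
    assume eq: "\<forall>c\<in>A. \<forall>p\<in>cdom c. a c p = m' c p \<and> 2 * a c p - m c p - b c p = 2 * m' c p - 2 * a' c p"
    then have "a c p = m' c p \<and> 2 * a c p - m c p - b c p = 2 * m' c p - 2 * a' c p"
      using cp by blast
    then have a: "a c p = m' c p" and l: "2 * a c p - m c p - b c p = 2 * m' c p - 2 * a' c p"
      by blast+
    have "m' c p * m' c p \<le> m' c p * a' c p" using square_le[OF cp] a by (simp add: power2_eq_square)
    then have "m' c p \<le> a' c p" using pos(2)[OF cp] by simp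
    then show ?thesis using l a m b a'm'[OF cp] by linarith
  qed (use cp in blast)
qed

lemma sum_less:
  assumes zero: "\<exists>c\<in>A. \<exists>p\<in>cdom c. a c p * m c p = 0" "\<exists>c\<in>A. \<exists>p\<in>cdom c. a c p * b c p = 0"
    and cp: "c \<in> A" "p \<in> cdom c"
  shows "2 * a c p + m c p + b c p < 2 * a' c p + m' c p + b' c p"
proof -
  interpret swapped: toda4_comparison A a b m a' m' b' by (rule swap)
  have m: "m c p < m' c p" and b: "b c p < m' c p"
    by (rule less[OF zero(1) cp], rule swapped.less[OF zero(2) cp])
  have ord: "b' c p \<le> a' c p" by (rule order(1)[OF cp])
  show ?thesis
    by (rule toda4_inequality[OF t(7)[OF cp] t(8)[OF cp] t(9)[OF cp] pos(1)[OF cp] pos(2)[OF cp] t'(9)[OF cp]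
          ord diagonal_less[OF m b cp] m b neighbours_le[OF cp] neighbours_le'[OF cp] square_le[OF cp]
          product_le[OF cp] le(2)[OF cp] swapped.le(2)[OF cp] prod[OF cp]])
qed

end

section \<open>The Hitchin equation of a cyclic bundle as a Toda system\<close>

lemma partial_eq_derivative:
  assumes "(f has_derivative D) (at w)"
  shows "partial_x f w = D 1" "partial_y f w = D \<i>"
  using has_derivative_along_line[of f D w 1 0] has_derivative_along_line[of f D w \<i> 0] assms
  by (simp_all add: partial_x_def partial_y_def vector_derivative_at)

text \<open>
  For a positive function \<open>f\<close>, \<open>F = f\<^sup>-\<^sup>1 \<partial>f\<close> has real part \<open>u\<^sub>x / 2\<close> and imaginary part \<open>- u\<^sub>y / 2\<close>, where
  \<open>u = log f\<close>. So the real part of \<open>wirtinger_bar F\<close> is \<open>(u\<^sub>x\<^sub>x + u\<^sub>y\<^sub>y) / 4\<close>. The function \<open>F\<close> is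
  prescribed on \<open>S\<close> only, since the metric is positive on the chart image only.
\<close>

lemma has_ddbar_ln_smooth:
  assumes S: "open S" "z \<in> S" and smooth: "smooth_on f S"
    and real: "\<And>w. w \<in> S \<Longrightarrow> Im (f w) = 0" and pos: "\<And>w. w \<in> S \<Longrightarrow> 0 < Re (f w)"
    and F: "\<And>w. w \<in> S \<Longrightarrow> F w = inverse (f w) * wirtinger f w"
  shows "has_ddbar (\<lambda>w. ln (Re (f w))) z (Re (wirtinger_bar F z))"
proof -
  have C2: "C_k_on (Suc (Suc 0)) f S" using smooth unfolding smooth_on_def by blast
  define Df where "Df = (\<lambda>w. frechet_derivative f (at w))"
  have Df: "(f has_derivative Df w) (at w)" if "w \<in> S" for w
    using C2 that unfolding Df_def by (auto simp: frechet_derivative_works[symmetric])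
  define Du where "Du = (\<lambda>w h. Re (Df w h) / Re (f w))"
  have Im_Df: "Im (Df w h) = 0" if w: "w \<in> S" for w h
  proof -
    have D: "((\<lambda>w. Im (f w)) has_derivative (\<lambda>h. Im (Df w h))) (at w)"
      using Df[OF w] by (auto intro!: derivative_eq_intros)
    have "((\<lambda>w. Im (f w)) has_derivative (\<lambda>h. 0)) (at w)"
      by (rule has_derivative_transform_within_open[OF has_derivative_const[of 0] S(1) w])
        (simp add: real)
    from has_derivative_unique[OF D this] show ?thesis by (rule fun_cong)
  qed
  have px: "partial_x f w = of_real (Re (Df w 1))" and py: "partial_y f w = of_real (Re (Df w \<i>))"
    if "w \<in> S" for w
    using partial_eq_derivative[OF Df[OF that]] Im_Df[OF that] by (simp_all add: complex_eq_iff)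
  have fw: "f w = of_real (Re (f w))" if "w \<in> S" for w
    using real[OF that] by (simp add: complex_eq_iff)
  have F_eq: "F w = of_real (Du w 1 / 2) - \<i> * of_real (Du w \<i> / 2)" if "w \<in> S" for w
  proof -
    have "F w = inverse (of_real (Re (f w))) * ((of_real (Re (Df w 1)) - \<i> * of_real (Re (Df w \<i>))) / 2)"
      using F[OF that] fw[OF that] px[OF that] py[OF that] by (simp add: wirtinger_def)
    then show ?thesis
      using pos[OF that] by (simp add: Du_def complex_eq_iff Re_divide Im_divide power2_eq_square field_simps)
  qed
  have "(\<lambda>w. inverse (f w) * ((partial_x f w - \<i> * partial_y f w) / 2)) differentiable (at z)"
  proof -
    have "f differentiable (at z)" "partial_x f differentiable (at z)" "partial_y f differentiable (at z)"
      using C2 S(2) by simp_all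
    moreover have "f z \<noteq> 0" using pos[OF S(2)] by auto
    ultimately show ?thesis
      by (intro differentiable_mult differentiable_inverse differentiable_diff
          differentiable_cmult_left_iff[THEN iffD2] differentiable_const) (auto intro!: derivative_intros)
  qed
  then obtain DG where "((\<lambda>w. inverse (f w) * ((partial_x f w - \<i> * partial_y f w) / 2)) has_derivative DG) (at z)"
    unfolding differentiable_def by blast
  then have DG: "(F has_derivative DG) (at z)"
    by (rule has_derivative_transform_within_open[OF _ S]) (simp add: F wirtinger_def)
  have line: "((\<lambda>t. F (z + v * of_real t)) has_vector_derivative DG v) (at 0)" for v
    using has_derivative_along_line[of F DG z v 0] DG by simp
  have near: "\<forall>\<^sub>F t in nhds 0. z + v * of_real t \<in> S" for v
    using eventually_nhds_line[OF eventually_nhds_in_open[OF S]] .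
  show ?thesis
  proof (rule has_ddbarI[where Du = Du])
    have "((\<lambda>w. ln (Re (f w))) has_derivative Du w) (at w)" if w: "w \<in> S" for w
    proof -
      have "((\<lambda>w. Re (f w)) has_derivative (\<lambda>h. Re (Df w h))) (at w)"
        using Df[OF w] by (auto intro!: derivative_eq_intros)
      from has_derivative_ln[OF pos[OF w] this] show ?thesis
        by (simp add: Du_def[abs_def] divide_inverse)
    qed
    then show "\<forall>\<^sub>F w in nhds z. ((\<lambda>w. ln (Re (f w))) has_derivative Du w) (at w)"
      using S by (auto simp: eventually_nhds)
    have "((\<lambda>t. 2 * Re (F (z + 1 * of_real t))) has_real_derivative 2 * Re (DG 1)) (at 0)"
      using bounded_linear.has_vector_derivative[OF bounded_linear_Re line[of 1]]
      by (intro DERIV_cmult) (simp add: has_real_derivative_iff_has_vector_derivative)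
    moreover have "\<forall>\<^sub>F t in nhds 0. 2 * Re (F (z + 1 * of_real t)) = Du (z + of_real t) 1"
      using near[of 1] by eventually_elim (simp add: F_eq)
    ultimately show "((\<lambda>t. Du (z + of_real t) 1) has_real_derivative 2 * Re (DG 1)) (at 0)"
      by (subst (asm) DERIV_cong_ev[OF refl _ refl]) auto
    have "((\<lambda>t. - 2 * Im (F (z + \<i> * of_real t))) has_real_derivative - 2 * Im (DG \<i>)) (at 0)"
      using bounded_linear.has_vector_derivative[OF bounded_linear_Im line[of \<i>]]
      by (intro DERIV_cmult) (simp add: has_real_derivative_iff_has_vector_derivative)
    moreover have "\<forall>\<^sub>F t in nhds 0. - 2 * Im (F (z + \<i> * of_real t)) = Du (z + \<i> * of_real t) \<i>"
      using near[of \<i>] by eventually_elim (simp add: F_eq)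
    ultimately show "((\<lambda>t. Du (z + \<i> * of_real t) \<i>) has_real_derivative - 2 * Im (DG \<i>)) (at 0)"
      by (subst (asm) DERIV_cong_ev[OF refl _ refl]) auto
    show "4 * Re (wirtinger_bar F z) = 2 * Re (DG 1) + - 2 * Im (DG \<i>)"
      using partial_eq_derivative[OF DG] by (simp add: wirtinger_bar_def)
  qed
qed

definition metric_entry :: "'a matrix_field \<Rightarrow> nat \<Rightarrow> 'a chart \<Rightarrow> 'a \<Rightarrow> real" where
  "metric_entry H i c p = Re (H c p $$ (i, i))"

text \<open>
  The squared norm, in the coordinate of \<open>c\<close>, of the \<open>j\<close>-th component of the Higgs field with respect to the
  metrics \<open>h\<^sub>j\<close> and \<open>h\<^sub>j\<^sub>+\<^sub>1\<close>.
\<close>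

definition energy_density ::
    "'a matrix_field \<Rightarrow> 'a section_of list \<Rightarrow> nat \<Rightarrow> 'a chart \<Rightarrow> 'a \<Rightarrow> real" where
  "energy_density H ss j c p =
     (cmod ((ss ! j) c p))\<^sup>2 * metric_entry H (Suc j mod length ss) c p * inverse (metric_entry H j c p)"

lemma mat_adjoint_index:
  assumes "M \<in> carrier_mat n n" "i < n" "j < n"
  shows "mat_adjoint M $$ (i, j) = cnj (M $$ (j, i))"
  using assms by (simp add: mat_adjoint_def mat_of_rows_index)

lemma mat_adjoint_carrier: "M \<in> carrier_mat n n \<Longrightarrow> mat_adjoint M \<in> carrier_mat n n"
  by (auto simp: mat_adjoint_def)

lemma mat_inv_mat_diag:
  assumes "\<And>i. i < n \<Longrightarrow> d i \<noteq> 0"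
  shows "mat_inv (mat_diag n d) = mat_diag n (\<lambda>i. inverse (d i))"
proof -
  let ?D = "mat_diag n d" and ?D' = "mat_diag n (\<lambda>i. inverse (d i))"
  have one: "mat_diag n (\<lambda>i. d i * inverse (d i)) = 1\<^sub>m n" "mat_diag n (\<lambda>i. inverse (d i) * d i) = 1\<^sub>m n"
    using assms by (auto simp: mat_diag_def one_mat_def)
  have inv: "?D * ?D' = 1\<^sub>m n" "?D' * ?D = 1\<^sub>m n" by (simp_all add: one)
  have D: "?D \<in> carrier_mat n n" "?D' \<in> carrier_mat n n" by auto
  have "\<exists>X\<in>carrier_mat n n. X * ?D = 1\<^sub>m n \<and> ?D * X = 1\<^sub>m n" using inv D(2) by blast
  then have "?D \<in> Units (ring_mat TYPE(complex) n ())"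
    using D(1) by (simp add: Units_def ring_mat_simps del: mat_diag_diag)
  then obtain B where B: "mat_inverse ?D = Some B"
    using mat_inverse(1)[OF D(1), where b = "()"] by (cases "mat_inverse ?D") auto
  have DB: "?D * B = 1\<^sub>m n" and Bc: "B \<in> carrier_mat n n" using mat_inverse(2)[OF D(1) B] by auto
  have "B = (?D' * ?D) * B" unfolding inv(2) using Bc by simp
  also have "\<dots> = ?D' * (?D * B)" by (rule assoc_mult_mat[OF D(2,1) Bc])
  also have "\<dots> = ?D'" unfolding DB by (rule right_mult_one_mat[OF D(2)])
  finally show ?thesis by (simp add: mat_inv_def B)
qed

lemma hermitian_metric_entry:
  assumes H: "hermitian_metric A n E H" and cp: "c \<in> A" "p \<in> cdom c" and i: "i < n"
  shows "H c p $$ (i, i) = of_real (metric_entry H i c p)" "0 < metric_entry H i c p"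
proof -
  have Hc: "H c p \<in> carrier_mat n n" "mat_adjoint (H c p) = H c p"
    and posdef: "\<And>v. v \<in> carrier_vec n \<Longrightarrow> v \<noteq> 0\<^sub>v n \<Longrightarrow> 0 < Re ((H c p *\<^sub>v v) \<bullet>c v)"
    using H cp unfolding hermitian_metric_def by blast+
  have "cnj (H c p $$ (i, i)) = H c p $$ (i, i)"
    using mat_adjoint_index[OF Hc(1) i i] Hc(2) by simp
  then show "H c p $$ (i, i) = of_real (metric_entry H i c p)"
    by (simp add: metric_entry_def complex_eq_iff)
  have "(H c p *\<^sub>v unit_vec n i) \<bullet>c unit_vec n i = H c p $$ (i, i)"
  proof -
    have "conjugate (unit_vec n i) = (unit_vec n i :: complex vec)"
      by (rule eq_vecI) (auto simp: unit_vec_def)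
    then show ?thesis using Hc(1) i by simp
  qed
  then show "0 < metric_entry H i c p"
    using posdef[of "unit_vec n i"] i by (simp add: metric_entry_def)
qed

lemma diagonal_metric:
  assumes H: "hermitian_metric A n E H" and cp: "c \<in> A" "p \<in> cdom c" and diag: "diagonal_mat (H c p)"
  shows "H c p = mat_diag n (\<lambda>i. of_real (metric_entry H i c p))"
proof -
  have "H c p \<in> carrier_mat n n" using H cp unfolding hermitian_metric_def by blast
  then show ?thesis
    using diag hermitian_metric_entry(1)[OF H cp] by (auto simp: mat_diag_def diagonal_mat_def)
qed

lemma higgs_adjoint_diagonal:
  assumes H: "hermitian_metric A n E H" and cp: "c \<in> A" "p \<in> cdom c" and diag: "diagonal_mat (H c p)"
    and \<phi>: "\<phi> c p \<in> carrier_mat n n"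
  shows "higgs_adjoint H \<phi> c p = Matrix.mat n n (\<lambda>(i, j).
     cnj (\<phi> c p $$ (j, i)) * of_real (metric_entry H j c p * inverse (metric_entry H i c p)))"
proof -
  note D = diagonal_metric[OF H cp diag]
  let ?h = "\<lambda>i. complex_of_real (metric_entry H i c p)"
  let ?X = "mat_adjoint (\<phi> c p)"
  have X: "?X \<in> carrier_mat n n" by (rule mat_adjoint_carrier[OF \<phi>])
  have h: "?h i \<noteq> 0" if "i < n" for i
    using hermitian_metric_entry(2)[OF H cp that] by simp
  have "mat_inv (H c p) = mat_diag n (\<lambda>i. inverse (?h i))"
    unfolding D by (rule mat_inv_mat_diag[OF h])
  then have "higgs_adjoint H \<phi> c p = mat_diag n (\<lambda>i. inverse (?h i)) * ?X * mat_diag n ?h"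
    unfolding higgs_adjoint_def by (simp only: D)
  also have "mat_diag n (\<lambda>i. inverse (?h i)) * ?X = Matrix.mat n n (\<lambda>(i, j). inverse (?h i) * ?X $$ (i, j))"
    by (rule mat_diag_mult_left[OF X])
  also have "\<dots> * mat_diag n ?h =
      Matrix.mat n n (\<lambda>(i, j). Matrix.mat n n (\<lambda>(i, j). inverse (?h i) * ?X $$ (i, j)) $$ (i, j) * ?h j)"
    by (rule mat_diag_mult_right) simp
  also have "\<dots> = Matrix.mat n n (\<lambda>(i, j).
     cnj (\<phi> c p $$ (j, i)) * of_real (metric_entry H j c p * inverse (metric_entry H i c p)))"
    by (rule eq_matI) (simp_all add: mat_adjoint_index[OF \<phi>])
  finally show ?thesis .
qed

lemma mult_mat_index:
  assumes "M \<in> carrier_mat n n" "N \<in> carrier_mat n n" "i < n" "j < n"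
  shows "(M * N) $$ (i, j) = (\<Sum>k<n. M $$ (i, k) * N $$ (k, j))"
  using assms by (simp add: scalar_prod_def lessThan_atLeast0)

text \<open>
  The common form of the given Higgs bundle and of the one in the Hitchin component.
\<close>

definition cyclic_bundle ::
    "'a chart set \<Rightarrow> nat \<Rightarrow> 'a lbundle list \<Rightarrow> 'a section_of list \<Rightarrow> bool" where
  "cyclic_bundle A n Ls ss \<longleftrightarrow> 2 \<le> n \<and> length Ls = n \<and> length ss = n \<and>
     (\<forall>i<n. line_bundle A (Ls ! i) \<and> twisted_hom A (Ls ! i) (Ls ! (Suc i mod n)) (ss ! i))"

lemma cyclic_field_carrier: "length ss = n \<Longrightarrow> cyclic_field ss c p \<in> carrier_mat n n"
  by (simp add: cyclic_field_def)

lemma cyclic_field_index: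
  "i < length ss \<Longrightarrow> j < length ss \<Longrightarrow>
    cyclic_field ss c p $$ (i, j) = (if i = Suc j mod length ss then (ss ! j) c p else 0)"
  by (simp add: cyclic_field_def)

lemma Suc_mod_eq_iff:
  assumes "i < n" "j < n"
  shows "i = Suc j mod n \<longleftrightarrow> j = (i + n - 1) mod n"
proof (cases "Suc j = n")
  case True
  then show ?thesis using assms by (cases i) (auto simp: mod_if)
next
  case False
  then have "Suc j mod n = Suc j" using assms by simp
  moreover have "(i + n - 1) mod n = i - 1" if "0 < i"
    using assms that by (simp add: mod_if)
  moreover have "(i + n - 1) mod n = n - 1" if "i = 0" using assms that by simp
  ultimately show ?thesis using assms False by (cases "i = 0") auto
qed

text \<open>
  In row and column \<open>i\<close>, the product \<open>\<phi> \<phi>\<^sup>*\<close> sees the component that enters line \<open>i\<close>, and \<open>\<phi>\<^sup>* \<phi>\<close> the one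
  that leaves it.
\<close>

lemma higgs_bracket_diagonal:
  assumes H: "hermitian_metric A n E H" and cp: "c \<in> A" "p \<in> cdom c" and diag: "diagonal_mat (H c p)"
    and ss: "length ss = n" and i: "i < n"
  shows "higgs_bracket H (cyclic_field ss) c p $$ (i, i) =
    of_real (energy_density H ss ((i + n - 1) mod n) c p - energy_density H ss i c p)"
proof -
  let ?\<phi> = "cyclic_field ss c p" and ?\<psi> = "higgs_adjoint H (cyclic_field ss) c p"
  let ?h = "\<lambda>i. metric_entry H i c p" and ?e = "\<lambda>i. energy_density H ss i c p"
  have \<phi>: "?\<phi> \<in> carrier_mat n n" by (rule cyclic_field_carrier[OF ss])
  note adj = higgs_adjoint_diagonal[where \<phi> = "cyclic_field ss", OF H cp diag \<phi>]
  have \<psi>: "?\<psi> \<in> carrier_mat n n" by (simp add: adj)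
  have sq: "x * (cnj x * of_real r) = of_real ((cmod x)\<^sup>2 * r)" for x r
    by (simp add: mult.assoc[symmetric] complex_norm_square[symmetric] del: of_real_power)
  have "(?\<phi> * ?\<psi>) $$ (i, i) = (\<Sum>j<n. ?\<phi> $$ (i, j) * ?\<psi> $$ (j, i))"
    using \<phi> \<psi> i by (simp add: scalar_prod_def lessThan_atLeast0)
  also have "\<dots> = (\<Sum>j<n. if j = (i + n - 1) mod n then of_real (?e j) else 0)"
  proof (rule sum.cong[OF refl])
    fix j assume "j \<in> {..<n}"
    then have j: "j < n" by simp
    show "?\<phi> $$ (i, j) * ?\<psi> $$ (j, i) = (if j = (i + n - 1) mod n then of_real (?e j) else 0)"
      using Suc_mod_eq_iff[OF i j] i j ss unfolding adj
      by (auto simp: cyclic_field_index sq energy_density_def mult.assoc)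
  qed
  also have "\<dots> = of_real (?e ((i + n - 1) mod n))" using i by (simp add: sum.delta)
  finally have 1: "(?\<phi> * ?\<psi>) $$ (i, i) = of_real (?e ((i + n - 1) mod n))" .
  have "(?\<psi> * ?\<phi>) $$ (i, i) = (\<Sum>j<n. ?\<psi> $$ (i, j) * ?\<phi> $$ (j, i))"
    using \<phi> \<psi> i by (simp add: scalar_prod_def lessThan_atLeast0)
  also have "\<dots> = (\<Sum>j<n. if j = Suc i mod n then of_real (?e i) else 0)"
  proof (rule sum.cong[OF refl])
    fix j assume "j \<in> {..<n}"
    then have j: "j < n" by simp
    have "cnj x * of_real r * x = of_real ((cmod x)\<^sup>2 * r)" for x r
      using sq[of x r] by (simp add: mult_ac)
    then show "?\<psi> $$ (i, j) * ?\<phi> $$ (j, i) = (if j = Suc i mod n then of_real (?e i) else 0)"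
      using i j ss unfolding adj by (auto simp: cyclic_field_index energy_density_def mult.assoc)
  qed
  also have "\<dots> = of_real (?e i)" using i by (simp add: sum.delta)
  finally have 2: "(?\<psi> * ?\<phi>) $$ (i, i) = of_real (?e i)" .
  show ?thesis using \<phi> \<psi> i 1 2 by (simp add: higgs_bracket_def)
qed

text \<open>
  The \<open>i\<close>-th diagonal entry of the Hitchin equation: the curvature of a diagonal metric is
  \<open>- \<partial>\<partial>\<^sup>* log h\<^sub>i\<close>.
\<close>

lemma metric_entry_log_ddbar:
  assumes A: "holomorphic_atlas A" and harmonic: "harmonic_metric A n E (cyclic_field ss) H"
    and ss: "length ss = n" and cp: "c \<in> A" "p \<in> cdom c" and i: "i < n"
  shows "log_ddbar c (metric_entry H i) p
    (energy_density H ss ((i + n - 1) mod n) c p - energy_density H ss i c p)"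
proof -
  have H: "hermitian_metric A n E H" using harmonic by (simp add: harmonic_metric_def)
  have diag: "diagonal_mat (H c q)" if "q \<in> cdom c" for q
    using harmonic cp(1) that by (simp add: harmonic_metric_def)
  define S where "S = coord c ` cdom c"
  define f where "f = (\<lambda>w. H c (chart_inv c w) $$ (i, i))"
  define F where "F = (\<lambda>w. (mat_inv (H c (chart_inv c w)) *
      mat_deriv wirtinger n (\<lambda>u. H c (chart_inv c u)) w) $$ (i, i))"
  have S: "open S" "coord c p \<in> S" using chart_open(2)[OF A cp(1)] cp(2) by (auto simp: S_def)
  have inv: "chart_inv c w \<in> cdom c" if "w \<in> S" for w
    using coord_chart_inv(2)[OF A cp(1)] that by (simp add: S_def)
  have f: "f w = of_real (metric_entry H i c (chart_inv c w))" "0 < metric_entry H i c (chart_inv c w)"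
    if "w \<in> S" for w
    using hermitian_metric_entry[OF H cp(1) inv[OF that] i] by (simp_all add: f_def)
  have smooth: "smooth_on f S" using H cp(1) i unfolding hermitian_metric_def f_def S_def by blast
  have F: "F w = inverse (f w) * wirtinger f w" if w: "w \<in> S" for w
  proof -
    let ?M = "mat_deriv wirtinger n (\<lambda>u. H c (chart_inv c u)) w"
    have M: "?M \<in> carrier_mat n n" by (simp add: mat_deriv_def)
    note D = diagonal_metric[OF H cp(1) inv[OF w] diag[OF inv[OF w]]]
    have "complex_of_real (metric_entry H k c (chart_inv c w)) \<noteq> 0" if "k < n" for k
      using hermitian_metric_entry(2)[OF H cp(1) inv[OF w] that] by simp
    then have "mat_inv (H c (chart_inv c w)) =
        mat_diag n (\<lambda>i. inverse (of_real (metric_entry H i c (chart_inv c w))))"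
      unfolding D by (rule mat_inv_mat_diag)
    then show ?thesis
      unfolding F_def f(1)[OF w] using i by (simp add: mat_diag_mult_left[OF M]) (simp add: mat_deriv_def f_def)
  qed
  have "has_ddbar (\<lambda>w. ln (Re (f w))) (coord c p) (Re (wirtinger_bar F (coord c p)))"
    using f by (intro has_ddbar_ln_smooth[OF S smooth _ _ F]) auto
  then have dd: "has_ddbar (\<lambda>w. ln (metric_entry H i c (chart_inv c w))) (coord c p)
      (Re (wirtinger_bar F (coord c p)))"
    by (simp add: f_def metric_entry_def)
  have "chern_curvature n H c p + higgs_bracket H (cyclic_field ss) c p = 0\<^sub>m n n"
    using harmonic cp by (simp add: harmonic_metric_def)
  then have "(chern_curvature n H c p + higgs_bracket H (cyclic_field ss) c p) $$ (i, i) = 0"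
    using i by simp
  moreover have \<phi>: "cyclic_field ss c p \<in> carrier_mat n n" by (rule cyclic_field_carrier[OF ss])
  have "higgs_adjoint H (cyclic_field ss) c p \<in> carrier_mat n n"
    by (simp add: higgs_adjoint_diagonal[where \<phi> = "cyclic_field ss", OF H cp diag[OF cp(2)] \<phi>])
  then have "higgs_bracket H (cyclic_field ss) c p \<in> carrier_mat n n"
    unfolding higgs_bracket_def using \<phi> by (intro minus_carrier_mat mult_carrier_mat)
  moreover have "chern_curvature n H c p $$ (i, i) = - wirtinger_bar F (coord c p)"
    using i by (simp add: chern_curvature_def mat_deriv_def F_def)
  ultimately have "wirtinger_bar F (coord c p) = higgs_bracket H (cyclic_field ss) c p $$ (i, i)"
    using i by simp
  then have "Re (wirtinger_bar F (coord c p)) =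
      energy_density H ss ((i + n - 1) mod n) c p - energy_density H ss i c p"
    using higgs_bracket_diagonal[OF H cp diag[OF cp(2)] ss i] by simp
  moreover have "\<forall>\<^sub>F w in nhds (coord c p). 0 < metric_entry H i c (chart_inv c w)"
    using eventually_nhds_in_open[OF S] by eventually_elim (rule f(2))
  ultimately show ?thesis using dd by (simp add: log_ddbar_def)
qed

lemma holomorphic_log_ddbar:
  assumes A: "holomorphic_atlas A" and cp: "c \<in> A" "p \<in> cdom c"
    and s: "holomorphic_in c (s c)" and nz: "s c p \<noteq> 0"
  shows "log_ddbar c (\<lambda>c p. (cmod (s c p))\<^sup>2) p 0"
proof -
  let ?f = "\<lambda>w. s c (chart_inv c w)"
  have S: "open (coord c ` cdom c)" "coord c p \<in> coord c ` cdom c"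
    using chart_open(2)[OF A cp(1)] cp(2) by auto
  have hol: "?f holomorphic_on (coord c ` cdom c)" using s by (simp add: holomorphic_in_def)
  have nz': "?f (coord c p) \<noteq> 0" using nz chart_inv_coord[OF A cp] by simp
  have "isCont ?f (coord c p)"
    using holomorphic_on_imp_continuous_on[OF hol] continuous_on_eq_continuous_at[OF S(1)] S(2) by blast
  then have "\<forall>\<^sub>F w in nhds (coord c p). ?f w \<noteq> 0"
    using isCont_tendsto_nhds tendsto_imp_eventually_ne[OF _ nz'] by blast
  then have "\<forall>\<^sub>F w in nhds (coord c p). 0 < (cmod (?f w))\<^sup>2"
    by eventually_elim simp
  then show ?thesis
    using has_ddbar_ln_norm_square[OF hol S nz'] by (simp add: log_ddbar_def)
qed

lemma line_bundle_nonzero: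
  assumes "line_bundle A L" "c \<in> A" "d \<in> A" "p \<in> cdom c" "p \<in> cdom d"
  shows "L c d p \<noteq> 0"
proof -
  have "L c c p = L c d p * L d c p" "L c c p = 1"
    using assms unfolding line_bundle_def by blast+
  then show ?thesis by auto
qed

lemma metric_entry_change:
  assumes H: "hermitian_metric A n (direct_sum Ls) H" and Ls: "length Ls = n" and i: "i < n"
    and cd: "c \<in> A" "d \<in> A" "p \<in> cdom c" "p \<in> cdom d" and diag: "diagonal_mat (H c p)"
  shows "metric_entry H i d p = (cmod ((Ls ! i) c d p))\<^sup>2 * metric_entry H i c p"
proof -
  let ?E = "direct_sum Ls c d p"
  have E: "?E = mat_diag n (\<lambda>i. (Ls ! i) c d p)"
    using Ls by (auto simp: direct_sum_def mat_diag_def)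
  have Ec: "?E \<in> carrier_mat n n" by (simp add: E)
  have adj: "mat_adjoint ?E = mat_diag n (\<lambda>i. cnj ((Ls ! i) c d p))"
    using mat_adjoint_index[OF Ec] mat_adjoint_carrier[OF Ec] by (auto simp: E mat_diag_def)
  have "H d p = mat_adjoint ?E * H c p * ?E"
    using H cd unfolding hermitian_metric_def by blast
  then have "H d p $$ (i, i) = cnj ((Ls ! i) c d p) * of_real (metric_entry H i c p) * (Ls ! i) c d p"
    unfolding adj unfolding diagonal_metric[OF H cd(1,3) diag] E mat_diag_diag
    using i by (simp add: mat_diag_def)
  also have "\<dots> = of_real ((cmod ((Ls ! i) c d p))\<^sup>2 * metric_entry H i c p)"
    by (simp add: complex_norm_square mult_ac del: of_real_power)
  finally show ?thesis by (simp add: metric_entry_def)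
qed

lemma metric_entry_continuous:
  assumes H: "hermitian_metric A n E H" and "i < n" "c \<in> A"
  shows "continuous_on (coord c ` cdom c) (\<lambda>w. metric_entry H i c (chart_inv c w))"
proof -
  have "smooth_on (\<lambda>w. H c (chart_inv c w) $$ (i, i)) (coord c ` cdom c)"
    using assms unfolding hermitian_metric_def by blast
  then have "C_k_on 0 (\<lambda>w. H c (chart_inv c w) $$ (i, i)) (coord c ` cdom c)"
    unfolding smooth_on_def by blast
  then show ?thesis unfolding metric_entry_def by (auto intro: continuous_intros)
qed

lemma energy_density_nonneg:
  assumes "hermitian_metric A n E H" "length ss = n" "c \<in> A" "p \<in> cdom c" "j < n"
  shows "0 \<le> energy_density H ss j c p"
    and "energy_density H ss j c p = 0 \<longleftrightarrow> (ss ! j) c p = 0"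
proof -
  have "0 < metric_entry H j c p" "0 < metric_entry H (Suc j mod n) c p"
    using hermitian_metric_entry(2)[OF assms(1,3,4)] assms(5) by auto
  then show "0 \<le> energy_density H ss j c p" "energy_density H ss j c p = 0 \<longleftrightarrow> (ss ! j) c p = 0"
    by (simp_all add: energy_density_def assms(2))
qed

text \<open>
  Passing to another chart, the transition functions of the two line bundles cancel against those of
  the metrics, and the factor \<open>K\<close> of the twist remains.
\<close>

lemma energy_density_weight:
  assumes A: "holomorphic_atlas A" and cyc: "cyclic_bundle A n Ls ss"
    and harmonic: "harmonic_metric A n (direct_sum Ls) (cyclic_field ss) H" and j: "j < n"
  shows "weight_density A 1 (energy_density H ss j)"
proof (rule weight_densityI)
  have Ls: "length Ls = n" "length ss = n" using cyc by (simp_all add: cyclic_bundle_def)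
  have H: "hermitian_metric A n (direct_sum Ls) H" using harmonic by (simp add: harmonic_metric_def)
  have k: "Suc j mod n < n" using j by simp
  have hom: "twisted_hom A (Ls ! j) (Ls ! (Suc j mod n)) (ss ! j)"
    using cyc j by (simp add: cyclic_bundle_def)
  fix c assume c: "c \<in> A"
  show "0 \<le> energy_density H ss j c p" if "p \<in> cdom c" for p
    by (rule energy_density_nonneg(1)[OF H Ls(2) c that j])
  have cont_h: "continuous_on (coord c ` cdom c) (\<lambda>w. metric_entry H i c (chart_inv c w))" if "i < n" for i
    by (rule metric_entry_continuous[OF H that c])
  have "(\<lambda>w. (ss ! j) c (chart_inv c w)) holomorphic_on (coord c ` cdom c)"
    using hom c by (simp add: holomorphic_section_def holomorphic_in_def)
  then have cont_s: "continuous_on (coord c ` cdom c) (\<lambda>w. (ss ! j) c (chart_inv c w))"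
    by (rule holomorphic_on_imp_continuous_on)
  have "metric_entry H j c (chart_inv c w) \<noteq> 0" if "w \<in> coord c ` cdom c" for w
    using hermitian_metric_entry(2)[OF H c coord_chart_inv(2)[OF A c that] j] by simp
  then show "continuous_on (coord c ` cdom c) (\<lambda>w. energy_density H ss j c (chart_inv c w))"
    unfolding energy_density_def using cont_h[OF j] cont_h[OF k] cont_s Ls
    by (intro continuous_intros) auto
  fix d p assume d: "d \<in> A" and p: "p \<in> cdom c" "p \<in> cdom d"
  have diag: "diagonal_mat (H c p)" using harmonic c p by (simp add: harmonic_metric_def)
  let ?L = "(Ls ! j) c d p" and ?M = "(Ls ! (Suc j mod n)) c d p" and ?K = "canonical_lb c d p"
  have "(ss ! j) c p = hom_lb (Ls ! j) (tensor_lb (Ls ! (Suc j mod n)) canonical_lb) c d p * (ss ! j) d p"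
    using hom c d p unfolding holomorphic_section_def by blast
  then have s: "(ss ! j) c p = inverse ?L * ?M * ?K * (ss ! j) d p"
    by (simp add: hom_lb_def tensor_lb_def power_lb_def power_int_minus mult.assoc)
  note h = metric_entry_change[OF H Ls(1) j c d p diag] metric_entry_change[OF H Ls(1) k c d p diag]
  show "energy_density H ss j c p = cmod ?K ^ (2 * 1) * energy_density H ss j d p"
    unfolding energy_density_def Ls(2) h s
    by (simp add: norm_mult norm_inverse power_mult_distrib power_inverse mult_ac)
qed

text \<open>
  Where \<open>s\<^sub>j\<close> does not vanish, \<open>log \<bar>s\<^sub>j\<bar>\<^sup>2\<close> is harmonic, so \<open>\<partial>\<partial>\<^sup>* log a\<^sub>j\<close> is the difference of the equations
  for \<open>h\<^sub>j\<^sub>+\<^sub>1\<close> and \<open>h\<^sub>j\<close>.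
\<close>

lemma toda_solution_harmonic:
  assumes A: "holomorphic_atlas A" and cyc: "cyclic_bundle A n Ls ss"
    and harmonic: "harmonic_metric A n (direct_sum Ls) (cyclic_field ss) H"
  shows "toda_solution A n (energy_density H ss)"
  unfolding toda_solution_def
proof (intro conjI allI impI ballI)
  fix j assume "j < n"
  then show "weight_density A 1 (energy_density H ss j)"
    by (rule energy_density_weight[OF A cyc harmonic])
next
  fix j c p assume j: "j < n" and cp: "c \<in> A" "p \<in> cdom c" and pos: "0 < energy_density H ss j c p"
  let ?e = "\<lambda>i. energy_density H ss i c p" and ?k = "Suc j mod n"
  have ss: "length ss = n" using cyc by (simp add: cyclic_bundle_def)
  have H: "hermitian_metric A n (direct_sum Ls) H" using harmonic by (simp add: harmonic_metric_def)
  have k: "?k < n" using j by simp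
  have "(?k + n - 1) mod n = j" using Suc_mod_eq_iff[OF k j] by simp
  then have hk: "log_ddbar c (metric_entry H ?k) p (?e j - ?e ?k)"
    using metric_entry_log_ddbar[OF A harmonic ss cp k] by simp
  have hj: "log_ddbar c (\<lambda>c p. inverse (metric_entry H j c p)) p (- (?e ((j + n - 1) mod n) - ?e j))"
    by (rule log_ddbar_inverse[OF metric_entry_log_ddbar[OF A harmonic ss cp j]])
  have "(ss ! j) c p \<noteq> 0" using energy_density_nonneg(2)[OF H ss cp j] pos by auto
  moreover have "holomorphic_in c ((ss ! j) c)"
    using cyc j cp by (simp add: cyclic_bundle_def holomorphic_section_def)
  ultimately have s: "log_ddbar c (\<lambda>c p. (cmod ((ss ! j) c p))\<^sup>2) p 0"
    by (rule holomorphic_log_ddbar[where s = "ss ! j", OF A cp, rotated])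
  have "log_ddbar c (energy_density H ss j) p (0 + (?e j - ?e ?k) + - (?e ((j + n - 1) mod n) - ?e j))"
    using log_ddbar_mult[OF log_ddbar_mult[OF s hk] hj] by (simp add: energy_density_def[abs_def] ss)
  then show "log_ddbar c (energy_density H ss j) p (2 * ?e j - ?e ((j + n - 1) mod n) - ?e ?k)"
    by (simp add: algebra_simps)
qed

text \<open>
  The metrics telescope around the cycle.
\<close>

lemma energy_density_prod:
  assumes H: "hermitian_metric A n E H" and cp: "c \<in> A" "p \<in> cdom c" and ss: "length ss = n" and n: "0 < n"
  shows "(\<Prod>j<n. energy_density H ss j c p) = (cmod (\<Prod>j<n. (ss ! j) c p))\<^sup>2"
proof -
  let ?h = "\<lambda>i. metric_entry H i c p"
  obtain m where m: "n = Suc m" using n by (cases n) auto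
  have "(\<Prod>j<n. ?h (Suc j mod n)) = (\<Prod>j<m. ?h (Suc j)) * ?h 0"
    unfolding m prod.lessThan_Suc by simp
  also have "\<dots> = (\<Prod>j<n. ?h j)" unfolding m prod.lessThan_Suc_shift by simp
  finally have h: "(\<Prod>j<n. ?h (Suc j mod n)) = (\<Prod>j<n. ?h j)" .
  have "0 < (\<Prod>j<n. ?h j)"
    using hermitian_metric_entry(2)[OF H cp] by (intro prod_pos) auto
  then have ne: "(\<Prod>j<n. ?h j) \<noteq> 0" by (rule less_imp_neq[symmetric])
  have inv: "(\<Prod>j<n. inverse (?h j)) = inverse (\<Prod>j<n. ?h j)"
    using prod_inversef[of ?h "{..<n}"] by (simp add: comp_def)
  have sq: "(\<Prod>j<n. (cmod ((ss ! j) c p))\<^sup>2) = (cmod (\<Prod>j<n. (ss ! j) c p))\<^sup>2"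
    by (simp add: prod_norm[symmetric] prod_power_distrib)
  show ?thesis
    unfolding energy_density_def ss prod.distrib h inv sq mult.assoc right_inverse[OF ne] by simp
qed

section \<open>The pullback metric of a cyclic bundle\<close>

lemma mat_trace_mult:
  assumes "M \<in> carrier_mat n n" "N \<in> carrier_mat n n"
  shows "mat_trace (M * N) = (\<Sum>i<n. \<Sum>j<n. M $$ (i, j) * N $$ (j, i))"
  using assms by (simp add: mat_trace_def scalar_prod_def lessThan_atLeast0)

text \<open>
  In the trace of the square of \<open>v \<phi> + v\<^sup>* \<phi>\<^sup>*\<close>, the two pure terms are conjugate to each other, and both
  mixed terms give the sum of the energy densities.
\<close>

lemma pullback_metric_cyclic:
  assumes H: "hermitian_metric A n E H" and cp: "c \<in> A" "p \<in> cdom c" and diag: "diagonal_mat (H c p)"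
    and ss: "length ss = n"
  shows "pullback_metric n H (cyclic_field ss) c p v v = 4 * real n *
    ((cmod v)\<^sup>2 * (\<Sum>j<n. energy_density H ss j c p)
      + Re (v\<^sup>2 * mat_trace (cyclic_field ss c p * cyclic_field ss c p)))"
proof -
  let ?\<phi> = "cyclic_field ss c p" and ?\<psi> = "higgs_adjoint H (cyclic_field ss) c p"
  let ?e = "\<lambda>j. energy_density H ss j c p"
  have \<phi>: "?\<phi> \<in> carrier_mat n n" by (rule cyclic_field_carrier[OF ss])
  note adj = higgs_adjoint_diagonal[where \<phi> = "cyclic_field ss", OF H cp diag \<phi>]
  have \<psi>: "?\<psi> \<in> carrier_mat n n" by (simp add: adj)
  have h: "metric_entry H i c p \<noteq> 0" if "i < n" for i
    using hermitian_metric_entry(2)[OF H cp that] by simp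
  define a b where "a = (\<lambda>i j. ?\<phi> $$ (i, j))" and "b = (\<lambda>i j. ?\<psi> $$ (i, j))"
  have bb: "b i j * b j i = cnj (a i j * a j i)" if "i < n" "j < n" for i j
    using h[OF that(1)] h[OF that(2)] that unfolding a_def b_def adj by (simp add: field_simps)
  have ab: "a i j * b j i = (if i = Suc j mod n then of_real (?e j) else 0)" if "i < n" "j < n" for i j
  proof -
    have "x * (cnj x * of_real r) = of_real ((cmod x)\<^sup>2 * r)" for x r
      by (simp add: mult.assoc[symmetric] complex_norm_square[symmetric] del: of_real_power)
    then show ?thesis
      using that ss unfolding a_def b_def adj
      by (auto simp: cyclic_field_index energy_density_def mult.assoc)
  qed
  define T where "T = (\<Sum>i<n. \<Sum>j<n. a i j * a j i)"
  have T: "mat_trace (?\<phi> * ?\<phi>) = T" unfolding T_def a_def by (rule mat_trace_mult[OF \<phi> \<phi>])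
  have "(\<Sum>i<n. \<Sum>j<n. b i j * b j i) = cnj T"
    unfolding T_def cnj_sum by (intro sum.cong refl) (simp add: bb)
  moreover have AB: "(\<Sum>i<n. \<Sum>j<n. a i j * b j i) = of_real (\<Sum>j<n. ?e j)"
  proof -
    have "(\<Sum>i<n. \<Sum>j<n. a i j * b j i) = (\<Sum>j<n. \<Sum>i<n. a i j * b j i)" by (rule sum.swap)
    also have "\<dots> = (\<Sum>j<n. \<Sum>i<n. if i = Suc j mod n then of_real (?e j) else 0)"
      by (intro sum.cong refl) (simp add: ab)
    also have "\<dots> = (\<Sum>j<n. of_real (?e j))" by (intro sum.cong refl) (simp add: sum.delta)
    finally show ?thesis by simp
  qed
  moreover have "(\<Sum>i<n. \<Sum>j<n. b i j * a j i) = of_real (\<Sum>j<n. ?e j)"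
    using AB by (subst sum.swap) (simp add: mult.commute)
  moreover have "mat_trace (higgs_eval H (cyclic_field ss) c p v * higgs_eval H (cyclic_field ss) c p v)
      = v\<^sup>2 * T + (cnj v)\<^sup>2 * (\<Sum>i<n. \<Sum>j<n. b i j * b j i)
        + v * cnj v * (\<Sum>i<n. \<Sum>j<n. a i j * b j i) + v * cnj v * (\<Sum>i<n. \<Sum>j<n. b i j * a j i)"
  proof -
    let ?M = "higgs_eval H (cyclic_field ss) c p v"
    have M: "?M \<in> carrier_mat n n" using \<phi> \<psi> by (simp add: higgs_eval_def)
    have "?M $$ (i, j) = v * a i j + cnj v * b i j" if "i < n" "j < n" for i j
      using \<phi> \<psi> that by (simp add: higgs_eval_def a_def b_def)
    then have "mat_trace (?M * ?M)
        = (\<Sum>i<n. \<Sum>j<n. (v * a i j + cnj v * b i j) * (v * a j i + cnj v * b j i))"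
      unfolding mat_trace_mult[OF M M] by simp
    also have "\<dots> = (\<Sum>i<n. \<Sum>j<n. v\<^sup>2 * (a i j * a j i) + (cnj v)\<^sup>2 * (b i j * b j i)
        + v * cnj v * (a i j * b j i) + v * cnj v * (b i j * a j i))"
      by (intro sum.cong refl) (simp add: power2_eq_square algebra_simps)
    finally show ?thesis by (simp add: sum.distrib sum_distrib_left T_def)
  qed
  ultimately have tr: "mat_trace (higgs_eval H (cyclic_field ss) c p v * higgs_eval H (cyclic_field ss) c p v)
      = v\<^sup>2 * T + cnj (v\<^sup>2 * T) + 2 * (v * cnj v * of_real (\<Sum>j<n. ?e j))"
    by simp
  have re: "Re (z + cnj z + 2 * (v * cnj v * of_real s)) = 2 * ((cmod v)\<^sup>2 * s + Re z)" for z s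
    unfolding complex_norm_square[symmetric] by simp
  show ?thesis
    unfolding pullback_metric_def T tr re by simp
qed

lemma det_mat_diag: "Determinant.det (mat_diag n d) = (\<Prod>i<n. d i)"
proof -
  have "Determinant.det (mat_diag n d) = prod_list (diag_mat (mat_diag n d))"
    by (rule det_upper_triangular) (auto simp: mat_diag_def)
  also have "diag_mat (mat_diag n d) = map d [0..<n]" by (auto simp: diag_mat_def mat_diag_def)
  finally show ?thesis by (simp add: prod.distinct_set_conv_list[symmetric] lessThan_atLeast0)
qed

text \<open>
  The first row has its only entry in the last column, and the remaining minor is diagonal.
\<close>

lemma det_cyclic_field:
  assumes ss: "length ss = Suc m"
  shows "Determinant.det (cyclic_field ss c p) = (-1) ^ m * (\<Prod>j<Suc m. (ss ! j) c p)"
proof -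
  let ?\<phi> = "cyclic_field ss c p"
  have \<phi>: "?\<phi> \<in> carrier_mat (Suc m) (Suc m)" by (rule cyclic_field_carrier[OF ss])
  have "Determinant.det ?\<phi> = (\<Sum>j<Suc m. ?\<phi> $$ (0, j) * cofactor ?\<phi> 0 j)"
    by (rule laplace_expansion_row[OF \<phi>]) simp
  also have "\<dots> = (\<Sum>j<Suc m. if j = m then (ss ! m) c p * cofactor ?\<phi> 0 m else 0)"
    by (intro sum.cong refl) (auto simp: cyclic_field_index ss)
  also have "\<dots> = (ss ! m) c p * cofactor ?\<phi> 0 m" by simp
  also have "mat_delete ?\<phi> 0 m = mat_diag m (\<lambda>j. (ss ! j) c p)"
    using ss by (auto simp: mat_delete_def mat_diag_def cyclic_field_def)
  then have "cofactor ?\<phi> 0 m = (-1) ^ m * (\<Prod>j<m. (ss ! j) c p)"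
    by (simp add: cofactor_def det_mat_diag)
  finally show ?thesis by (simp add: mult_ac)
qed

text \<open>
  Two steps along the cycle return to the starting point only when \<open>n = 2\<close>.
\<close>

lemma trace_square_cyclic:
  assumes ss: "length ss = n" and n: "2 \<le> n"
  shows "mat_trace (cyclic_field ss c p * cyclic_field ss c p) =
    (if n = 2 then 2 * ((ss ! 0) c p * (ss ! 1) c p) else 0)"
proof -
  let ?\<phi> = "cyclic_field ss c p"
  have \<phi>: "?\<phi> \<in> carrier_mat n n" by (rule cyclic_field_carrier[OF ss])
  have "mat_trace (?\<phi> * ?\<phi>) = (\<Sum>j<n. \<Sum>i<n. ?\<phi> $$ (i, j) * ?\<phi> $$ (j, i))"
    unfolding mat_trace_mult[OF \<phi> \<phi>] by (rule sum.swap)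
  also have "\<dots> = (\<Sum>j<n. \<Sum>i<n. if i = Suc j mod n then
      (if j = Suc i mod n then (ss ! j) c p * (ss ! i) c p else 0) else 0)"
    using ss by (intro sum.cong refl) (auto simp: cyclic_field_index)
  also have "\<dots> = (\<Sum>j<n. if j = Suc (Suc j mod n) mod n then
      (ss ! j) c p * (ss ! (Suc j mod n)) c p else 0)"
    using n by (intro sum.cong refl) (simp add: sum.delta)
  finally have T: "mat_trace (?\<phi> * ?\<phi>) = (\<Sum>j<n. if j = Suc (Suc j mod n) mod n then
      (ss ! j) c p * (ss ! (Suc j mod n)) c p else 0)" .
  show ?thesis
  proof (cases "n = 2")
    case True
    then show ?thesis unfolding T by (simp add: numeral_2_eq_2 mult.commute)
  next
    case False
    have "j \<noteq> Suc (Suc j mod n) mod n" if "j < n" for j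
    proof -
      have "Suc (Suc j mod n) mod n = (if Suc (Suc j) < n then Suc (Suc j) else Suc (Suc j) - n)"
        using that n False by (auto simp: mod_Suc_eq mod_if)
      then show ?thesis using that n False by auto
    qed
    then show ?thesis unfolding T using False by simp
  qed
qed

text \<open>
  The part of the pullback metric that involves \<open>tr \<phi>\<^sup>2\<close> is determined by the product of the components.
\<close>

lemma pullback_metric_less:
  assumes H: "hermitian_metric A n E H" "diagonal_mat (H c p)" "length ss = n"
    and H': "hermitian_metric A n E' H'" "diagonal_mat (H' c p)" "length ts = n"
    and cp: "c \<in> A" "p \<in> cdom c" and n: "2 \<le> n"
    and prod: "(\<Prod>j<n. (ss ! j) c p) = (\<Prod>j<n. (ts ! j) c p)"
    and less: "(\<Sum>j<n. energy_density H ss j c p) < (\<Sum>j<n. energy_density H' ts j c p)"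
    and v: "v \<noteq> 0"
  shows "0 < pullback_metric n H' (cyclic_field ts) c p v v - pullback_metric n H (cyclic_field ss) c p v v"
proof -
  have "mat_trace (cyclic_field ss c p * cyclic_field ss c p) = mat_trace (cyclic_field ts c p * cyclic_field ts c p)"
  proof (cases "n = 2")
    case True
    have "(ss ! 0) c p * (ss ! 1) c p = (ts ! 0) c p * (ts ! 1) c p"
      using prod unfolding True by (simp add: numeral_2_eq_2)
    then show ?thesis unfolding trace_square_cyclic[OF H(3) n] trace_square_cyclic[OF H'(3) n] by simp
  next
    case False
    then show ?thesis unfolding trace_square_cyclic[OF H(3) n] trace_square_cyclic[OF H'(3) n] by simp
  qed
  moreover have "(cmod v)\<^sup>2 * (\<Sum>j<n. energy_density H ss j c p) < (cmod v)\<^sup>2 * (\<Sum>j<n. energy_density H' ts j c p)"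
    using less v by simp
  ultimately show ?thesis
    unfolding pullback_metric_cyclic[OF H(1) cp H(2,3)] pullback_metric_cyclic[OF H'(1) cp H'(2,3)]
    using n by simp
qed

section \<open>Line bundles and the cyclic structure of the Hitchin component\<close>

lemma line_bundle_trivial: "line_bundle A trivial_lb"
  by (simp add: line_bundle_def trivial_lb_def)

lemma line_bundle_power:
  assumes A: "holomorphic_atlas A" and L: "line_bundle A L"
  shows "line_bundle A (power_lb L m)"
  unfolding line_bundle_def
proof (intro conjI ballI)
  fix c d assume cd: "c \<in> A" "d \<in> A"
  have "L c d (chart_inv c w) \<noteq> 0" if w: "w \<in> coord c ` (cdom c \<inter> cdom d)" for w
  proof -
    have "chart_inv c w \<in> cdom c \<inter> cdom d"
      using w chart_inv_coord[OF A cd(1)] by auto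
    then show ?thesis using line_bundle_nonzero[OF L cd] by blast
  qed
  moreover have "(\<lambda>w. L c d (chart_inv c w)) holomorphic_on (coord c ` (cdom c \<inter> cdom d))"
    using L cd unfolding line_bundle_def by blast
  ultimately show "(\<lambda>w. power_lb L m c d (chart_inv c w)) holomorphic_on (coord c ` (cdom c \<inter> cdom d))"
    unfolding power_lb_def by (intro holomorphic_on_power_int) auto
next
  fix c p assume "c \<in> A" "p \<in> cdom c"
  then have "L c c p = 1" using L unfolding line_bundle_def by blast
  then show "power_lb L m c c p = 1" by (simp add: power_lb_def)
next
  fix c d e p assume "c \<in> A" "d \<in> A" "e \<in> A" "p \<in> cdom c \<inter> cdom d \<inter> cdom e"
  then have "L c e p = L c d p * L d e p" using L unfolding line_bundle_def by blast
  then show "power_lb L m c e p = power_lb L m c d p * power_lb L m d e p"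
    by (simp add: power_lb_def power_int_mult_distrib)
qed

lemma line_bundle_canonical:
  assumes A: "holomorphic_atlas A"
  shows "line_bundle A canonical_lb"
  unfolding line_bundle_def
proof (intro conjI ballI)
  fix c d assume cd: "c \<in> A" "d \<in> A"
  let ?S = "coord c ` (cdom c \<inter> cdom d)" and ?f = "\<lambda>w. coord d (chart_inv c w)"
  have "?f holomorphic_on ?S" using A cd unfolding holomorphic_atlas_def by blast
  then have "deriv ?f holomorphic_on ?S"
    by (rule holomorphic_deriv[OF _ open_chart_overlap[OF A cd(1) chart_open(1)[OF A cd(2)]]])
  moreover have "deriv ?f w = canonical_lb c d (chart_inv c w)" if "w \<in> ?S" for w
    using that coord_chart_inv(1)[OF A cd(1), of w] by (auto simp: canonical_lb_def)
  ultimately show "(\<lambda>w. canonical_lb c d (chart_inv c w)) holomorphic_on ?S"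
    by (rule holomorphic_transform)
next
  fix c p assume "c \<in> A" "p \<in> cdom c"
  then show "canonical_lb c c p = 1" by (rule canonical_lb_refl[OF A])
next
  fix c d e p assume "c \<in> A" "d \<in> A" "e \<in> A" "p \<in> cdom c \<inter> cdom d \<inter> cdom e"
  then show "canonical_lb c e p = canonical_lb c d p * canonical_lb d e p"
    using canonical_lb_cocycle[OF A] by blast
qed

lemma holomorphic_section_change:
  assumes "holomorphic_section A L s" "c \<in> A" "d \<in> A" "p \<in> cdom c" "p \<in> cdom d"
  shows "s c p = L c d p * s d p"
  using assms unfolding holomorphic_section_def by blast

lemma holomorphic_section_in: "holomorphic_section A L s \<Longrightarrow> c \<in> A \<Longrightarrow> holomorphic_in c (s c)"
  unfolding holomorphic_section_def by blast

lemma holomorphic_sectionI: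
  assumes "\<And>c. c \<in> A \<Longrightarrow> holomorphic_in c (s c)"
    and "\<And>c d p. c \<in> A \<Longrightarrow> d \<in> A \<Longrightarrow> p \<in> cdom c \<Longrightarrow> p \<in> cdom d \<Longrightarrow> s c p = L c d p * s d p"
  shows "holomorphic_section A L s"
  using assms unfolding holomorphic_section_def by blast

lemma holomorphic_in_const: "holomorphic_in c (\<lambda>p. z)"
  by (simp add: holomorphic_in_def)

lemma holomorphic_in_mult:
  "holomorphic_in c f \<Longrightarrow> holomorphic_in c g \<Longrightarrow> holomorphic_in c (\<lambda>p. f p * g p)"
  unfolding holomorphic_in_def by (rule holomorphic_on_mult)

lemma holomorphic_in_power_int:
  assumes A: "holomorphic_atlas A" "c \<in> A" and f: "holomorphic_in c f" and nz: "\<And>p. p \<in> cdom c \<Longrightarrow> f p \<noteq> 0"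
  shows "holomorphic_in c (\<lambda>p. f p powi k)"
  using f nz[OF coord_chart_inv(2)[OF A]] unfolding holomorphic_in_def
  by (intro holomorphic_on_power_int) auto

lemma holomorphic_in_divide:
  assumes A: "holomorphic_atlas A" "c \<in> A" and "holomorphic_in c f" "holomorphic_in c g"
    and nz: "\<And>p. p \<in> cdom c \<Longrightarrow> g p \<noteq> 0"
  shows "holomorphic_in c (\<lambda>p. f p / g p)"
  using assms(3,4) nz[OF coord_chart_inv(2)[OF A]] unfolding holomorphic_in_def
  by (intro holomorphic_on_divide) auto

lemma power_lb_one: "power_lb L 1 = L"
  by (simp add: power_lb_def fun_eq_iff)

lemma dual_dual_lb: "dual_lb (dual_lb L) = L"
  by (simp add: power_lb_def fun_eq_iff power_int_minus)

lemma hitchin_bundle_even_section: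
  assumes A: "holomorphic_atlas A" and S: "sqrt_canonical A S \<tau>"
  shows "twisted_hom A (power_lb S k) (power_lb S (k - 2)) \<tau>"
proof (rule holomorphic_sectionI)
  have \<tau>: "holomorphic_section A (hom_lb (tensor_lb S S) canonical_lb) \<tau>" and L: "line_bundle A S"
    using S by (simp_all add: sqrt_canonical_def)
  show "holomorphic_in c (\<tau> c)" if "c \<in> A" for c by (rule holomorphic_section_in[OF \<tau> that])
  fix c d p assume cd: "c \<in> A" "d \<in> A" "p \<in> cdom c" "p \<in> cdom d"
  have nz: "S c d p \<noteq> 0" by (rule line_bundle_nonzero[OF L cd])
  show "\<tau> c p = hom_lb (power_lb S k) (tensor_lb (power_lb S (k - 2)) canonical_lb) c d p * \<tau> d p"
    unfolding holomorphic_section_change[OF \<tau> cd] using nz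
    by (simp add: hom_lb_def tensor_lb_def power_lb_def power_int_diff power_int_minus power2_eq_square field_simps)
qed

lemma power_int_transition:
  fixes s k t u :: "'a :: field"
  assumes "s \<noteq> 0" "k \<noteq> 0"
  shows "k powi m * u * (inverse (s * s) * k * t) powi (1 - m) =
    inverse (s powi (1 - m)) * (s powi (m - 1) * k) * (u * t powi (1 - m))"
proof -
  have s1: "s powi (1 - m) = inverse (s powi (m - 1))"
    using power_int_minus[of s "m - 1"] by simp
  have k1: "k powi m * k powi (1 - m) = k"
    using power_int_add[of k m "1 - m"] assms by simp
  have "(inverse (s * s) * k * t) powi (1 - m)
      = (s powi (m - 1) * s powi (m - 1)) * k powi (1 - m) * t powi (1 - m)"
    unfolding power_int_mult_distrib power_int_inverse s1 by simp
  then have "k powi m * u * (inverse (s * s) * k * t) powi (1 - m)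
      = (k powi m * k powi (1 - m)) * (s powi (m - 1) * s powi (m - 1)) * (u * t powi (1 - m))"
    by (simp only: mult_ac)
  then show ?thesis unfolding k1 s1 by (simp only: inverse_inverse_eq mult_ac)
qed

text \<open>
  The section \<open>q \<tau>\<^sup>1\<^sup>-\<^sup>n\<close> takes values in \<open>S\<^sup>2\<^sup>n\<^sup>-\<^sup>2 K\<close> because \<open>\<tau>\<close> is a section of \<open>S\<^sup>-\<^sup>2 K\<close>.
\<close>

lemma hitchin_bundle_even_last_section:
  assumes A: "holomorphic_atlas A" and S: "sqrt_canonical A S \<tau>" and q: "holomorphic_differential A n q"
  shows "twisted_hom A (power_lb S (1 - int n)) (power_lb S (int n - 1)) (\<lambda>c p. q c p * \<tau> c p powi (1 - int n))"
proof (rule holomorphic_sectionI)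
  have \<tau>: "holomorphic_section A (hom_lb (tensor_lb S S) canonical_lb) \<tau>" and L: "line_bundle A S"
    and \<tau>_nz: "\<And>c p. c \<in> A \<Longrightarrow> p \<in> cdom c \<Longrightarrow> \<tau> c p \<noteq> 0"
    using S by (simp_all add: sqrt_canonical_def)
  have q: "holomorphic_section A (power_lb canonical_lb (int n)) q"
    using q by (simp add: holomorphic_differential_def)
  show "holomorphic_in c (\<lambda>p. q c p * \<tau> c p powi (1 - int n))" if c: "c \<in> A" for c
    by (intro holomorphic_in_mult holomorphic_in_power_int[OF A c] holomorphic_section_in[OF q c]
        holomorphic_section_in[OF \<tau> c] \<tau>_nz[OF c])
  fix c d p assume cd: "c \<in> A" "d \<in> A" "p \<in> cdom c" "p \<in> cdom d"
  let ?S = "S c d p" and ?K = "canonical_lb c d p"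
  have nz: "?S \<noteq> 0" "?K \<noteq> 0"
    by (rule line_bundle_nonzero[OF L cd] line_bundle_nonzero[OF line_bundle_canonical[OF A] cd])+
  show "q c p * \<tau> c p powi (1 - int n) =
    hom_lb (power_lb S (1 - int n)) (tensor_lb (power_lb S (int n - 1)) canonical_lb) c d p
      * (q d p * \<tau> d p powi (1 - int n))"
    unfolding holomorphic_section_change[OF \<tau> cd] holomorphic_section_change[OF q cd]
      hom_lb_def tensor_lb_def power_lb_def power_int_minus1_right
    by (rule power_int_transition[OF nz])
qed

text \<open>
  The only component of the Hitchin field that may vanish is the last one.
\<close>

lemma hitchin_bundle_is_cyclic:
  assumes A: "holomorphic_atlas A" and n: "n \<in> {2, 3, 4}" and q: "holomorphic_differential A n q"
    and hit: "hitchin_bundle A n q E \<phi>"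
  obtains Ls ss where "E = direct_sum Ls" "\<phi> = cyclic_field ss" "cyclic_bundle A n Ls ss"
    and "\<And>j c p. j < n - 1 \<Longrightarrow> c \<in> A \<Longrightarrow> p \<in> cdom c \<Longrightarrow> (ss ! j) c p \<noteq> 0"
    and "\<And>c p. c \<in> A \<Longrightarrow> p \<in> cdom c \<Longrightarrow> (\<Prod>j<n. (ss ! j) c p) = q c p"
proof (cases "odd n")
  case True
  then have n3: "n = 3" using n by auto
  let ?K = "power_lb canonical_lb :: int \<Rightarrow> 'a lbundle"
  let ?Ls = "[?K 1, ?K 0, ?K (-1)]" and ?ss = "[\<lambda>c p. 1, \<lambda>c p. 1, q]"
  note K = line_bundle_canonical[OF A]
  have nz: "canonical_lb c d p \<noteq> 0" if "c \<in> A" "d \<in> A" "p \<in> cdom c" "p \<in> cdom d" for c d p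
    by (rule line_bundle_nonzero[OF K that])
  have q': "holomorphic_section A (?K 3) q" using q n3 by (simp add: holomorphic_differential_def)
  have "twisted_hom A (?K 1) (?K 0) (\<lambda>c p. 1)"
    by (rule holomorphic_sectionI[OF holomorphic_in_const])
      (simp add: hom_lb_def tensor_lb_def power_lb_def power_int_minus nz)
  moreover have "twisted_hom A (?K 0) (?K (-1)) (\<lambda>c p. 1)"
    by (rule holomorphic_sectionI[OF holomorphic_in_const])
      (simp add: hom_lb_def tensor_lb_def power_lb_def power_int_minus nz)
  moreover have "twisted_hom A (?K (-1)) (?K 1) q"
  proof (rule holomorphic_sectionI[OF holomorphic_section_in[OF q']])
    fix c d p assume cd: "c \<in> A" "d \<in> A" "p \<in> cdom c" "p \<in> cdom d"
    show "q c p = hom_lb (?K (-1)) (tensor_lb (?K 1) canonical_lb) c d p * q d p"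
      unfolding holomorphic_section_change[OF q' cd]
      by (simp add: hom_lb_def tensor_lb_def power_lb_def power_int_minus power3_eq_cube)
  qed
  moreover note line_bundle_power[OF A K, of 1] line_bundle_power[OF A K, of 0] line_bundle_power[OF A K, of "-1"]
  ultimately have "line_bundle A (?Ls ! i) \<and> twisted_hom A (?Ls ! i) (?Ls ! (Suc i mod 3)) (?ss ! i)"
    if "i < 3" for i
  proof -
    have "i = 0 \<or> i = 1 \<or> i = 2" using that by auto
    then show ?thesis using \<open>twisted_hom A (?K 1) (?K 0) (\<lambda>c p. 1)\<close>
      \<open>twisted_hom A (?K 0) (?K (-1)) (\<lambda>c p. 1)\<close> \<open>twisted_hom A (?K (-1)) (?K 1) q\<close>
      \<open>line_bundle A (?K 1)\<close> \<open>line_bundle A (?K 0)\<close> \<open>line_bundle A (?K (-1))\<close>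
      by (elim disjE) simp_all
  qed
  then have cyc: "cyclic_bundle A n ?Ls ?ss" by (simp add: cyclic_bundle_def n3)
  have upt: "[0..<3] = [0, 1, 2::nat]" by (simp add: upt_rec)
  have E: "E = direct_sum ?Ls" "\<phi> = cyclic_field ?ss"
    using hit True by (simp_all add: hitchin_bundle_def n3 upt numeral_2_eq_2)
  show thesis
  proof (rule that[OF E cyc])
    fix j c p assume "j < n - 1"
    then have "j = 0 \<or> j = 1" using n3 by auto
    then show "(?ss ! j) c p \<noteq> 0" by auto
  next
    show "(\<Prod>j<n. (?ss ! j) c p) = q c p" for c p
      by (simp add: n3 lessThan_atLeast0 atLeastLessThan_upt upt)
  qed
next
  case False
  then obtain S \<tau> where S: "sqrt_canonical A S \<tau>"
    and E: "E = direct_sum (map (\<lambda>i. power_lb S (int n - 1 - 2 * int i)) [0..<n])"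
    and \<phi>: "\<phi> = cyclic_field (replicate (n - 1) \<tau> @ [\<lambda>c p. q c p * \<tau> c p powi (1 - int n)])"
    using hit unfolding hitchin_bundle_def by auto
  let ?Ls = "map (\<lambda>i. power_lb S (int n - 1 - 2 * int i)) [0..<n]"
  let ?ss = "replicate (n - 1) \<tau> @ [\<lambda>c p. q c p * \<tau> c p powi (1 - int n)]"
  have n2: "2 \<le> n" using n by auto
  have \<tau>_nz: "\<tau> c p \<noteq> 0" if "c \<in> A" "p \<in> cdom c" for c p
    using S that by (simp add: sqrt_canonical_def)
  have last: "?ss ! (n - 1) = (\<lambda>c p. q c p * \<tau> c p powi (1 - int n))" and
    init: "\<And>j. j < n - 1 \<Longrightarrow> ?ss ! j = \<tau>" by (simp_all add: nth_append)
  have "twisted_hom A (?Ls ! i) (?Ls ! (Suc i mod n)) (?ss ! i)" if i: "i < n" for i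
  proof (cases "i = n - 1")
    case True
    have "?Ls ! i = power_lb S (1 - int n)" "?Ls ! (Suc i mod n) = power_lb S (int n - 1)"
      using True n2 by (simp_all add: of_nat_diff)
    then show ?thesis
      unfolding True last using hitchin_bundle_even_last_section[OF A S q] True by simp
  next
    case False
    then have "Suc i < n" using i by simp
    then have "?Ls ! i = power_lb S (int n - 1 - 2 * int i)"
      "?Ls ! (Suc i mod n) = power_lb S (int n - 1 - 2 * int i - 2)"
      by (simp_all add: algebra_simps)
    moreover have "?ss ! i = \<tau>" using init[of i] \<open>Suc i < n\<close> by simp
    ultimately show ?thesis using hitchin_bundle_even_section[OF A S] by metis
  qed
  moreover have "line_bundle A (?Ls ! i)" if "i < n" for i
    using line_bundle_power[OF A] S that by (simp add: sqrt_canonical_def)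
  ultimately have cyc: "cyclic_bundle A n ?Ls ?ss" using n2 by (simp add: cyclic_bundle_def)
  have prod: "(\<Prod>j<n. (?ss ! j) c p) = q c p" if cp: "c \<in> A" "p \<in> cdom c" for c p
  proof -
    have "n = Suc (n - 1)" using n2 by simp
    from prod.lessThan_Suc[of "\<lambda>j. (?ss ! j) c p" "n - 1", folded this]
    have "(\<Prod>j<n. (?ss ! j) c p) = (\<Prod>j<n - 1. (?ss ! j) c p) * (?ss ! (n - 1)) c p" .
    also have "(\<Prod>j<n - 1. (?ss ! j) c p) = \<tau> c p ^ (n - 1)"
      using init by simp
    also have "\<tau> c p ^ (n - 1) * (?ss ! (n - 1)) c p = q c p * (\<tau> c p powi (int (n - 1)) * \<tau> c p powi (1 - int n))"
      unfolding last by simp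
    also have "\<tau> c p powi (int (n - 1)) * \<tau> c p powi (1 - int n) = 1"
      using \<tau>_nz[OF cp] n2 by (simp add: power_int_add[symmetric] of_nat_diff del: power_int_of_nat)
    finally show ?thesis by simp
  qed
  show thesis
  proof (rule that[OF E \<phi> cyc _ prod])
    fix j c p assume "j < n - 1" "c \<in> A" "p \<in> cdom c"
    then show "(?ss ! j) c p \<noteq> 0" using \<tau>_nz unfolding init[OF \<open>j < n - 1\<close>] by blast
  qed
qed

section \<open>Isomorphisms onto the Hitchin component\<close>

text \<open>
  A bundle isomorphism that rotates the lines by \<open>r\<close> places and multiplies the \<open>j\<close>-th line by \<open>g j\<close>.
\<close>

lemma isomorphic_higgs_cyclicI:
  assumes n: "0 < n" and len: "length Ls = n" "length ss = n" "length Ms = n" "length ts = n"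
    and hol: "\<And>j c. j < n \<Longrightarrow> c \<in> A \<Longrightarrow> holomorphic_in c (g j c)"
    and nz: "\<And>j c p. j < n \<Longrightarrow> c \<in> A \<Longrightarrow> p \<in> cdom c \<Longrightarrow> g j c p \<noteq> 0"
    and lines: "\<And>j c d p. j < n \<Longrightarrow> c \<in> A \<Longrightarrow> d \<in> A \<Longrightarrow> p \<in> cdom c \<Longrightarrow> p \<in> cdom d \<Longrightarrow>
      g j c p * (Ls ! j) c d p = (Ms ! ((j + r) mod n)) c d p * g j d p"
    and field: "\<And>j c p. j < n \<Longrightarrow> c \<in> A \<Longrightarrow> p \<in> cdom c \<Longrightarrow>
      g (Suc j mod n) c p * (ss ! j) c p = (ts ! ((j + r) mod n)) c p * g j c p"
  shows "isomorphic_higgs A n (direct_sum Ls) (cyclic_field ss) (direct_sum Ms) (cyclic_field ts)"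
proof -
  define f where "f = (\<lambda>c p. Matrix.mat n n (\<lambda>(i, j). if i = (j + r) mod n then g j c p else 0))"
  have f: "f c p \<in> carrier_mat n n" for c p by (simp add: f_def)
  have diag: "direct_sum Ls c d p = mat_diag n (\<lambda>i. (Ls ! i) c d p)"
    "direct_sum Ms c d p = mat_diag n (\<lambda>i. (Ms ! i) c d p)" for c d p
    using len by (auto simp: direct_sum_def mat_diag_def)
  have shift: "(j + r) mod n = (k + r) mod n \<longleftrightarrow> j = k" if jk: "j < n" "k < n" for j k
  proof
    assume "(j + r) mod n = (k + r) mod n"
    then obtain a b where "j + r + n * a = k + r + n * b" unfolding nat_mod_eq_iff by blast
    then have "j + n * a = k + n * b" by linarith
    then have "(j + n * a) mod n = (k + n * b) mod n" by (rule arg_cong)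
    then show "j = k" using jk by simp
  qed simp
  have "holomorphic_mat_in c n n (f c)" if "c \<in> A" for c
    unfolding holomorphic_mat_in_def
  proof (intro conjI ballI allI impI)
    show "f c p \<in> carrier_mat n n" for p by (rule f)
    fix i j assume "i < n" "j < n"
    then show "holomorphic_in c (\<lambda>p. f c p $$ (i, j))"
      using hol[OF \<open>j < n\<close> that] by (cases "i = (j + r) mod n") (simp_all add: f_def holomorphic_in_def)
  qed
  moreover have "Determinant.det (f c p) \<noteq> 0" if cp: "c \<in> A" "p \<in> cdom c" for c p
  proof
    define f' where "f' = Matrix.mat n n (\<lambda>(j, i). if i = (j + r) mod n then inverse (g j c p) else 0)"
    have f': "f' \<in> carrier_mat n n" by (simp add: f'_def)
    have "f' * f c p = 1\<^sub>m n"
    proof (rule eq_matI)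
      fix j k assume "j < dim_row (1\<^sub>m n)" "k < dim_col (1\<^sub>m n)"
      then have jk: "j < n" "k < n" by simp_all
      have "(f' * f c p) $$ (j, k) = (\<Sum>i<n. f' $$ (j, i) * f c p $$ (i, k))"
        by (rule mult_mat_index[OF f' f jk])
      also have "\<dots> = (\<Sum>i<n. if i = (j + r) mod n then (if j = k then 1 else 0) else 0)"
        using jk shift[OF jk] nz[OF jk(1) cp] by (intro sum.cong refl) (auto simp: f_def f'_def)
      also have "\<dots> = 1\<^sub>m n $$ (j, k)" using jk n by simp
      finally show "(f' * f c p) $$ (j, k) = 1\<^sub>m n $$ (j, k)" .
    qed (simp_all add: f_def f'_def)
    moreover assume "Determinant.det (f c p) = 0"
    ultimately show False using det_mult[OF f' f[of c p]] by simp
  qed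
  moreover have "f c p * direct_sum Ls c d p = direct_sum Ms c d p * f d p"
    if "c \<in> A" "d \<in> A" "p \<in> cdom c \<inter> cdom d" for c d p
    unfolding diag mat_diag_mult_right[OF f] mat_diag_mult_left[OF f]
    using that lines by (intro cong_mat refl) (auto simp: f_def)
  moreover have "f c p * cyclic_field ss c p = cyclic_field ts c p * f c p"
    if cp: "c \<in> A" "p \<in> cdom c" for c p
  proof (rule eq_matI)
    let ?s = "cyclic_field ss c p" and ?t = "cyclic_field ts c p"
    have st: "?s \<in> carrier_mat n n" "?t \<in> carrier_mat n n"
      by (rule cyclic_field_carrier[OF len(2)] cyclic_field_carrier[OF len(4)])+
    show "dim_row (f c p * ?s) = dim_row (?t * f c p)" "dim_col (f c p * ?s) = dim_col (?t * f c p)"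
      using st f[of c p] by auto
    fix i k assume "i < dim_row (?t * f c p)" "k < dim_col (?t * f c p)"
    then have ik: "i < n" "k < n" using st f[of c p] by auto
    have mod: "(Suc k mod n + r) mod n = Suc ((k + r) mod n) mod n"
      by (simp add: mod_simps)
    have "(f c p * ?s) $$ (i, k) = (\<Sum>j<n. f c p $$ (i, j) * ?s $$ (j, k))"
      by (rule mult_mat_index[OF f st(1) ik])
    also have "\<dots> = (\<Sum>j<n. if j = Suc k mod n then
        (if i = (Suc k mod n + r) mod n then g (Suc k mod n) c p * (ss ! k) c p else 0) else 0)"
      using ik len by (intro sum.cong refl) (auto simp: f_def cyclic_field_index)
    also have "\<dots> = (if i = Suc ((k + r) mod n) mod n then (ts ! ((k + r) mod n)) c p * g k c p else 0)"
      using n field[OF ik(2) cp] unfolding mod by simp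
    also have "\<dots> = (\<Sum>j<n. if j = (k + r) mod n then
        (if i = Suc ((k + r) mod n) mod n then (ts ! ((k + r) mod n)) c p * g k c p else 0) else 0)"
      using n by simp
    also have "\<dots> = (\<Sum>j<n. ?t $$ (i, j) * f c p $$ (j, k))"
      using ik len by (intro sum.cong refl) (auto simp: f_def cyclic_field_index)
    also have "\<dots> = (?t * f c p) $$ (i, k)"
      by (rule mult_mat_index[OF st(2) f ik, symmetric])
    finally show "(f c p * ?s) $$ (i, k) = (?t * f c p) $$ (i, k)" .
  qed
  ultimately show ?thesis unfolding isomorphic_higgs_def by blast
qed

lemma sqrt_canonicalI:
  assumes "line_bundle A S" and "twisted_hom A S (dual_lb S) \<tau>"
    and "\<And>c p. c \<in> A \<Longrightarrow> p \<in> cdom c \<Longrightarrow> \<tau> c p \<noteq> 0"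
  shows "sqrt_canonical A S \<tau>"
proof -
  have "hom_lb S (tensor_lb (dual_lb S) canonical_lb) = hom_lb (tensor_lb S S) canonical_lb"
    by (simp add: fun_eq_iff hom_lb_def tensor_lb_def power_lb_def power_int_minus)
  then show ?thesis using assms by (simp add: sqrt_canonical_def)
qed

lemma hitchin_bundle2I:
  assumes "sqrt_canonical A S \<tau>"
  shows "hitchin_bundle A 2 q (direct_sum [S, dual_lb S]) (cyclic_field [\<tau>, \<lambda>c p. q c p * \<tau> c p powi (- 1)])"
proof -
  have "[0..<2] = [0, 1::nat]" by (simp add: upt_rec)
  then show ?thesis
    using assms unfolding hitchin_bundle_def by (auto intro!: exI[of _ S] exI[of _ \<tau>] simp: power_lb_one)
qed

lemma hitchin_bundle3I:
  fixes A :: "'a::topological_space chart set"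
  shows "hitchin_bundle A 3 q (direct_sum [canonical_lb, power_lb canonical_lb 0, dual_lb canonical_lb])
     (cyclic_field [\<lambda>c p. 1, \<lambda>c p. 1, q])"
proof -
  have "[0..<3] = [0, 1, 2::nat]" by (simp add: upt_rec)
  moreover have "replicate (3 - 1) x = [x, x]" for x :: "'a section_of" by (simp add: numeral_2_eq_2)
  ultimately show ?thesis by (simp add: hitchin_bundle_def power_lb_one)
qed

lemma hitchin_bundle4I:
  assumes "sqrt_canonical A S \<tau>"
  shows "hitchin_bundle A 4 q (direct_sum [power_lb S 3, S, dual_lb S, power_lb S (- 3)])
    (cyclic_field [\<tau>, \<tau>, \<tau>, \<lambda>c p. q c p * \<tau> c p powi (- 3)])"
proof -
  have "[0..<4] = [0, 1, 2, 3::nat]" by (simp add: upt_rec)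
  then show ?thesis
    using assms unfolding hitchin_bundle_def
    by (auto intro!: exI[of _ S] exI[of _ \<tau>] simp: power_lb_one numeral_3_eq_3)
qed

text \<open>
  A component without zeros makes its source a square root of \<open>K\<close>. If this component is \<open>\<nu>\<close>, the
  isomorphism exchanges the two lines.
\<close>

lemma isomorphic_hitchin2:
  assumes A: "holomorphic_atlas A" and L: "line_bundle A L"
    and \<mu>: "twisted_hom A L (dual_lb L) \<mu>" and \<nu>: "twisted_hom A (dual_lb L) L \<nu>"
    and q: "\<And>c p. c \<in> A \<Longrightarrow> p \<in> cdom c \<Longrightarrow> \<mu> c p * \<nu> c p = q c p"
    and nz: "(\<forall>c\<in>A. \<forall>p\<in>cdom c. \<mu> c p \<noteq> 0) \<or> (\<forall>c\<in>A. \<forall>p\<in>cdom c. \<nu> c p \<noteq> 0)"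
  shows "\<exists>F \<psi>. hitchin_bundle A 2 q F \<psi> \<and>
    isomorphic_higgs A 2 (direct_sum [L, dual_lb L]) (cyclic_field [\<mu>, \<nu>]) F \<psi>"
  using nz
proof
  have two: "j = 0 \<or> j = 1" if "j < 2" for j :: nat using that by auto
  {
    assume nz: "\<forall>c\<in>A. \<forall>p\<in>cdom c. \<mu> c p \<noteq> 0"
    have "sqrt_canonical A L \<mu>" using nz by (intro sqrt_canonicalI L \<mu>) blast
    moreover have "isomorphic_higgs A 2 (direct_sum [L, dual_lb L]) (cyclic_field [\<mu>, \<nu>])
      (direct_sum [L, dual_lb L]) (cyclic_field [\<mu>, \<lambda>c p. q c p * \<mu> c p powi (- 1)])"
    proof (rule isomorphic_higgs_cyclicI[where g = "\<lambda>j c p. 1" and r = 0])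
      fix j c p assume j: "j < (2::nat)" and cp: "c \<in> A" "p \<in> cdom c"
      show "1 * ([\<mu>, \<nu>] ! j) c p =
          ([\<mu>, \<lambda>c p. q c p * \<mu> c p powi (- 1)] ! ((j + 0) mod 2)) c p * 1"
        using two[OF j] q[OF cp, symmetric] nz cp by (auto simp: power_int_minus field_simps)
    qed (auto simp: holomorphic_in_const)
    ultimately show ?thesis using hitchin_bundle2I by blast
  next
    assume nz: "\<forall>c\<in>A. \<forall>p\<in>cdom c. \<nu> c p \<noteq> 0"
    have "sqrt_canonical A (dual_lb L) \<nu>"
      using nz \<nu> by (intro sqrt_canonicalI line_bundle_power A L) (simp_all add: dual_dual_lb)
    moreover have "isomorphic_higgs A 2 (direct_sum [L, dual_lb L]) (cyclic_field [\<mu>, \<nu>])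
      (direct_sum [dual_lb L, dual_lb (dual_lb L)]) (cyclic_field [\<nu>, \<lambda>c p. q c p * \<nu> c p powi (- 1)])"
    proof (rule isomorphic_higgs_cyclicI[where g = "\<lambda>j c p. 1" and r = 1])
      fix j c p assume j: "j < (2::nat)" and cp: "c \<in> A" "p \<in> cdom c"
      show "1 * ([\<mu>, \<nu>] ! j) c p =
          ([\<nu>, \<lambda>c p. q c p * \<nu> c p powi (- 1)] ! ((j + 1) mod 2)) c p * 1"
        using two[OF j] q[OF cp, symmetric] nz cp by (auto simp: power_int_minus field_simps)
    next
      fix j c d p assume "j < (2::nat)"
      then show "1 * ([L, dual_lb L] ! j) c d p = ([dual_lb L, dual_lb (dual_lb L)] ! ((j + 1) mod 2)) c d p * 1"
        using two[of j] by (auto simp: dual_dual_lb)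
    qed (auto simp: holomorphic_in_const)
    ultimately show ?thesis using hitchin_bundle2I by blast
  }
qed

text \<open>
  A section \<open>\<mu>\<close> without zeros identifies \<open>L\<close> with \<open>K\<close>, and rescaling the outer lines by
  \<open>\<mu>\<close> and \<open>1 / \<mu>\<close> turns both components \<open>\<mu>\<close> into \<open>1\<close>.
\<close>

lemma isomorphic_hitchin3:
  assumes A: "holomorphic_atlas A" and L: "line_bundle A L"
    and \<mu>: "twisted_hom A L trivial_lb \<mu>"
    and q: "\<And>c p. c \<in> A \<Longrightarrow> p \<in> cdom c \<Longrightarrow> \<mu> c p * \<mu> c p * \<nu> c p = q c p"
    and nz: "\<And>c p. c \<in> A \<Longrightarrow> p \<in> cdom c \<Longrightarrow> \<mu> c p \<noteq> 0"
  shows "\<exists>F \<psi>. hitchin_bundle A 3 q F \<psi> \<and>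
    isomorphic_higgs A 3 (direct_sum [L, trivial_lb, dual_lb L]) (cyclic_field [\<mu>, \<mu>, \<nu>]) F \<psi>"
proof -
  have three: "j = 0 \<or> j = 1 \<or> j = 2" if "j < 3" for j :: nat using that by auto
  let ?g = "\<lambda>j. [\<mu>, \<lambda>c p. 1, \<lambda>c p. 1 / \<mu> c p] ! j"
  have "isomorphic_higgs A 3 (direct_sum [L, trivial_lb, dual_lb L]) (cyclic_field [\<mu>, \<mu>, \<nu>])
    (direct_sum [canonical_lb, power_lb canonical_lb 0, dual_lb canonical_lb])
    (cyclic_field [\<lambda>c p. 1, \<lambda>c p. 1, q])"
  proof (rule isomorphic_higgs_cyclicI[where g = ?g and r = 0])
    fix j c assume j: "j < (3::nat)" and c: "c \<in> A"
    have "holomorphic_in c (\<mu> c)" by (rule holomorphic_section_in[OF \<mu> c])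
    moreover from this have "holomorphic_in c (\<lambda>p. 1 / \<mu> c p)"
      by (intro holomorphic_in_divide[OF A c] holomorphic_in_const nz[OF c])
    ultimately show "holomorphic_in c (?g j c)"
      using three[OF j] by (auto simp: holomorphic_in_const)
    fix p assume p: "p \<in> cdom c"
    show "?g j c p \<noteq> 0" using three[OF j] nz[OF c p] by auto
    show "?g (Suc j mod 3) c p * ([\<mu>, \<mu>, \<nu>] ! j) c p = ([\<lambda>c p. 1, \<lambda>c p. 1, q] ! ((j + 0) mod 3)) c p * ?g j c p"
      using three[OF j] nz[OF c p] q[OF c p, symmetric] by (auto simp: field_simps)
    fix d assume d: "d \<in> A" "p \<in> cdom d"
    have \<mu>_cd: "\<mu> c p = inverse (L c d p) * canonical_lb c d p * \<mu> d p"
      using holomorphic_section_change[OF \<mu> c d(1) p d(2)]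
      by (simp add: hom_lb_def tensor_lb_def power_lb_def trivial_lb_def power_int_minus)
    have "L c d p \<noteq> 0" "canonical_lb c d p \<noteq> 0"
      by (rule line_bundle_nonzero[OF L c d(1) p d(2)]
          line_bundle_nonzero[OF line_bundle_canonical[OF A] c d(1) p d(2)])+
    then show "?g j c p * ([L, trivial_lb, dual_lb L] ! j) c d p =
        ([canonical_lb, power_lb canonical_lb 0, dual_lb canonical_lb] ! ((j + 0) mod 3)) c d p * ?g j d p"
      using three[OF j] nz[OF d]
      by (auto simp: \<mu>_cd trivial_lb_def power_lb_def power_int_minus field_simps)
  qed auto
  then show ?thesis using hitchin_bundle3I by blast
qed

text \<open>
  If \<open>\<mu>\<close> has no zeros, \<open>L2\<close> is a square root \<open>S\<close> of \<open>K\<close> and \<open>\<gamma> / \<mu>\<close> identifies \<open>L1\<close> with \<open>S\<^sup>3\<close>. If \<open>\<nu>\<close> has no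
  zeros, the dual of \<open>L1\<close> plays the role of \<open>S\<close>, after a rotation by two places.
\<close>

lemma isomorphic_hitchin4:
  assumes A: "holomorphic_atlas A" and L: "line_bundle A L1" "line_bundle A L2"
    and \<gamma>: "twisted_hom A L1 L2 \<gamma>"
    and \<mu>: "twisted_hom A L2 (dual_lb L2) \<mu>" and \<nu>: "twisted_hom A (dual_lb L1) L1 \<nu>"
    and q: "\<And>c p. c \<in> A \<Longrightarrow> p \<in> cdom c \<Longrightarrow> \<gamma> c p * \<mu> c p * \<gamma> c p * \<nu> c p = q c p"
    and nz: "\<And>c p. c \<in> A \<Longrightarrow> p \<in> cdom c \<Longrightarrow> \<gamma> c p \<noteq> 0"
    and nz2: "(\<forall>c\<in>A. \<forall>p\<in>cdom c. \<mu> c p \<noteq> 0) \<or> (\<forall>c\<in>A. \<forall>p\<in>cdom c. \<nu> c p \<noteq> 0)"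
  shows "\<exists>F \<psi>. hitchin_bundle A 4 q F \<psi> \<and>
    isomorphic_higgs A 4 (direct_sum [L1, L2, dual_lb L2, dual_lb L1]) (cyclic_field [\<gamma>, \<mu>, \<gamma>, \<nu>]) F \<psi>"
  using nz2
proof
  let ?Ls = "[L1, L2, dual_lb L2, dual_lb L1]" and ?ss = "[\<gamma>, \<mu>, \<gamma>, \<nu>]"
  have four: "j = 0 \<or> j = 1 \<or> j = 2 \<or> j = 3" if "j < 4" for j :: nat using that by auto
  have \<gamma>_in: "holomorphic_in c (\<gamma> c)" "holomorphic_in c (\<mu> c)" "holomorphic_in c (\<nu> c)" if "c \<in> A" for c
    using holomorphic_section_in[OF _ that] \<gamma> \<mu> \<nu> by blast+
  have change: "\<gamma> c p = inverse (L1 c d p) * L2 c d p * canonical_lb c d p * \<gamma> d p"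
    "\<mu> c p = inverse (L2 c d p) * inverse (L2 c d p) * canonical_lb c d p * \<mu> d p"
    "\<nu> c p = L1 c d p * L1 c d p * canonical_lb c d p * \<nu> d p"
    "L1 c d p \<noteq> 0" "L2 c d p \<noteq> 0" "canonical_lb c d p \<noteq> 0"
    if cd: "c \<in> A" "d \<in> A" "p \<in> cdom c" "p \<in> cdom d" for c d p
    using holomorphic_section_change[OF \<gamma> cd] holomorphic_section_change[OF \<mu> cd]
      holomorphic_section_change[OF \<nu> cd] line_bundle_nonzero[OF L(1) cd] line_bundle_nonzero[OF L(2) cd]
      line_bundle_nonzero[OF line_bundle_canonical[OF A] cd]
    by (simp_all add: hom_lb_def tensor_lb_def power_lb_def power_int_minus mult.assoc)
  {
    assume nz2: "\<forall>c\<in>A. \<forall>p\<in>cdom c. \<mu> c p \<noteq> 0"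
    let ?g = "\<lambda>j. [\<lambda>c p. \<gamma> c p / \<mu> c p, \<lambda>c p. 1, \<lambda>c p. 1, \<lambda>c p. \<mu> c p / \<gamma> c p] ! j"
    have "sqrt_canonical A L2 \<mu>" using nz2 by (intro sqrt_canonicalI L \<mu>) blast
    moreover have "isomorphic_higgs A 4 (direct_sum ?Ls) (cyclic_field ?ss)
      (direct_sum [power_lb L2 3, L2, dual_lb L2, power_lb L2 (- 3)])
      (cyclic_field [\<mu>, \<mu>, \<mu>, \<lambda>c p. q c p * \<mu> c p powi (- 3)])"
    proof (rule isomorphic_higgs_cyclicI[where g = ?g and r = 0])
      fix j c assume j: "j < (4::nat)" and c: "c \<in> A"
      have "holomorphic_in c (\<lambda>p. \<gamma> c p / \<mu> c p)" "holomorphic_in c (\<lambda>p. \<mu> c p / \<gamma> c p)"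
        using nz2 c nz[OF c] by (auto intro!: holomorphic_in_divide[OF A c] \<gamma>_in)
      then show "holomorphic_in c (?g j c)"
        using four[OF j] by (auto simp: holomorphic_in_const)
      fix p assume p: "p \<in> cdom c"
      have nzp: "\<gamma> c p \<noteq> 0" "\<mu> c p \<noteq> 0" using nz nz2 c p by auto
      then show "?g j c p \<noteq> 0" using four[OF j] by auto
      show "?g (Suc j mod 4) c p * (?ss ! j) c p =
          ([\<mu>, \<mu>, \<mu>, \<lambda>c p. q c p * \<mu> c p powi (- 3)] ! ((j + 0) mod 4)) c p * ?g j c p"
        using four[OF j] nzp q[OF c p, symmetric]
        by (auto simp: field_simps power_int_minus power3_eq_cube)
      fix d assume d: "d \<in> A" "p \<in> cdom d"
      have nzd: "\<gamma> d p \<noteq> 0" "\<mu> d p \<noteq> 0" using nz nz2 d by auto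
      show "?g j c p * (?Ls ! j) c d p =
          ([power_lb L2 3, L2, dual_lb L2, power_lb L2 (- 3)] ! ((j + 0) mod 4)) c d p * ?g j d p"
        using four[OF j] nzd change(4-6)[OF c d(1) p d(2)]
        by (auto simp: change(1,2)[OF c d(1) p d(2)] power_lb_def power_int_minus power3_eq_cube field_simps)
    qed auto
    ultimately show ?thesis using hitchin_bundle4I by blast
  next
    assume nz2: "\<forall>c\<in>A. \<forall>p\<in>cdom c. \<nu> c p \<noteq> 0"
    let ?S = "dual_lb L1"
    let ?g = "\<lambda>j. [\<lambda>c p. 1, \<lambda>c p. \<nu> c p / \<gamma> c p, \<lambda>c p. \<gamma> c p / \<nu> c p, \<lambda>c p. 1] ! j"
    have "sqrt_canonical A ?S \<nu>"
      using nz2 \<nu> by (intro sqrt_canonicalI line_bundle_power A L) (simp_all add: dual_dual_lb)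
    moreover have "isomorphic_higgs A 4 (direct_sum ?Ls) (cyclic_field ?ss)
      (direct_sum [power_lb ?S 3, ?S, dual_lb ?S, power_lb ?S (- 3)])
      (cyclic_field [\<nu>, \<nu>, \<nu>, \<lambda>c p. q c p * \<nu> c p powi (- 3)])"
    proof (rule isomorphic_higgs_cyclicI[where g = ?g and r = 2])
      fix j c assume j: "j < (4::nat)" and c: "c \<in> A"
      have "holomorphic_in c (\<lambda>p. \<gamma> c p / \<nu> c p)" "holomorphic_in c (\<lambda>p. \<nu> c p / \<gamma> c p)"
        using nz2 c nz[OF c] by (auto intro!: holomorphic_in_divide[OF A c] \<gamma>_in)
      then show "holomorphic_in c (?g j c)"
        using four[OF j] by (auto simp: holomorphic_in_const)
      fix p assume p: "p \<in> cdom c"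
      have nzp: "\<gamma> c p \<noteq> 0" "\<nu> c p \<noteq> 0" using nz nz2 c p by auto
      then show "?g j c p \<noteq> 0" using four[OF j] by auto
      show "?g (Suc j mod 4) c p * (?ss ! j) c p =
          ([\<nu>, \<nu>, \<nu>, \<lambda>c p. q c p * \<nu> c p powi (- 3)] ! ((j + 2) mod 4)) c p * ?g j c p"
        using four[OF j] nzp q[OF c p, symmetric]
        by (auto simp: field_simps power_int_minus power3_eq_cube)
      fix d assume d: "d \<in> A" "p \<in> cdom d"
      have nzd: "\<gamma> d p \<noteq> 0" "\<nu> d p \<noteq> 0" using nz nz2 d by auto
      show "?g j c p * (?Ls ! j) c d p =
          ([power_lb ?S 3, ?S, dual_lb ?S, power_lb ?S (- 3)] ! ((j + 2) mod 4)) c d p * ?g j d p"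
        using four[OF j] nzd change(4-6)[OF c d(1) p d(2)]
        by (auto simp: change(1,3)[OF c d(1) p d(2)] power_lb_def power_int_minus power3_eq_cube field_simps)
    qed auto
    ultimately show ?thesis using hitchin_bundle4I by blast
  }
qed

section \<open>Comparison of the energies\<close>

lemma mod4_indices:
  "(0 + 4 - 1) mod 4 = (3::nat)" "(1 + 4 - 1) mod 4 = (0::nat)"
  "(2 + 4 - 1) mod 4 = (1::nat)" "(3 + 4 - 1) mod 4 = (2::nat)"
  "Suc 0 mod 4 = 1" "Suc 1 mod 4 = 2" "Suc 2 mod 4 = 3" "Suc 3 mod 4 = 0"
proof -
  have e: "0 + 4 - 1 = (3::nat)" "1 + 4 - 1 = (4::nat)" "2 + 4 - 1 = (5::nat)" "3 + 4 - 1 = (6::nat)"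
    "Suc 0 = 1" "Suc 1 = 2" "Suc 2 = 3" "Suc 3 = 4" by arith+
  show "(0 + 4 - 1) mod 4 = (3::nat)" "(1 + 4 - 1) mod 4 = (0::nat)"
    "(2 + 4 - 1) mod 4 = (1::nat)" "(3 + 4 - 1) mod 4 = (2::nat)"
    "Suc 0 mod 4 = 1" "Suc 1 mod 4 = 2" "Suc 2 mod 4 = 3" "Suc 3 mod 4 = 0"
    unfolding e by simp_all
qed

text \<open>
  Let \<open>M\<close> be the maximum of \<open>F / G\<close>, which is also \<open>x / y\<close> where this makes sense. If \<open>M > 1\<close>, then near a
  maximum \<open>F > G\<close>, hence \<open>x \<ge> y\<close> and \<open>log (F / G)\<close> is subharmonic; by the strong maximum principle \<open>F / G\<close> is
  constant, and its \<open>\<partial>\<partial>\<^sup>* log\<close>, which is \<open>2 (x - y)\<close>, vanishes. The second derivative test alone gives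
  no contradiction, because \<open>x\<close> and \<open>y\<close> may both vanish at a maximum.
\<close>

lemma balanced_le:
  assumes surface: "closed_riemann_surface A"
    and dens: "weight_density A k F" "weight_density A k G" "weight_density A 1 x"
    and pos: "\<And>c p. c \<in> A \<Longrightarrow> p \<in> cdom c \<Longrightarrow> 0 < F c p" "\<And>c p. c \<in> A \<Longrightarrow> p \<in> cdom c \<Longrightarrow> 0 < G c p"
    and y: "\<And>c p. c \<in> A \<Longrightarrow> p \<in> cdom c \<Longrightarrow> 0 \<le> y c p"
    and dF: "\<And>c p. c \<in> A \<Longrightarrow> p \<in> cdom c \<Longrightarrow> log_ddbar c F p (x c p - y c p)"
    and dG: "\<And>c p. c \<in> A \<Longrightarrow> p \<in> cdom c \<Longrightarrow> log_ddbar c G p (y c p - x c p)"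
    and ratio: "\<And>c p. c \<in> A \<Longrightarrow> p \<in> cdom c \<Longrightarrow> x c p * G c p = y c p * F c p"
    and cp: "c \<in> A" "p \<in> cdom c"
  shows "x c p \<le> y c p"
proof -
  obtain M d z where z: "d \<in> A" "z \<in> cdom d" "F d z = M * G d z"
    and le: "\<And>d x. d \<in> A \<Longrightarrow> x \<in> cdom d \<Longrightarrow> F d x \<le> M * G d x"
    using ratio_maximum_point[OF surface dens(1,2) pos(2)] by metis
  have M: "0 < M" using z pos(1)[OF z(1,2)] pos(2)[OF z(1,2)] by (simp add: zero_less_mult_iff)
  show ?thesis
  proof (cases "M \<le> 1")
    case True
    then have "M * G c p \<le> G c p" using pos(2)[OF cp] by simp
    then have "F c p \<le> G c p" using le[OF cp] by linarith
    then have "x c p * G c p \<le> y c p * G c p"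
      unfolding ratio[OF cp] using y[OF cp] by (rule mult_left_mono)
    then show ?thesis using pos(2)[OF cp] by simp
  next
    case False
    define G' where "G' = (\<lambda>c p. M * G c p)"
    have G': "weight_density A k G'" "\<And>c p. c \<in> A \<Longrightarrow> p \<in> cdom c \<Longrightarrow> 0 < G' c p"
      using weight_density_scale[OF dens(2), of M] M pos(2) by (simp_all add: G'_def)
    have dG': "log_ddbar c G' p (y c p - x c p)" if "c \<in> A" "p \<in> cdom c" for c p
      using log_ddbar_scale[OF dG[OF that] M] by (simp add: G'_def)
    have le': "F c p \<le> G' c p" if "c \<in> A" "p \<in> cdom c" for c p
      using le[OF that] by (simp add: G'_def)
    have "(\<forall>c\<in>A. \<forall>p\<in>cdom c. F c p < G' c p) \<or>
        (\<forall>c\<in>A. \<forall>p\<in>cdom c. F c p = G' c p \<and> x c p - y c p = y c p - x c p)"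
    \<comment> \<open>The threshold \<open>1 / M\<close> makes the condition read \<open>F > G\<close>, which forces \<open>x \<ge> y\<close>.\<close>
    proof (rule ratio_strong_maximum[OF surface dens(1) G'(1) dens(3) G'(2) le' dF dG', where \<theta> = "1 / M"])
      fix c p assume cp: "c \<in> A" "p \<in> cdom c" and gt: "1 / M * G' c p < F c p"
      have "G c p \<le> F c p" using gt M by (simp add: G'_def)
      then have "y c p * G c p \<le> x c p * G c p"
        unfolding ratio[OF cp] using y[OF cp] by (rule mult_left_mono)
      then have "y c p \<le> x c p" using pos(2)[OF cp] by simp
      moreover have "x c p * (F c p / G' c p - 1) \<le> 0"
        using weight_density_nonneg[OF dens(3) cp] le'[OF cp] G'(2)[OF cp]
        by (simp add: mult_le_0_iff)
      ultimately show "x c p * (F c p / G' c p - 1) \<le> x c p - y c p - (y c p - x c p)" by linarith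
    qed (use False in auto)
    then show ?thesis
    proof
      assume "\<forall>c\<in>A. \<forall>p\<in>cdom c. F c p < G' c p"
      then have "F d z < G' d z" using z(1,2) by blast
      then show ?thesis using z(3) by (simp add: G'_def)
    next
      assume "\<forall>c\<in>A. \<forall>p\<in>cdom c. F c p = G' c p \<and> x c p - y c p = y c p - x c p"
      then have "x c p - y c p = y c p - x c p" using cp by blast
      then show ?thesis by simp
    qed
  qed
qed

text \<open>
  The quotient of the two densities is \<open>h\<^sub>1 h\<^sub>2 / (h\<^sub>0 h\<^sub>3)\<close>. Its numerator and its denominator are functions on
  the surface, because the lines pair off with their duals, and \<open>balanced_le\<close> applies in both directions.
\<close>

lemma energy_density_symmetric4:
  fixes A :: "'a::t2_space chart set"
  assumes surface: "closed_riemann_surface A"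
    and cyc: "cyclic_bundle A 4 [L1, L2, dual_lb L2, dual_lb L1] [\<gamma>, \<mu>, \<gamma>, \<nu>]"
    and harmonic: "harmonic_metric A 4 (direct_sum [L1, L2, dual_lb L2, dual_lb L1])
      (cyclic_field [\<gamma>, \<mu>, \<gamma>, \<nu>]) H"
    and cp: "c \<in> A" "p \<in> cdom c"
  shows "energy_density H [\<gamma>, \<mu>, \<gamma>, \<nu>] 0 c p = energy_density H [\<gamma>, \<mu>, \<gamma>, \<nu>] 2 c p"
proof -
  let ?Ls = "[L1, L2, dual_lb L2, dual_lb L1]" and ?ss = "[\<gamma>, \<mu>, \<gamma>, \<nu>]"
  let ?e = "energy_density H ?ss" and ?h = "metric_entry H"
  have A: "holomorphic_atlas A" using surface by (simp add: closed_riemann_surface_def)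
  have H: "hermitian_metric A 4 (direct_sum ?Ls) H" using harmonic by (simp add: harmonic_metric_def)
  have pos: "0 < ?h i c p" if "i < 4" "c \<in> A" "p \<in> cdom c" for i c p
    using hermitian_metric_entry(2)[OF H that(2,3,1)] .
  have "\<And>i. i < 4 \<Longrightarrow> line_bundle A (?Ls ! i)" using cyc unfolding cyclic_bundle_def by blast
  from this[of 0] this[of 1] have lb: "line_bundle A L1" "line_bundle A L2" by simp_all
  have change: "?h i d p = (cmod ((?Ls ! i) c d p))\<^sup>2 * ?h i c p"
    if "i < 4" "c \<in> A" "d \<in> A" "p \<in> cdom c" "p \<in> cdom d" for i c d p
    using metric_entry_change[OF H _ that] harmonic that by (simp add: harmonic_metric_def)
  have cont: "continuous_on (coord c ` cdom c) (\<lambda>w. ?h i c (chart_inv c w))" if "i < 4" "c \<in> A" for i c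
    by (rule metric_entry_continuous[OF H that])
  have weight: "weight_density A 0 (\<lambda>c p. ?h i c p * ?h j c p)"
    if "(i, j) \<in> {(1, 2), (0, 3)}" for i j
  proof (rule weight_densityI)
    have ij: "i < 4" "j < 4" using that by auto
    fix c assume c: "c \<in> A"
    show "continuous_on (coord c ` cdom c) (\<lambda>w. ?h i c (chart_inv c w) * ?h j c (chart_inv c w))"
      by (intro continuous_on_mult cont ij c)
    show "0 \<le> ?h i c p * ?h j c p" if "p \<in> cdom c" for p
      using pos[OF ij(1) c that] pos[OF ij(2) c that] by simp
    fix d p assume d: "d \<in> A" "p \<in> cdom c" "p \<in> cdom d"
    have "(cmod ((?Ls ! i) c d p))\<^sup>2 * (cmod ((?Ls ! j) c d p))\<^sup>2 = 1"
    proof -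
      have "cmod z * cmod (z powi (- 1)) = 1" if "z \<noteq> 0" for z
        using that by (simp add: power_int_minus norm_inverse)
      from this[OF line_bundle_nonzero[OF lb(1) c d]] this[OF line_bundle_nonzero[OF lb(2) c d]]
      have "cmod ((?Ls ! 1) c d p) * cmod ((?Ls ! 2) c d p) = 1"
        "cmod ((?Ls ! 0) c d p) * cmod ((?Ls ! 3) c d p) = 1" by (simp_all add: power_lb_def)
      moreover have "i = 1 \<and> j = 2 \<or> i = 0 \<and> j = 3" using that by blast
      ultimately have "cmod ((?Ls ! i) c d p) * cmod ((?Ls ! j) c d p) = 1" by blast
      then show ?thesis by (simp only: power_mult_distrib[symmetric] power_one)
    qed
    then have "((cmod ((?Ls ! i) c d p))\<^sup>2 * (cmod ((?Ls ! j) c d p))\<^sup>2) * (?h i c p * ?h j c p) = ?h i c p * ?h j c p"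
      by (simp only: mult_1_left)
    then show "?h i c p * ?h j c p = cmod (canonical_lb c d p) ^ (2 * 0) * (?h i d p * ?h j d p)"
      unfolding change[OF ij(1) c d] change[OF ij(2) c d] mult_zero_right power_0 by (simp only: mult_ac mult_1_left)
  qed
  have dh: "log_ddbar c (?h i) p (?e ((i + 4 - 1) mod 4) c p - ?e i c p)"
    if "i < 4" "c \<in> A" "p \<in> cdom c" for i c p
    by (rule metric_entry_log_ddbar[OF A harmonic _ that(2,3,1)]) simp
  note dh = dh[of 0, unfolded mod4_indices] dh[of 1, unfolded mod4_indices]
    dh[of 2, unfolded mod4_indices] dh[of 3, unfolded mod4_indices]
  define F G where "F = (\<lambda>c p. ?h 1 c p * ?h 2 c p)" and "G = (\<lambda>c p. ?h 0 c p * ?h 3 c p)"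
  have FG: "weight_density A 0 F" "weight_density A 0 G"
    unfolding F_def G_def by (rule weight, simp)+
  have FG_pos: "0 < F c p" "0 < G c p" if "c \<in> A" "p \<in> cdom c" for c p
    unfolding F_def G_def using pos[OF _ that] by simp_all
  have dF: "log_ddbar c F p (?e 0 c p - ?e 2 c p)" if "c \<in> A" "p \<in> cdom c" for c p
    using log_ddbar_mult[OF dh(2)[OF _ that] dh(3)[OF _ that]] unfolding F_def by simp
  have dG: "log_ddbar c G p (?e 2 c p - ?e 0 c p)" if "c \<in> A" "p \<in> cdom c" for c p
    using log_ddbar_mult[OF dh(1)[OF _ that] dh(4)[OF _ that]] unfolding G_def by simp
  have ratio: "?e 0 c p * G c p = ?e 2 c p * F c p" if "c \<in> A" "p \<in> cdom c" for c p
  proof -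
    have "?e 0 c p = (cmod (\<gamma> c p))\<^sup>2 * ?h 1 c p * inverse (?h 0 c p)"
      "?e 2 c p = (cmod (\<gamma> c p))\<^sup>2 * ?h 3 c p * inverse (?h 2 c p)"
      by (simp_all add: energy_density_def)
    then show ?thesis
      using pos[OF _ that, of 0] pos[OF _ that, of 2] by (simp add: F_def G_def)
  qed
  have e: "weight_density A 1 (?e i)" if "i < 4" for i
    by (rule energy_density_weight[OF A cyc harmonic that])
  have e_nn: "0 \<le> ?e i c p" if "i < 4" "c \<in> A" "p \<in> cdom c" for i c p
    by (rule energy_density_nonneg(1)[OF H _ that(2,3,1)]) simp
  have "?e 0 c p \<le> ?e 2 c p"
    by (rule balanced_le[OF surface FG(1,2) e FG_pos e_nn dF dG ratio cp]) simp_all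
  moreover have "?e 2 c p \<le> ?e 0 c p"
    by (rule balanced_le[OF surface FG(2,1) e FG_pos(2,1) e_nn dG dF ratio[symmetric] cp]) simp_all
  ultimately show ?thesis by simp
qed

lemma symmetric_toda4I:
  assumes "toda_solution A 4 f"
    and eq: "\<And>c p. c \<in> A \<Longrightarrow> p \<in> cdom c \<Longrightarrow> f 0 c p = f 2 c p"
  shows "symmetric_toda4 A (f 0) (f 1) (f 3)"
proof -
  note t = toda_solution_density[OF assms(1)]
  note d = toda_solution_ddbar[OF assms(1), of 0, unfolded mod4_indices]
    toda_solution_ddbar[OF assms(1), of 1, unfolded mod4_indices]
    toda_solution_ddbar[OF assms(1), of 3, unfolded mod4_indices]
  have d0: "log_ddbar c (f 0) p (2 * f 0 c p - f 1 c p - f 3 c p)"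
    if "c \<in> A" "p \<in> cdom c" "0 < f 0 c p" for c p
    using d(1)[OF _ that] by (simp add: algebra_simps)
  have d1: "log_ddbar c (f 1) p (2 * f 1 c p - 2 * f 0 c p)"
    if "c \<in> A" "p \<in> cdom c" "0 < f 1 c p" for c p
    using d(2)[OF _ that] eq[OF that(1,2)] by simp
  have d3: "log_ddbar c (f 3) p (2 * f 3 c p - 2 * f 0 c p)"
    if "c \<in> A" "p \<in> cdom c" "0 < f 3 c p" for c p
    using d(3)[OF _ that] eq[OF that(1,2)] by simp
  have t: "weight_density A 1 (f 0)" "weight_density A 1 (f 1)" "weight_density A 1 (f 3)"
    by (rule t, simp)+
  show ?thesis unfolding symmetric_toda4_def using t d0 d1 d3 by blast
qed

text \<open>
  Components \<open>0\<close> and \<open>2\<close> have the same neighbours.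
\<close>

lemma toda4_symmetric_of_pos:
  assumes surface: "closed_riemann_surface A" and toda: "toda_solution A 4 f"
    and pos: "\<And>c p. c \<in> A \<Longrightarrow> p \<in> cdom c \<Longrightarrow> 0 < f 0 c p" "\<And>c p. c \<in> A \<Longrightarrow> p \<in> cdom c \<Longrightarrow> 0 < f 2 c p"
    and cp: "c \<in> A" "p \<in> cdom c"
  shows "f 0 c p = f 2 c p"
proof -
  note dens = toda_solution_density[OF toda]
  have d0: "log_ddbar c (f 0) p (2 * f 0 c p - f 3 c p - f 1 c p)"
    if "c \<in> A" "p \<in> cdom c" for c p
    using toda_solution_ddbar[OF toda _ that pos(1)[OF that], unfolded mod4_indices] by simp
  have d2: "log_ddbar c (f 2) p (2 * f 2 c p - f 1 c p - f 3 c p)"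
    if "c \<in> A" "p \<in> cdom c" for c p
    using toda_solution_ddbar[OF toda _ that pos(2)[OF that], unfolded mod4_indices] by simp
  have "f 0 c p \<le> f 2 c p"
    by (rule le_of_log_ddbar_difference[OF surface dens dens pos(2) d0 d2 _ _ cp, where k = 2]) auto
  moreover have "f 2 c p \<le> f 0 c p"
    by (rule le_of_log_ddbar_difference[OF surface dens dens pos(1) d2 d0 _ _ cp, where k = 2]) auto
  ultimately show ?thesis by simp
qed

text \<open>
  The metric is positive, so the energy density vanishes exactly at the zeros of the section.
\<close>

lemma exists_zero_energy:
  assumes H: "hermitian_metric A n E H" and ss: "length ss = n" "j < n"
    and zero: "\<not> (\<forall>c\<in>A. \<forall>p\<in>cdom c. (ss ! j) c p \<noteq> 0)"
  shows "\<exists>c\<in>A. \<exists>p\<in>cdom c. energy_density H ss j c p = 0"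
  using zero energy_density_nonneg(2)[OF H ss(1) _ _ ss(2)] by blast

text \<open>
  Both sections have zeros, since otherwise the bundle is isomorphic to one in the Hitchin component.
\<close>

lemma energy_sum_less2:
  fixes A :: "'a::t2_space chart set"
  assumes surface: "closed_riemann_surface A"
    and L: "line_bundle A L" and \<mu>: "twisted_hom A L (dual_lb L) \<mu>" and \<nu>: "twisted_hom A (dual_lb L) L \<nu>"
    and prod: "\<And>c p. c \<in> A \<Longrightarrow> p \<in> cdom c \<Longrightarrow> \<mu> c p * \<nu> c p = q c p"
    and distinct: "\<And>F \<psi>. hitchin_bundle A 2 q F \<psi> \<Longrightarrow>
      \<not> isomorphic_higgs A 2 (direct_sum [L, dual_lb L]) (cyclic_field [\<mu>, \<nu>]) F \<psi>"
    and cyc: "cyclic_bundle A 2 [L, dual_lb L] [\<mu>, \<nu>]"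
    and harmonic: "harmonic_metric A 2 (direct_sum [L, dual_lb L]) (cyclic_field [\<mu>, \<nu>]) H"
    and g: "toda_solution A 2 g" and pos: "\<And>j c p. j < 1 \<Longrightarrow> c \<in> A \<Longrightarrow> p \<in> cdom c \<Longrightarrow> 0 < g j c p"
    and prods: "\<And>c p. c \<in> A \<Longrightarrow> p \<in> cdom c \<Longrightarrow>
      (\<Prod>j<2. energy_density H [\<mu>, \<nu>] j c p) = (\<Prod>j<2. g j c p)"
    and cp: "c \<in> A" "p \<in> cdom c"
  shows "(\<Sum>j<2. energy_density H [\<mu>, \<nu>] j c p) < (\<Sum>j<2. g j c p)"
proof -
  let ?f = "energy_density H [\<mu>, \<nu>]"
  have A: "holomorphic_atlas A" using surface by (simp add: closed_riemann_surface_def)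
  have H: "hermitian_metric A 2 (direct_sum [L, dual_lb L]) H" using harmonic by (simp add: harmonic_metric_def)
  have f: "toda_solution A 2 ?f" by (rule toda_solution_harmonic[OF A cyc harmonic])
  have idx: "(0 + 2 - 1) mod 2 = (1::nat)" "(1 + 2 - 1) mod 2 = (0::nat)" "Suc 0 mod 2 = 1" "Suc 1 mod 2 = 0"
    by simp_all
  have no_nz: "\<not> ((\<forall>c\<in>A. \<forall>p\<in>cdom c. \<mu> c p \<noteq> 0) \<or> (\<forall>c\<in>A. \<forall>p\<in>cdom c. \<nu> c p \<noteq> 0))"
    using isomorphic_hitchin2[OF A L \<mu> \<nu> prod] distinct by blast
  have zero: "\<exists>c\<in>A. \<exists>p\<in>cdom c. ?f 0 c p = 0" "\<exists>c\<in>A. \<exists>p\<in>cdom c. ?f 1 c p = 0"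
    using exists_zero_energy[OF H, of "[\<mu>, \<nu>]" 0] exists_zero_energy[OF H, of "[\<mu>, \<nu>]" 1] no_nz by auto
  note df = toda_solution_ddbar[OF f, of 0, unfolded idx] toda_solution_ddbar[OF f, of 1, unfolded idx]
  have d0: "log_ddbar c (?f 0) p (2 * ?f 0 c p - 2 * ?f 1 c p)" if "c \<in> A" "p \<in> cdom c" "0 < ?f 0 c p" for c p
    using df(1)[OF _ that] by simp
  have d1: "log_ddbar c (?f 1) p (2 * ?f 1 c p - 2 * ?f 0 c p)" if "c \<in> A" "p \<in> cdom c" "0 < ?f 1 c p" for c p
    using df(2)[OF _ that] by simp
  have g0: "0 < g 0 c p" if "c \<in> A" "p \<in> cdom c" for c p using pos[OF _ that] by simp
  have dg: "log_ddbar c (g 0) p (2 * g 0 c p - 2 * g 1 c p)" if "c \<in> A" "p \<in> cdom c" for c p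
    using toda_solution_ddbar[OF g _ that g0[OF that], unfolded idx] by simp
  have prod2: "?f 0 c p * ?f 1 c p = g 0 c p * g 1 c p" if "c \<in> A" "p \<in> cdom c" for c p
    using prods[OF that] by (simp add: numeral_2_eq_2)
  have fd: "weight_density A 1 (?f j)" and gd: "weight_density A 1 (g j)" if "j < 2" for j
    by (rule toda_solution_density[OF f that] toda_solution_density[OF g that])+
  have "?f 0 c p + ?f 1 c p < g 0 c p + g 1 c p"
    by (rule toda2_sum_less[OF surface fd fd gd gd g0 d0 d1 dg prod2 zero cp]) simp_all
  then show ?thesis by (simp add: numeral_2_eq_2)
qed

text \<open>
  The section \<open>\<mu>\<close> has a zero, since otherwise the bundle is isomorphic to one in the Hitchin component;
  so two of the three energy densities have zeros.
\<close>

lemma energy_sum_less3: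
  fixes A :: "'a::t2_space chart set"
  assumes surface: "closed_riemann_surface A"
    and L: "line_bundle A L" and \<mu>: "twisted_hom A L trivial_lb \<mu>"
    and prod: "\<And>c p. c \<in> A \<Longrightarrow> p \<in> cdom c \<Longrightarrow> \<mu> c p * \<mu> c p * \<nu> c p = q c p"
    and distinct: "\<And>F \<psi>. hitchin_bundle A 3 q F \<psi> \<Longrightarrow>
      \<not> isomorphic_higgs A 3 (direct_sum [L, trivial_lb, dual_lb L]) (cyclic_field [\<mu>, \<mu>, \<nu>]) F \<psi>"
    and cyc: "cyclic_bundle A 3 [L, trivial_lb, dual_lb L] [\<mu>, \<mu>, \<nu>]"
    and harmonic: "harmonic_metric A 3 (direct_sum [L, trivial_lb, dual_lb L]) (cyclic_field [\<mu>, \<mu>, \<nu>]) H"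
    and g: "toda_solution A 3 g" and pos: "\<And>j c p. j < 2 \<Longrightarrow> c \<in> A \<Longrightarrow> p \<in> cdom c \<Longrightarrow> 0 < g j c p"
    and prods: "\<And>c p. c \<in> A \<Longrightarrow> p \<in> cdom c \<Longrightarrow>
      (\<Prod>j<3. energy_density H [\<mu>, \<mu>, \<nu>] j c p) = (\<Prod>j<3. g j c p)"
    and cp: "c \<in> A" "p \<in> cdom c"
  shows "(\<Sum>j<3. energy_density H [\<mu>, \<mu>, \<nu>] j c p) < (\<Sum>j<3. g j c p)"
proof -
  let ?f = "energy_density H [\<mu>, \<mu>, \<nu>]"
  have A: "holomorphic_atlas A" using surface by (simp add: closed_riemann_surface_def)
  have H: "hermitian_metric A 3 (direct_sum [L, trivial_lb, dual_lb L]) H" using harmonic by (simp add: harmonic_metric_def)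
  have f: "toda_solution A 3 ?f" by (rule toda_solution_harmonic[OF A cyc harmonic])
  have three: "{..<3} = {0, 1, 2::nat}" by auto
  have no_nz: "\<not> (\<forall>c\<in>A. \<forall>p\<in>cdom c. \<mu> c p \<noteq> 0)"
    using isomorphic_hitchin3[OF A L \<mu> prod] distinct by blast
  have zero: "\<exists>c\<in>A. \<exists>p\<in>cdom c. ?f 0 c p = 0" "\<exists>c\<in>A. \<exists>p\<in>cdom c. ?f 1 c p = 0"
    using exists_zero_energy[OF H, of "[\<mu>, \<mu>, \<nu>]" 0] exists_zero_energy[OF H, of "[\<mu>, \<mu>, \<nu>]" 1] no_nz by auto
  have prod3: "?f 0 c p * ?f 1 c p * ?f 2 c p = g 0 c p * g 1 c p * g 2 c p" if "c \<in> A" "p \<in> cdom c" for c p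
    using prods[OF that] unfolding three by (simp add: mult.assoc)
  have "?f 0 c p + ?f 1 c p + ?f 2 c p < g 0 c p + g 1 c p + g 2 c p"
    by (rule toda3_sum_less[OF surface f g pos pos prod3 zero cp]) simp_all
  then show ?thesis unfolding three by (simp add: add.assoc)
qed

text \<open>
  The products \<open>\<gamma> \<mu>\<close> and \<open>\<gamma> \<nu>\<close> both have zeros, since otherwise the bundle is isomorphic to one in the
  Hitchin component.
\<close>

lemma energy_sum_less4:
  fixes A :: "'a::t2_space chart set"
  assumes surface: "closed_riemann_surface A"
    and L: "line_bundle A L1" "line_bundle A L2" and \<gamma>: "twisted_hom A L1 L2 \<gamma>"
    and \<mu>: "twisted_hom A L2 (dual_lb L2) \<mu>" and \<nu>: "twisted_hom A (dual_lb L1) L1 \<nu>"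
    and prod: "\<And>c p. c \<in> A \<Longrightarrow> p \<in> cdom c \<Longrightarrow> \<gamma> c p * \<mu> c p * \<gamma> c p * \<nu> c p = q c p"
    and distinct: "\<And>F \<psi>. hitchin_bundle A 4 q F \<psi> \<Longrightarrow>
      \<not> isomorphic_higgs A 4 (direct_sum [L1, L2, dual_lb L2, dual_lb L1]) (cyclic_field [\<gamma>, \<mu>, \<gamma>, \<nu>]) F \<psi>"
    and cyc: "cyclic_bundle A 4 [L1, L2, dual_lb L2, dual_lb L1] [\<gamma>, \<mu>, \<gamma>, \<nu>]"
    and harmonic: "harmonic_metric A 4 (direct_sum [L1, L2, dual_lb L2, dual_lb L1])
      (cyclic_field [\<gamma>, \<mu>, \<gamma>, \<nu>]) H"
    and g: "toda_solution A 4 g" and pos: "\<And>j c p. j < 3 \<Longrightarrow> c \<in> A \<Longrightarrow> p \<in> cdom c \<Longrightarrow> 0 < g j c p"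
    and prods: "\<And>c p. c \<in> A \<Longrightarrow> p \<in> cdom c \<Longrightarrow>
      (\<Prod>j<4. energy_density H [\<gamma>, \<mu>, \<gamma>, \<nu>] j c p) = (\<Prod>j<4. g j c p)"
    and cp: "c \<in> A" "p \<in> cdom c"
  shows "(\<Sum>j<4. energy_density H [\<gamma>, \<mu>, \<gamma>, \<nu>] j c p) < (\<Sum>j<4. g j c p)"
proof -
  let ?ss = "[\<gamma>, \<mu>, \<gamma>, \<nu>]"
  let ?f = "energy_density H ?ss"
  have A: "holomorphic_atlas A" using surface by (simp add: closed_riemann_surface_def)
  have H: "hermitian_metric A 4 (direct_sum [L1, L2, dual_lb L2, dual_lb L1]) H"
    using harmonic by (simp add: harmonic_metric_def)
  have f: "toda_solution A 4 ?f" by (rule toda_solution_harmonic[OF A cyc harmonic])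
  have four: "{..<4} = {0, 1, 2, 3::nat}" by auto
  have pos': "0 < g 0 c p" "0 < g 1 c p" "0 < g 2 c p" if "c \<in> A" "p \<in> cdom c" for c p
    using pos[OF _ that] by simp_all
  have f_eq: "?f 0 c p = ?f 2 c p" if "c \<in> A" "p \<in> cdom c" for c p
    by (rule energy_density_symmetric4[OF surface cyc harmonic that])
  have g_eq: "g 0 c p = g 2 c p" if "c \<in> A" "p \<in> cdom c" for c p
    by (rule toda4_symmetric_of_pos[OF surface g pos'(1) pos'(3) that])
  have no_nz: "\<not> ((\<forall>c\<in>A. \<forall>p\<in>cdom c. \<gamma> c p \<noteq> 0) \<and>
      ((\<forall>c\<in>A. \<forall>p\<in>cdom c. \<mu> c p \<noteq> 0) \<or> (\<forall>c\<in>A. \<forall>p\<in>cdom c. \<nu> c p \<noteq> 0)))"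
    using isomorphic_hitchin4[OF A L \<gamma> \<mu> \<nu> prod] distinct by blast
  have zero_iff: "?f j c p = 0 \<longleftrightarrow> (?ss ! j) c p = 0" if "j < 4" "c \<in> A" "p \<in> cdom c" for j c p
    by (rule energy_density_nonneg(2)[OF H _ that(2,3,1)]) simp
  have zero: "\<exists>c\<in>A. \<exists>p\<in>cdom c. ?f 0 c p * ?f 1 c p = 0" "\<exists>c\<in>A. \<exists>p\<in>cdom c. ?f 0 c p * ?f 3 c p = 0"
  proof -
    have *: "\<exists>c\<in>A. \<exists>p\<in>cdom c. ?f 0 c p * ?f i c p = 0"
      if i: "i < 4" and z: "\<exists>c\<in>A. \<exists>p\<in>cdom c. (?ss ! 0) c p = 0 \<or> (?ss ! i) c p = 0" for i
    proof -
      obtain d x where x: "d \<in> A" "x \<in> cdom d" "(?ss ! 0) d x = 0 \<or> (?ss ! i) d x = 0" using z by blast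
      then have "?f 0 d x = 0 \<or> ?f i d x = 0" using zero_iff[OF _ x(1,2), of 0] zero_iff[OF i x(1,2)] by simp
      then show ?thesis using x(1,2) by (intro bexI[of _ d] bexI[of _ x]) auto
    qed
    have "(\<exists>c\<in>A. \<exists>p\<in>cdom c. \<gamma> c p = 0 \<or> \<mu> c p = 0)" "(\<exists>c\<in>A. \<exists>p\<in>cdom c. \<gamma> c p = 0 \<or> \<nu> c p = 0)"
      using no_nz by blast+
    then show "\<exists>c\<in>A. \<exists>p\<in>cdom c. ?f 0 c p * ?f 1 c p = 0" "\<exists>c\<in>A. \<exists>p\<in>cdom c. ?f 0 c p * ?f 3 c p = 0"
      using *[of 1] *[of 3] by simp_all
  qed
  have prod4: "(?f 0 c p)\<^sup>2 * ?f 1 c p * ?f 3 c p = (g 0 c p)\<^sup>2 * g 1 c p * g 3 c p"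
    if "c \<in> A" "p \<in> cdom c" for c p
    using prods[OF that] f_eq[OF that] g_eq[OF that] unfolding four
    by (simp add: power2_eq_square mult_ac)
  interpret toda4_comparison A "?f 0" "?f 1" "?f 3" "g 0" "g 1" "g 3"
    by (rule toda4_comparison.intro[OF surface symmetric_toda4I[OF f f_eq] symmetric_toda4I[OF g g_eq]
          pos'(1) pos'(2) prod4])
  have "2 * ?f 0 c p + ?f 1 c p + ?f 3 c p < 2 * g 0 c p + g 1 c p + g 3 c p"
    by (rule sum_less[OF zero cp])
  then show ?thesis using f_eq[OF cp] g_eq[OF cp] unfolding four by simp
qed

theorem theorem1p9:
  fixes A :: "'a::t2_space chart set" and n genus :: nat
    and q :: "'a section_of"
    and E E' :: "'a vbundle" and \<phi> \<phi>' H H' :: "'a matrix_field"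
  assumes n: "n \<in> {2, 3, 4}"
    and surface: "closed_riemann_surface A"
    and genus: "has_genus (euclidean :: 'a topology) genus" "2 \<le> genus"
    and q: "holomorphic_differential A n q"
    and hitchin: "hitchin_bundle A n q E' \<phi>'"
    and cyclic: "cyclic_SLR A n E \<phi>"
    and distinct: "\<And>F \<psi>. hitchin_bundle A n q F \<psi> \<Longrightarrow> \<not> isomorphic_higgs A n E \<phi> F \<psi>"
    and det: "\<And>c p. c \<in> A \<Longrightarrow> p \<in> cdom c \<Longrightarrow> Determinant.det (\<phi> c p) = (-1) ^ (n - 1) * q c p"
    and harmonic: "harmonic_metric A n E \<phi> H"
    and harmonic': "harmonic_metric A n E' \<phi>' H'"
  shows "\<forall>c\<in>A. \<forall>p\<in>cdom c. \<forall>v. v \<noteq> 0 \<longrightarrow>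
           0 < pullback_metric n H' \<phi>' c p v v - pullback_metric n H \<phi> c p v v"
proof (intro ballI allI impI)
  fix c p and v :: complex assume cp: "c \<in> A" "p \<in> cdom c" and v: "v \<noteq> 0"
  have A: "holomorphic_atlas A" using surface by (simp add: closed_riemann_surface_def)
  have n2: "2 \<le> n" using n by auto
  obtain Ms ts where E': "E' = direct_sum Ms" "\<phi>' = cyclic_field ts" and cyc': "cyclic_bundle A n Ms ts"
    and nz: "\<And>j c p. j < n - 1 \<Longrightarrow> c \<in> A \<Longrightarrow> p \<in> cdom c \<Longrightarrow> (ts ! j) c p \<noteq> 0"
    and prod': "\<And>c p. c \<in> A \<Longrightarrow> p \<in> cdom c \<Longrightarrow> (\<Prod>j<n. (ts ! j) c p) = q c p"
    using hitchin_bundle_is_cyclic[OF A n q hitchin] by blast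
  note h' = harmonic'[unfolded E']
  have H': "hermitian_metric A n (direct_sum Ms) H'" and H: "hermitian_metric A n E H"
    using h' harmonic by (simp_all add: harmonic_metric_def)
  have diag: "diagonal_mat (H c p)" "diagonal_mat (H' c p)"
    using harmonic harmonic' cp by (simp_all add: harmonic_metric_def)
  have ts: "length ts = n" using cyc' by (simp add: cyclic_bundle_def)
  define g where "g = energy_density H' ts"
  have g: "toda_solution A n g" unfolding g_def by (rule toda_solution_harmonic[OF A cyc' h'])
  have pos: "0 < g j c p" if "j < n - 1" "c \<in> A" "p \<in> cdom c" for j c p
  proof -
    have "j < n" using that(1) by simp
    then show ?thesis
      using energy_density_nonneg[OF H' ts that(2,3) \<open>j < n\<close>] nz[OF that] unfolding g_def by linarith
  qed
  have prod: "(\<Prod>j<n. (ss ! j) c p) = q c p"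
    if "\<phi> = cyclic_field ss" "length ss = n" "c \<in> A" "p \<in> cdom c" for ss c p
    using det[OF that(3,4)] det_cyclic_field[of ss "n - 1" c p] that(1,2) n2 by simp
  have prods: "(\<Prod>j<n. energy_density H ss j c p) = (\<Prod>j<n. g j c p)"
    if "\<phi> = cyclic_field ss" "length ss = n" "c \<in> A" "p \<in> cdom c" for ss c p
    unfolding g_def energy_density_prod[OF H that(3,4,2) order.strict_trans2[OF zero_less_numeral n2]]
      energy_density_prod[OF H' that(3,4) ts order.strict_trans2[OF zero_less_numeral n2]]
      prod[OF that] prod'[OF that(3,4)] ..
  have "\<exists>ss. \<phi> = cyclic_field ss \<and> length ss = n \<and>
      (\<Sum>j<n. energy_density H ss j c p) < (\<Sum>j<n. g j c p)"
    using cyclic unfolding cyclic_SLR_def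
  proof (elim disjE conjE)
    assume n: "n = 2" and "cyclic_SL2R A E \<phi>"
    then obtain L \<mu> \<nu> where L: "line_bundle A L" and \<mu>: "twisted_hom A L (dual_lb L) \<mu>"
      and \<nu>: "twisted_hom A (dual_lb L) L \<nu>"
      and E: "E = direct_sum [L, dual_lb L]" "\<phi> = cyclic_field [\<mu>, \<nu>]"
      unfolding cyclic_SL2R_def by blast
    have cyc: "cyclic_bundle A 2 [L, dual_lb L] [\<mu>, \<nu>]"
      using L \<mu> \<nu> line_bundle_power[OF A L] by (simp add: cyclic_bundle_def less_2_cases_iff all_conj_distrib)
    have "(\<Sum>j<2. energy_density H [\<mu>, \<nu>] j c p) < (\<Sum>j<2. g j c p)"
    proof (rule energy_sum_less2[OF surface L \<mu> \<nu> _ _ cyc _ _ _ _ cp])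
      show "\<mu> c p * \<nu> c p = q c p" if "c \<in> A" "p \<in> cdom c" for c p
        using prod[OF E(2) _ that] by (simp add: n numeral_2_eq_2)
      show "\<not> isomorphic_higgs A 2 (direct_sum [L, dual_lb L]) (cyclic_field [\<mu>, \<nu>]) F \<psi>"
        if "hitchin_bundle A 2 q F \<psi>" for F \<psi>
        using distinct[unfolded n E, OF that] .
    qed (use harmonic[unfolded n E] g pos prods[OF E(2)] in \<open>simp_all add: n\<close>)
    then show ?thesis using E(2) n by (intro exI[of _ "[\<mu>, \<nu>]"]) simp
  next
    assume n: "n = 3" and "cyclic_SL3R A E \<phi>"
    then obtain L \<mu> \<nu> where L: "line_bundle A L" and \<mu>: "twisted_hom A L trivial_lb \<mu>"
      "twisted_hom A trivial_lb (dual_lb L) \<mu>" and \<nu>: "twisted_hom A (dual_lb L) L \<nu>"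
      and E: "E = direct_sum [L, trivial_lb, dual_lb L]" "\<phi> = cyclic_field [\<mu>, \<mu>, \<nu>]"
      unfolding cyclic_SL3R_def by blast
    have "line_bundle A ([L, trivial_lb, dual_lb L] ! i) \<and> twisted_hom A ([L, trivial_lb, dual_lb L] ! i)
        ([L, trivial_lb, dual_lb L] ! (Suc i mod 3)) ([\<mu>, \<mu>, \<nu>] ! i)" if "i < 3" for i
    proof -
      have "i = 0 \<or> i = 1 \<or> i = 2" using that by auto
      then show ?thesis using L \<mu> \<nu> line_bundle_trivial line_bundle_power[OF A L] by (elim disjE) simp_all
    qed
    then have cyc: "cyclic_bundle A 3 [L, trivial_lb, dual_lb L] [\<mu>, \<mu>, \<nu>]" by (simp add: cyclic_bundle_def)
    have three: "{..<3} = {0, 1, 2::nat}" by auto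
    have "(\<Sum>j<3. energy_density H [\<mu>, \<mu>, \<nu>] j c p) < (\<Sum>j<3. g j c p)"
    proof (rule energy_sum_less3[OF surface L \<mu>(1) _ _ cyc _ _ _ _ cp])
      show "\<mu> c p * \<mu> c p * \<nu> c p = q c p" if "c \<in> A" "p \<in> cdom c" for c p
        using prod[OF E(2) _ that] unfolding n three by (simp add: mult.assoc)
      show "\<not> isomorphic_higgs A 3 (direct_sum [L, trivial_lb, dual_lb L]) (cyclic_field [\<mu>, \<mu>, \<nu>]) F \<psi>"
        if "hitchin_bundle A 3 q F \<psi>" for F \<psi>
        using distinct[unfolded n E, OF that] .
    qed (use harmonic[unfolded n E] g pos prods[OF E(2)] in \<open>simp_all add: n\<close>)
    then show ?thesis using E(2) n by (intro exI[of _ "[\<mu>, \<mu>, \<nu>]"]) simp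
  next
    assume n: "n = 4" and "cyclic_SL4R A E \<phi>"
    then obtain L1 L2 \<gamma> \<mu> \<nu> where L: "line_bundle A L1" "line_bundle A L2"
      and \<gamma>: "twisted_hom A L1 L2 \<gamma>" "twisted_hom A (dual_lb L2) (dual_lb L1) \<gamma>"
      and \<mu>: "twisted_hom A L2 (dual_lb L2) \<mu>" and \<nu>: "twisted_hom A (dual_lb L1) L1 \<nu>"
      and E: "E = direct_sum [L1, L2, dual_lb L2, dual_lb L1]" "\<phi> = cyclic_field [\<gamma>, \<mu>, \<gamma>, \<nu>]"
      unfolding cyclic_SL4R_def by blast
    let ?Ls = "[L1, L2, dual_lb L2, dual_lb L1]" and ?ss = "[\<gamma>, \<mu>, \<gamma>, \<nu>]"
    have "line_bundle A (?Ls ! i) \<and> twisted_hom A (?Ls ! i) (?Ls ! (Suc i mod 4)) (?ss ! i)" if "i < 4" for i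
    proof -
      have "i = 0 \<or> i = 1 \<or> i = 2 \<or> i = 3" using that by auto
      then show ?thesis using L \<gamma> \<mu> \<nu> line_bundle_power[OF A] by (elim disjE) simp_all
    qed
    then have cyc: "cyclic_bundle A 4 ?Ls ?ss" by (simp add: cyclic_bundle_def)
    have four: "{..<4} = {0, 1, 2, 3::nat}" by auto
    have "(\<Sum>j<4. energy_density H ?ss j c p) < (\<Sum>j<4. g j c p)"
    proof (rule energy_sum_less4[OF surface L \<gamma>(1) \<mu> \<nu> _ _ cyc _ _ _ _ cp])
      show "\<gamma> c p * \<mu> c p * \<gamma> c p * \<nu> c p = q c p" if "c \<in> A" "p \<in> cdom c" for c p
        using prod[OF E(2) _ that] unfolding n four by (simp add: mult.assoc)
      show "\<not> isomorphic_higgs A 4 (direct_sum ?Ls) (cyclic_field ?ss) F \<psi>"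
        if "hitchin_bundle A 4 q F \<psi>" for F \<psi>
        using distinct[unfolded n E, OF that] .
    qed (use harmonic[unfolded n E] g pos prods[OF E(2)] in \<open>simp_all add: n\<close>)
    then show ?thesis using E(2) n by (intro exI[of _ ?ss]) simp
  qed
  then obtain ss where ss: "\<phi> = cyclic_field ss" "length ss = n"
    "(\<Sum>j<n. energy_density H ss j c p) < (\<Sum>j<n. energy_density H' ts j c p)"
    unfolding g_def by blast
  have "(\<Prod>j<n. (ss ! j) c p) = (\<Prod>j<n. (ts ! j) c p)"
    using prod[OF ss(1,2) cp] prod'[OF cp] by simp
  then show "0 < pullback_metric n H' \<phi>' c p v v - pullback_metric n H \<phi> c p v v"
    unfolding E'(2) ss(1)
    by (rule pullback_metric_less[where H = H and H' = H', OF H diag(1) ss(2) H' diag(2) ts cp n2 _ ss(3) v])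
qed

end
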